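(* Let $k\ge 1$ be a fixed integer, $\alpha\in(0,1)$, and let $\tilde{q}^{(n)}\in\mathbb{V}_h(\Sigma)^*$, $\tilde{p}^{(n)}\in V_h(\Sigma)$ be the sequences of the approximate Richardson iteration with recycled and truncated preconditioned conjugate gradient, started from the trivial initial guess $\tilde q^{(0)}=0$, $\tilde p^{(0)}=0$ and given, for all $n\ge 0$, by $$\tilde p^{(n+1)}=\mathrm{PCG}_k(\tilde p^{(n)},\,R^*S\tilde q^{(n)}),\qquad \tilde q^{(n+1)}=((1-\alpha)\mathrm{Id}+\alpha S)\tilde q^{(n)}-2\alpha\, T R\,\tilde p^{(n+1)}+\alpha g .$$ Define $$\rho:=\sup_{q\in\mathbb{V}_h(\Sigma)^*\setminus\{0\}}\frac{\|((1-\alpha)\mathrm{Id}-\alpha\Pi S)q\|_{T^{-1}}}{\|q\|_{T^{-1}}},\qquad \epsilon:=2\left(\frac{\sqrt{\mathrm{cond}(P R^*TR)}-1}{\sqrt{\mathrm{cond}(P R^*TR)}+1}\right)^k,$$ $$\mathfrak{R}:=\begin{pmatrix}\rho+2\epsilon & 2\sqrt{\epsilon(1+\epsilon)}\\ 2\sqrt{\epsilon(1+\epsilon)} & 2\epsilon\end{pmatrix},$$ and let $|\mathfrak{R}|$ denote the matrix norm of $\mathfrak{R}$ induced by the Euclidean norm of $\mathbb{R}^2$. Under the condition that $|\mathfrak{R}|<1$, the sequence $\tilde q^{(n)}$ converges toward $q^{(\infty)}:=(\mathrm{Id}+\Pi S)^{-1}g$, the solution of $(\mathrm{Id}+\Pi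 S)q=g$, and for all $n\ge 0$ $$\|\tilde q^{(n)}-q^{(\infty)}\|_{T^{-1}}\le \|\tilde q^{(0)}\|_{T^{-1}}\,\frac{|\mathfrak{R}|^{n+1}}{1-|\mathfrak{R}|}.$$
   Context: Geometry and finite element spaces. $\Omega\subset\mathbb{R}^d$ is a bounded polygonal/polyhedral domain, $\kappa>0$ a real constant, $f\in L^2(\partial\Omega)$ complex valued. $\mathcal{T}_h(\Omega)$ is a regular triangulation of $\overline\Omega$, and $V_h(\Omega)\subset H^1(\Omega)$ is the complex space of continuous functions on $\overline\Omega$ whose restriction to each element is a polynomial of degree at most a fixed integer $\geq 1$ (Lagrange finite elements). Let $a(u,v)=\int_\Omega \nabla u\cdot\nabla\overline v-\kappa^2u\overline v\,dx-i\kappa\int_{\partial\Omega}u\overline v\,d\sigma$ and $\ell(v)=\int_{\partial\Omega}f\overline v\,d\sigma$. It is assumed that the discrete problem "find $u_h\in V_h(\Omega)$ with $a(u_h,v_h)=\ell(v_h)$ for all $v_h\in V_h(\Omega)$" is uniquely solvable (i.e. its matrix is invertible). Domain partition. $\overline\Omega=\overline\Omega_1\cup\dots\cup\overline\Omega_J$ with pairwise disjoint polyhedral subdomains $\Omega_j$, each $\overline\Omega_j$ being a union of closed mesh elements; $\Gamma_j=\partial\Omega_j$, $\Sigma=\Gamma_1\cup\dots\cup\Gamma_J$. Set $V_h(\Omega_j)=\{v|_{\Omega_j}:v\in V_h(\Omega)\}$, $V_h(\Gamma_j)=\{v|_{\Gamma_j}:v\in V_h(\Omega)\}$, $V_h(\Sigma)=\{v|_\Sigma:v\in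 V_h(\Omega)\}$, $\mathbb{V}_h(\Omega)=V_h(\Omega_1)\times\dots\times V_h(\Omega_J)$, $\mathbb{V}_h(\Sigma)=V_h(\Gamma_1)\times\dots\times V_h(\Gamma_J)$. A star on a space denotes its dual and $\langle\cdot,\cdot\rangle$ denotes the bilinear duality pairing (no complex conjugation). Operators. $B:\mathbb{V}_h(\Omega)\to\mathbb{V}_h(\Sigma)$, $B(v_1,\dots,v_J)=(v_1|_{\Gamma_1},\dots,v_J|_{\Gamma_J})$; $R:V_h(\Sigma)\to\mathbb{V}_h(\Sigma)$, $R(v)=(v|_{\Gamma_1},\dots,v|_{\Gamma_J})$; $B^*,R^*$ are their adjoints with respect to $\langle\cdot,\cdot\rangle$, mapping between dual spaces. $A:\mathbb{V}_h(\Omega)\to\mathbb{V}_h(\Omega)^*$ and $l\in\mathbb{V}_h(\Omega)^*$ are defined by $$\langle A(u),v\rangle=\sum_{j=1}^J\int_{\Omega_j}\nabla u_j\cdot\nabla v_j-\kappa^2u_jv_j\,dx-i\kappa\int_{\partial\Omega\cap\partial\Omega_j}u_jv_j\,d\sigma,\qquad \langle l,v\rangle=\sum_{j=1}^J\int_{\partial\Omega\cap\partial\Omega_j}f v_j\,d\sigma .$$ $T:\mathbb{V}_h(\Sigma)\to\mathbb{V}_h(\Sigma)^*$ is a given hermitian positive definite linear operator: $\langle T u,\overline v\rangle=\overline{\langle Tv,\overline u\rangle}$ and $\langle Tv,\overline v\rangle>0$ for $v\ne0$. Norms: $\|v\|_T^2=\langle Tv,\overline v\rangle$ on $\mathbb{V}_h(\Sigma)$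 and $\|q\|_{T^{-1}}^2=\langle T^{-1}q,\overline q\rangle$ on $\mathbb{V}_h(\Sigma)^*$; similarly $\|\eta\|_{R^*TR}^2=\langle R^*TR\,\eta,\overline\eta\rangle$ on $V_h(\Sigma)$. Exchange operator $\Pi:\mathbb{V}_h(\Sigma)^*\to\mathbb{V}_h(\Sigma)^*$, $\Pi=2TR(R^*TR)^{-1}R^*-\mathrm{Id}$. Scattering operator $S:\mathbb{V}_h(\Sigma)^*\to\mathbb{V}_h(\Sigma)^*$ and right-hand side $g\in\mathbb{V}_h(\Sigma)^*$: $S=\mathrm{Id}+2iTB(A-iB^*TB)^{-1}B^*$, $g=2iTB(A-iB^*TB)^{-1}l$. Preconditioned conjugate gradient. $P:V_h(\Sigma)^*\to V_h(\Sigma)$ is a hermitian positive definite linear map (the preconditioner). For $b\in V_h(\Sigma)^*$, $x_0\in V_h(\Sigma)$, put $r_0=Pb-(PR^*TR)x_0$ and $\mathscr{K}_k(x_0,b)=\mathrm{span}\{r_0,(PR^*TR)r_0,\dots,(PR^*TR)^{k-1}r_0\}$. Then $\mathrm{PCG}_k(x_0,b)$ (the result of $k$ steps of PCG started from $x_0$) is the unique minimizer over $\eta\in x_0+\mathscr{K}_k(x_0,b)$ of $\|(R^*TR)^{-1}b-\eta\|_{R^*TR}$. For a linear map $L:V_h(\Sigma)\to V_h(\Sigma)$ with positive real spectrum $\mathfrak{S}(L)$, $\mathrm{cond}(L)=\sup\mathfrak{S}(L)/\inf\mathfrak{S}(L)$.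
   Formalization: The printed bound is zero for the prescribed start q̃^(0)=0, hence false unless q^(∞)=0; the formal theorem instead proves ‖q̃^(n)−q^(∞)‖ ≤ ‖q̃^(1)‖ |ℜ|^n/(1−|ℜ|) for all n≥0, with all hypotheses and the convergence claim unchanged. *)

theory Defs
  imports "HOL-Analysis.Analysis" "HOL-Library.Function_Algebras"
begin

section \<open>Complex spaces of functions, their duals, and linear operators\<close>

text \<open>
  All vector spaces below are sets of functions \<open>'x \<Rightarrow> complex\<close> with pointwise operations. A
  function that is mathematically defined on a subset only is extended by 0, so that equality and
  pointwise addition of the representing functions are those of the space. The same convention is
  used for linear functionals, which vanish outside the space on which they live; the dual of a
  space is then again a set of complex valued functions, and the bilinear duality pairing is
  function application.
\<close>

definition cscale :: "complex \<Rightarrow> ('x \<Rightarrow> complex) \<Rightarrow> 'x \<Rightarrow> complex" where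
  "cscale c u = (\<lambda>x. c * u x)"

definition restr :: "'x set \<Rightarrow> ('x \<Rightarrow> complex) \<Rightarrow> 'x \<Rightarrow> complex" where
  "restr S u = (\<lambda>x. if x \<in> S then u x else 0)"

definition linear_map_on ::
  "('x \<Rightarrow> complex) set \<Rightarrow> ('y \<Rightarrow> complex) set \<Rightarrow> (('x \<Rightarrow> complex) \<Rightarrow> 'y \<Rightarrow> complex) \<Rightarrow> bool" where
  "linear_map_on V W L \<longleftrightarrow>
     (\<forall>u\<in>V. L u \<in> W) \<and>
     (\<forall>u\<in>V. \<forall>v\<in>V. L (u + v) = L u + L v) \<and>
     (\<forall>c. \<forall>u\<in>V. L (cscale c u) = cscale c (L u))"

definition dual :: "('x \<Rightarrow> complex) set \<Rightarrow> (('x \<Rightarrow> complex) \<Rightarrow> complex) set" where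
  "dual V = {\<phi>. (\<forall>u\<in>V. \<forall>v\<in>V. \<phi> (u + v) = \<phi> u + \<phi> v) \<and>
                 (\<forall>c. \<forall>u\<in>V. \<phi> (cscale c u) = c * \<phi> u) \<and>
                 (\<forall>u. u \<notin> V \<longrightarrow> \<phi> u = 0)}"

text \<open>The adjoint \<open>W* \<rightarrow> V*\<close> of \<open>L : V \<rightarrow> W\<close> with respect to the bilinear pairings.\<close>

definition adjoint_on ::
  "('x \<Rightarrow> complex) set \<Rightarrow> (('x \<Rightarrow> complex) \<Rightarrow> 'y \<Rightarrow> complex) \<Rightarrow>
   (('y \<Rightarrow> complex) \<Rightarrow> complex) \<Rightarrow> ('x \<Rightarrow> complex) \<Rightarrow> complex" where
  "adjoint_on V L \<psi> = restr V (\<lambda>v. \<psi> (L v))"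

definition cnj_fun :: "('x \<Rightarrow> complex) \<Rightarrow> 'x \<Rightarrow> complex" where
  "cnj_fun u = (\<lambda>x. cnj (u x))"

text \<open>
  The conjugate of a functional is again a linear functional,
  characterised by \<open>\<langle>cnj q, cnj v\<rangle> = cnj \<langle>q, v\<rangle>\<close>.
\<close>

definition cnj_functional ::
  "(('x \<Rightarrow> complex) \<Rightarrow> complex) \<Rightarrow> ('x \<Rightarrow> complex) \<Rightarrow> complex" where
  "cnj_functional q = (\<lambda>v. cnj (q (cnj_fun v)))"

text \<open>In the next two definitions, hermitian symmetry makes the quadratic form real.\<close>

definition hermitian_pos_def ::
  "('x \<Rightarrow> complex) set \<Rightarrow> (('x \<Rightarrow> complex) \<Rightarrow> ('x \<Rightarrow> complex) \<Rightarrow> complex) \<Rightarrow> bool" where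
  "hermitian_pos_def V T \<longleftrightarrow>
     linear_map_on V (dual V) T \<and>
     (\<forall>u\<in>V. \<forall>v\<in>V. T u (cnj_fun v) = cnj (T v (cnj_fun u))) \<and>
     (\<forall>v\<in>V. v \<noteq> 0 \<longrightarrow> Re (T v (cnj_fun v)) > 0)"

definition hermitian_pos_def_dual ::
  "('x \<Rightarrow> complex) set \<Rightarrow> ((('x \<Rightarrow> complex) \<Rightarrow> complex) \<Rightarrow> 'x \<Rightarrow> complex) \<Rightarrow> bool" where
  "hermitian_pos_def_dual V P \<longleftrightarrow>
     linear_map_on (dual V) V P \<and>
     (\<forall>b\<in>dual V. \<forall>c\<in>dual V. cnj_functional c (P b) = cnj (cnj_functional b (P c))) \<and>
     (\<forall>b\<in>dual V. b \<noteq> 0 \<longrightarrow> Re (cnj_functional b (P b)) > 0)"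

definition op_norm_primal ::
  "(('x \<Rightarrow> complex) \<Rightarrow> ('x \<Rightarrow> complex) \<Rightarrow> complex) \<Rightarrow> ('x \<Rightarrow> complex) \<Rightarrow> real" where
  "op_norm_primal T v = sqrt (Re (T v (cnj_fun v)))"

definition op_norm_dual ::
  "('x \<Rightarrow> complex) set \<Rightarrow> (('x \<Rightarrow> complex) \<Rightarrow> ('x \<Rightarrow> complex) \<Rightarrow> complex) \<Rightarrow>
   (('x \<Rightarrow> complex) \<Rightarrow> complex) \<Rightarrow> real" where
  "op_norm_dual V T q = sqrt (Re (cnj_functional q (inv_into V T q)))"

definition spectrum_on ::
  "('x \<Rightarrow> complex) set \<Rightarrow> (('x \<Rightarrow> complex) \<Rightarrow> 'x \<Rightarrow> complex) \<Rightarrow> complex set" where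
  "spectrum_on V L = {z. \<exists>v\<in>V. v \<noteq> 0 \<and> L v = cscale z v}"

definition cond_on ::
  "('x \<Rightarrow> complex) set \<Rightarrow> (('x \<Rightarrow> complex) \<Rightarrow> 'x \<Rightarrow> complex) \<Rightarrow> real" where
  "cond_on V L = Sup (Re ` spectrum_on V L) / Inf (Re ` spectrum_on V L)"


section \<open>Geometry, finite element spaces and integrals\<close>

definition polyhedral_open :: "'a::euclidean_space set \<Rightarrow> bool" where
  "polyhedral_open S \<longleftrightarrow>
     open S \<and> S \<noteq> {} \<and> bounded S \<and> S = interior (closure S) \<and>
     (\<exists>\<P>. finite \<P> \<and> (\<forall>K\<in>\<P>. polytope K) \<and> closure S = \<Union>\<P>)"

text \<open>Polynomials of total degree at most \<open>m\<close>, in the coordinates given by the basis.\<close>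

definition poly_on :: "nat \<Rightarrow> 'a::euclidean_space set \<Rightarrow> ('a \<Rightarrow> complex) \<Rightarrow> bool" where
  "poly_on m K u \<longleftrightarrow>
     (\<exists>c. \<forall>x\<in>K. u x =
        (\<Sum>\<alpha> | (\<forall>b. b \<notin> Basis \<longrightarrow> \<alpha> b = (0::nat)) \<and> (\<Sum>b\<in>Basis. \<alpha> b) \<le> m.
           c \<alpha> * of_real (\<Prod>b\<in>Basis. (x \<bullet> b) ^ \<alpha> b)))"

text \<open>
  The bilinear product of gradients. At points of non-differentiability (for finite element
  functions, at most the mesh skeleton, which has measure zero) \<open>frechet_derivative\<close> is unspecified.
\<close>

definition grad_prod ::
  "('a::euclidean_space \<Rightarrow> complex) \<Rightarrow> ('a \<Rightarrow> complex) \<Rightarrow> 'a \<Rightarrow> complex" where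
  "grad_prod u v x = (\<Sum>b\<in>Basis. frechet_derivative u (at x) b * frechet_derivative v (at x) b)"

text \<open>
  Surface measure on a flat \<open>(d - 1)\<close>-dimensional face \<open>F\<close>: the area of \<open>E \<subseteq> F\<close> is the Lebesgue
  measure of the right prism of height 1 over \<open>E\<close>. On the prism over \<open>F\<close>, the closest point in \<open>F\<close>
  is the foot of the perpendicular. In dimension one this is the counting measure of a point.
\<close>

definition facet_normal :: "'a::euclidean_space set \<Rightarrow> 'a" where
  "facet_normal F = (SOME \<nu>. norm \<nu> = 1 \<and> (\<forall>x\<in>F. \<forall>y\<in>F. \<nu> \<bullet> (x - y) = 0))"

definition facet_measure :: "'a::euclidean_space set \<Rightarrow> 'a measure" where
  "facet_measure F =
     distr (restrict_space lborel {x + t *\<^sub>R facet_normal F |x t. x \<in> F \<and> t \<in> {0..1}})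
       (restrict_space borel F) (closest_point F)"

record 'a helmholtz_ddm =
  Dom :: "'a set"
  Mesh :: "'a set set"
  Deg :: nat
  Wavenum :: real
  Bdata :: "'a \<Rightarrow> complex"
  Nsub :: nat
  Sub :: "nat \<Rightarrow> 'a set"

definition boundary_facets :: "'a::euclidean_space helmholtz_ddm \<Rightarrow> 'a set \<Rightarrow> 'a set set" where
  "boundary_facets D G = {F. F \<subseteq> G \<and> (\<exists>K\<in>Mesh D. F facet_of K)}"

text \<open>The surface integral over \<open>G\<close>, for a set \<open>G\<close> that is up to surface measure zero a union of
  facets of mesh elements.\<close>

definition surf_int :: "'a::euclidean_space helmholtz_ddm \<Rightarrow> 'a set \<Rightarrow> ('a \<Rightarrow> complex) \<Rightarrow> complex" where
  "surf_int D G w = (\<Sum>F\<in>boundary_facets D G. integral\<^sup>L (facet_measure F) w)"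

definition L2_boundary :: "'a::euclidean_space helmholtz_ddm \<Rightarrow> ('a \<Rightarrow> complex) \<Rightarrow> bool" where
  "L2_boundary D f \<longleftrightarrow>
     (\<forall>F\<in>boundary_facets D (frontier (Dom D)).
        f \<in> borel_measurable (facet_measure F) \<and>
        integrable (facet_measure F) (\<lambda>x. (cmod (f x))\<^sup>2))"

definition Vh :: "'a::euclidean_space helmholtz_ddm \<Rightarrow> ('a \<Rightarrow> complex) set" where
  "Vh D = {u. continuous_on (closure (Dom D)) u \<and>
              (\<forall>K\<in>Mesh D. poly_on (Deg D) K u) \<and>
              (\<forall>x. x \<notin> closure (Dom D) \<longrightarrow> u x = 0)}"

definition form_a ::
  "'a::euclidean_space helmholtz_ddm \<Rightarrow> ('a \<Rightarrow> complex) \<Rightarrow> ('a \<Rightarrow> complex) \<Rightarrow> complex" where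
  "form_a D u v =
     (LINT x:Dom D|lebesgue. grad_prod u (cnj_fun v) x - of_real ((Wavenum D)\<^sup>2) * u x * cnj (v x))
     - \<i> * of_real (Wavenum D) * surf_int D (frontier (Dom D)) (\<lambda>x. u x * cnj (v x))"

definition form_l :: "'a::euclidean_space helmholtz_ddm \<Rightarrow> ('a \<Rightarrow> complex) \<Rightarrow> complex" where
  "form_l D v = surf_int D (frontier (Dom D)) (\<lambda>x. Bdata D x * cnj (v x))"

definition helmholtz_setting :: "'a::euclidean_space helmholtz_ddm \<Rightarrow> bool" where
  "helmholtz_setting D \<longleftrightarrow>
     polyhedral_open (Dom D) \<and> connected (Dom D) \<and>
     triangulation (Mesh D) \<and> (\<forall>K\<in>Mesh D. int DIM('a) simplex K) \<and>
     \<Union>(Mesh D) = closure (Dom D) \<and>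
     Deg D \<ge> 1 \<and> Wavenum D > 0 \<and> L2_boundary D (Bdata D) \<and>
     (\<forall>j\<in>{1..Nsub D}. polyhedral_open (Sub D j) \<and> (\<exists>\<M>\<subseteq>Mesh D. closure (Sub D j) = \<Union>\<M>)) \<and>
     (\<forall>i\<in>{1..Nsub D}. \<forall>j\<in>{1..Nsub D}. i \<noteq> j \<longrightarrow> Sub D i \<inter> Sub D j = {}) \<and>
     closure (Dom D) = (\<Union>j\<in>{1..Nsub D}. closure (Sub D j)) \<and>
     (\<exists>!u. u \<in> Vh D \<and> (\<forall>v\<in>Vh D. form_a D u v = form_l D v))"


section \<open>Domain decomposition spaces and operators\<close>

definition skeleton :: "'a::euclidean_space helmholtz_ddm \<Rightarrow> 'a set" where
  "skeleton D = (\<Union>j\<in>{1..Nsub D}. frontier (Sub D j))"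

text \<open>
  By continuity, restrictions to \<open>Sub D j\<close> are identified with restrictions to its closure, so
  that traces on the boundary are restrictions. A tuple \<open>(u\<^sub>1, \<dots>, u\<^sub>J)\<close> is encoded as the
  function \<open>(j, x) \<mapsto> u\<^sub>j x\<close>, vanishing for \<open>j\<close> outside \<open>{1..J}\<close>.
\<close>

definition tuples :: "nat \<Rightarrow> (nat \<Rightarrow> ('a \<Rightarrow> complex) set) \<Rightarrow> (nat \<times> 'a \<Rightarrow> complex) set" where
  "tuples J V = {u. (\<forall>j\<in>{1..J}. (\<lambda>x. u (j, x)) \<in> V j) \<and> (\<forall>j x. j \<notin> {1..J} \<longrightarrow> u (j, x) = 0)}"

definition Vh_Sigma :: "'a::euclidean_space helmholtz_ddm \<Rightarrow> ('a \<Rightarrow> complex) set" where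
  "Vh_Sigma D = restr (skeleton D) ` Vh D"

definition VVh_Omega :: "'a::euclidean_space helmholtz_ddm \<Rightarrow> (nat \<times> 'a \<Rightarrow> complex) set" where
  "VVh_Omega D = tuples (Nsub D) (\<lambda>j. restr (closure (Sub D j)) ` Vh D)"

definition VVh_Sigma :: "'a::euclidean_space helmholtz_ddm \<Rightarrow> (nat \<times> 'a \<Rightarrow> complex) set" where
  "VVh_Sigma D = tuples (Nsub D) (\<lambda>j. restr (frontier (Sub D j)) ` Vh D)"

definition Bop ::
  "'a::euclidean_space helmholtz_ddm \<Rightarrow> (nat \<times> 'a \<Rightarrow> complex) \<Rightarrow> nat \<times> 'a \<Rightarrow> complex" where
  "Bop D u = (\<lambda>(j, x). if j \<in> {1..Nsub D} \<and> x \<in> frontier (Sub D j) then u (j, x) else 0)"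

definition Rop ::
  "'a::euclidean_space helmholtz_ddm \<Rightarrow> ('a \<Rightarrow> complex) \<Rightarrow> nat \<times> 'a \<Rightarrow> complex" where
  "Rop D v = (\<lambda>(j, x). if j \<in> {1..Nsub D} \<and> x \<in> frontier (Sub D j) then v x else 0)"

definition Bstar ::
  "'a::euclidean_space helmholtz_ddm \<Rightarrow>
   ((nat \<times> 'a \<Rightarrow> complex) \<Rightarrow> complex) \<Rightarrow> (nat \<times> 'a \<Rightarrow> complex) \<Rightarrow> complex" where
  "Bstar D = adjoint_on (VVh_Omega D) (Bop D)"

definition Rstar ::
  "'a::euclidean_space helmholtz_ddm \<Rightarrow>
   ((nat \<times> 'a \<Rightarrow> complex) \<Rightarrow> complex) \<Rightarrow> ('a \<Rightarrow> complex) \<Rightarrow> complex" where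
  "Rstar D = adjoint_on (Vh_Sigma D) (Rop D)"

definition Aop ::
  "'a::euclidean_space helmholtz_ddm \<Rightarrow>
   (nat \<times> 'a \<Rightarrow> complex) \<Rightarrow> (nat \<times> 'a \<Rightarrow> complex) \<Rightarrow> complex" where
  "Aop D u = restr (VVh_Omega D) (\<lambda>v. \<Sum>j\<in>{1..Nsub D}.
     (LINT x:Sub D j|lebesgue. grad_prod (\<lambda>y. u (j, y)) (\<lambda>y. v (j, y)) x
        - of_real ((Wavenum D)\<^sup>2) * u (j, x) * v (j, x))
     - \<i> * of_real (Wavenum D) *
         surf_int D (frontier (Dom D) \<inter> frontier (Sub D j)) (\<lambda>x. u (j, x) * v (j, x)))"

definition lvec ::
  "'a::euclidean_space helmholtz_ddm \<Rightarrow> (nat \<times> 'a \<Rightarrow> complex) \<Rightarrow> complex" where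
  "lvec D = restr (VVh_Omega D) (\<lambda>v. \<Sum>j\<in>{1..Nsub D}.
     surf_int D (frontier (Dom D) \<inter> frontier (Sub D j)) (\<lambda>x. Bdata D x * v (j, x)))"

type_synonym 'a transmission_op =
  "(nat \<times> 'a \<Rightarrow> complex) \<Rightarrow> (nat \<times> 'a \<Rightarrow> complex) \<Rightarrow> complex"

type_synonym 'a precond = "(('a \<Rightarrow> complex) \<Rightarrow> complex) \<Rightarrow> 'a \<Rightarrow> complex"

text \<open>\<open>(A - i B* T B)\<^sup>-\<^sup>1\<close>\<close>

definition local_solve ::
  "'a::euclidean_space helmholtz_ddm \<Rightarrow> 'a transmission_op \<Rightarrow>
   ((nat \<times> 'a \<Rightarrow> complex) \<Rightarrow> complex) \<Rightarrow> nat \<times> 'a \<Rightarrow> complex" where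
  "local_solve D T =
     inv_into (VVh_Omega D) (\<lambda>u. Aop D u - cscale \<i> (Bstar D (T (Bop D u))))"

definition RTR ::
  "'a::euclidean_space helmholtz_ddm \<Rightarrow> 'a transmission_op \<Rightarrow>
   ('a \<Rightarrow> complex) \<Rightarrow> ('a \<Rightarrow> complex) \<Rightarrow> complex" where
  "RTR D T \<eta> = Rstar D (T (Rop D \<eta>))"

definition exchange ::
  "'a::euclidean_space helmholtz_ddm \<Rightarrow> 'a transmission_op \<Rightarrow>
   ((nat \<times> 'a \<Rightarrow> complex) \<Rightarrow> complex) \<Rightarrow> (nat \<times> 'a \<Rightarrow> complex) \<Rightarrow> complex" where
  "exchange D T q =
     cscale 2 (T (Rop D (inv_into (Vh_Sigma D) (RTR D T) (Rstar D q)))) - q"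

definition scattering ::
  "'a::euclidean_space helmholtz_ddm \<Rightarrow> 'a transmission_op \<Rightarrow>
   ((nat \<times> 'a \<Rightarrow> complex) \<Rightarrow> complex) \<Rightarrow> (nat \<times> 'a \<Rightarrow> complex) \<Rightarrow> complex" where
  "scattering D T q = q + cscale (2 * \<i>) (T (Bop D (local_solve D T (Bstar D q))))"

definition gvec ::
  "'a::euclidean_space helmholtz_ddm \<Rightarrow> 'a transmission_op \<Rightarrow>
   (nat \<times> 'a \<Rightarrow> complex) \<Rightarrow> complex" where
  "gvec D T = cscale (2 * \<i>) (T (Bop D (local_solve D T (lvec D))))"


section \<open>Preconditioned conjugate gradient\<close>

text \<open>The affine space \<open>x\<^sub>0 + span {r\<^sub>0, M r\<^sub>0, \<dots>, M\<^sup>k\<^sup>-\<^sup>1 r\<^sub>0}\<close>, with complex coefficients.\<close>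

definition krylov_affine ::
  "nat \<Rightarrow> (('x \<Rightarrow> complex) \<Rightarrow> 'x \<Rightarrow> complex) \<Rightarrow> ('x \<Rightarrow> complex) \<Rightarrow> ('x \<Rightarrow> complex) \<Rightarrow>
   ('x \<Rightarrow> complex) set" where
  "krylov_affine k M x0 r0 = {x0 + (\<Sum>i<k. cscale (c i) ((M ^^ i) r0)) | c. True}"

definition PCG ::
  "'a::euclidean_space helmholtz_ddm \<Rightarrow> 'a transmission_op \<Rightarrow> 'a precond \<Rightarrow> nat \<Rightarrow>
   ('a \<Rightarrow> complex) \<Rightarrow> (('a \<Rightarrow> complex) \<Rightarrow> complex) \<Rightarrow> 'a \<Rightarrow> complex" where
  "PCG D T P k x0 b =
     (let M = (\<lambda>\<eta>. P (RTR D T \<eta>));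
          K = krylov_affine k M x0 (P b - M x0);
          err = (\<lambda>\<eta>. op_norm_primal (RTR D T) (inv_into (Vh_Sigma D) (RTR D T) b - \<eta>))
      in THE \<eta>. \<eta> \<in> K \<and> (\<forall>\<zeta>\<in>K. err \<eta> \<le> err \<zeta>))"

end

theory Submission
  imports Defs "HOL-Computational_Algebra.Fundamental_Theorem_Algebra"
begin

text \<open>
  The iteration is an exact relaxed Richardson iteration for \<open>(Id + \<Pi> S) q = g\<close>, perturbed by the
  error of the truncated conjugate gradient method that replaces \<open>(R* T R)\<^sup>-\<^sup>1\<close> in \<open>\<Pi>\<close>. The proof
  controls two quantities together: the norm \<open>x\<^sub>n\<close> of the increment of \<open>q\<close>, and the norm \<open>y\<^sub>n\<close> of
  the conjugate gradient error in step \<open>n\<close>.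

  Since PCG is started from its previous result, its initial error is at most \<open>y\<^sub>n\<close> plus the change
  of the exact solution of the linear system. That change is at most \<open>x\<^sub>n\<close>, because the right-hand
  side depends on \<open>q\<close> through \<open>S\<close> and the map \<open>(R* T R)\<^sup>-\<^sup>1 R*\<close>, and both are contractions. The
  classical Chebyshev estimate (\<open>cg_error_bound\<close>) then gives
  \<open>y\<^sub>n\<^sub>+\<^sub>1 \<le> \<epsilon> (x\<^sub>n + y\<^sub>n)\<close>, and the definition of \<open>\<rho>\<close> gives
  \<open>x\<^sub>n\<^sub>+\<^sub>1 \<le> \<rho> x\<^sub>n + 2 (y\<^sub>n\<^sub>+\<^sub>1 + y\<^sub>n)\<close>. After a rescaling of \<open>y\<close> this is a recurrence whose matrix is
  bounded entrywise by the symmetric matrix of the theorem (\<open>matrix_recurrence_decay\<close>), so the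
  increments decay like the powers of its norm. Since \<open>\<rho>\<close> is at most the norm of the
  matrix, hence less than 1, \<open>Id + \<Pi> S\<close> is invertible and its inverse bounds the distance to the
  solution in terms of the latest increment and conjugate gradient error. So the iterates converge,
  and summing the increments gives the stated bound.

  Three facts about the problem carry this argument. The operator \<open>\<Pi>\<close> is a reflection, hence an
  isometry (\<open>exchange_isometry\<close>). The scattering operator is a contraction by an energy balance: the
  imaginary part of the Helmholtz form is, up to sign, the energy lost through the outer boundary
  (\<open>scattering_contraction\<close>). For \<open>S\<close> to be a linear map at all, the local operators
  \<open>A - \<i> B* T B\<close> must be invertible; the same energy balance reduces this to local solutions with
  zero trace, which can be glued to a solution of the global homogeneous problem
  (\<open>traceless_kernel\<close>).
\<close>

section \<open>Finite-dimensional spaces of functions\<close>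

lemma cscale_apply: "cscale c u x = c * u x"
  by (simp add: cscale_def)

lemmas fun_apply = plus_fun_apply zero_fun_apply minus_apply uminus_apply cscale_apply

text \<open>
  Functionals take functions as arguments, and the unifier often leaves such an argument
  eta-expanded. The pointwise rules would then rewrite \<open>u + v\<close> inside an argument into a
  lambda-abstraction that no longer matches, so they are used on request only.
\<close>

declare plus_fun_apply [simp del] zero_fun_apply [simp del]
  minus_apply [simp del] uminus_apply [simp del]

interpretation fs: vector_space "cscale :: complex \<Rightarrow> ('x \<Rightarrow> complex) \<Rightarrow> 'x \<Rightarrow> complex"
  by unfold_locales (auto simp: fun_eq_iff fun_apply algebra_simps)

text \<open>
  The function types are infinite-dimensional in general, so dimension is a property of the carrier
  sets.
\<close>

definition fin_dim :: "('x \<Rightarrow> complex) set \<Rightarrow> bool" where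
  "fin_dim V \<longleftrightarrow> fs.subspace V \<and> (\<exists>B. finite B \<and> V \<subseteq> fs.span B)"

lemma fin_dim_subspace: "fin_dim V \<Longrightarrow> fs.subspace V"
  by (simp add: fin_dim_def)

lemma cnj_fun_add: "cnj_fun (u + v) = cnj_fun u + cnj_fun v"
  and cnj_fun_scale: "cnj_fun (cscale c u) = cscale (cnj c) (cnj_fun u)"
  and cnj_fun_zero: "cnj_fun 0 = 0"
  and cnj_fun_cnj_fun [simp]: "cnj_fun (cnj_fun u) = u"
  by (auto simp: cnj_fun_def fun_eq_iff fun_apply)

lemma sum_fun_apply: "(\<Sum>i\<in>I. f i) x = (\<Sum>i\<in>I. f i x)"
  by (induction I rule: infinite_finite_induct) (auto simp: fun_apply)

lemma linear_map_on_mem: "linear_map_on V W L \<Longrightarrow> u \<in> V \<Longrightarrow> L u \<in> W"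
  and linear_map_on_add: "linear_map_on V W L \<Longrightarrow> u \<in> V \<Longrightarrow> v \<in> V \<Longrightarrow> L (u + v) = L u + L v"
  and linear_map_on_scale: "linear_map_on V W L \<Longrightarrow> u \<in> V \<Longrightarrow> L (cscale c u) = cscale c (L u)"
  by (auto simp: linear_map_on_def)

lemma linear_map_on_zero:
  assumes "linear_map_on V W L" "fs.subspace V"
  shows "L 0 = 0"
proof -
  have "L (cscale 0 0) = cscale 0 (L 0)"
    by (rule linear_map_on_scale[OF assms(1)]) (use assms(2) fs.subspace_0 in auto)
  moreover have "cscale 0 u = 0" for u :: "'z \<Rightarrow> complex"
    by (rule fs.scale_zero_left)
  ultimately show ?thesis by metis
qed

lemma linear_map_on_diff:
  assumes "linear_map_on V W L" "fs.subspace V" "u \<in> V" "v \<in> V"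
  shows "L (u - v) = L u - L v"
proof -
  have "u - v = u + cscale (- 1) v" by (auto simp: fun_eq_iff fun_apply)
  then have "L (u - v) = L (u + cscale (- 1) v)" by (rule arg_cong)
  also have "\<dots> = L u + L (cscale (- 1) v)"
    by (rule linear_map_on_add[OF assms(1,3)]) (rule fs.subspace_scale[OF assms(2,4)])
  also have "L (cscale (- 1) v) = cscale (- 1) (L v)"
    by (rule linear_map_on_scale[OF assms(1,4)])
  also have "L u + cscale (- 1) (L v) = L u - L v" by (auto simp: fun_eq_iff fun_apply)
  finally show ?thesis .
qed

lemma linear_map_on_sum:
  assumes L: "linear_map_on V W L" and V: "fs.subspace V" and "\<And>i. i \<in> I \<Longrightarrow> f i \<in> V"
  shows "L (\<Sum>i\<in>I. f i) = (\<Sum>i\<in>I. L (f i))"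
  using assms(3)
proof (induction I rule: infinite_finite_induct)
  case (insert x F)
  then have "L (f x + sum f F) = L (f x) + L (sum f F)"
    by (intro linear_map_on_add[OF L]) (auto intro: fs.subspace_sum[OF V])
  then show ?case using insert by (simp add: sum.insert)
qed (simp_all add: linear_map_on_zero[OF L V])

lemma subspace_image:
  assumes L: "linear_map_on V W L" and V: "fs.subspace V"
  shows "fs.subspace (L ` V)"
  unfolding fs.subspace_def
proof (intro conjI ballI allI)
  show "0 \<in> L ` V" using linear_map_on_zero[OF L V] fs.subspace_0[OF V] by (metis imageI)
next
  fix x y assume "x \<in> L ` V" "y \<in> L ` V"
  then show "x + y \<in> L ` V"
    using linear_map_on_add[OF L] fs.subspace_add[OF V] by (smt (verit) image_iff)
next
  fix c x assume "x \<in> L ` V"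
  then show "cscale c x \<in> L ` V"
    using linear_map_on_scale[OF L] fs.subspace_scale[OF V] by (smt (verit) image_iff)
qed

lemma fin_dim_basis:
  assumes "fin_dim V"
  obtains B where "finite B" "fs.independent B" "fs.span B = V"
proof -
  obtain C where C: "finite C" "V \<subseteq> fs.span C" and V: "fs.subspace V"
    using assms by (auto simp: fin_dim_def)
  obtain B where B: "B \<subseteq> V" "fs.independent B" "V \<subseteq> fs.span B"
    using fs.maximal_independent_subset[of V] by metis
  have "finite B"
    using fs.independent_span_bound[OF C(1) B(2)] B(1) C(2) by blast
  moreover have "fs.span B = V"
    using B(1,3) V fs.span_minimal by blast
  ultimately show ?thesis using B(2) that by blast
qed

lemma linear_image_span:
  assumes L: "linear_map_on V W L" and V: "fs.subspace V" and B: "B \<subseteq> V" and u: "u \<in> fs.span B"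
  shows "L u \<in> fs.span (L ` B)"
proof -
  have "u \<in> V \<and> L u \<in> fs.span (L ` B)"
    using u
  proof (induction rule: fs.span_induct_alt)
    case base
    then show ?case
      by (simp only: linear_map_on_zero[OF L V] fs.subspace_0[OF V] fs.span_zero simp_thms)
  next
    case (step c x y)
    then have x: "x \<in> V" and y: "y \<in> V" using B by auto
    have "L (cscale c x + y) = cscale c (L x) + L y"
      using x y by (simp add: linear_map_on_add[OF L] linear_map_on_scale[OF L] fs.subspace_scale[OF V])
    then show ?case
      using step x y by (simp add: fs.subspace_add[OF V] fs.subspace_scale[OF V] fs.span_add fs.span_scale fs.span_base)
  qed
  then show ?thesis by blast
qed

lemma fin_dim_image:
  assumes L: "linear_map_on V W L" and V: "fin_dim V"
  shows "fin_dim (L ` V)"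
proof -
  obtain B where B: "finite B" "fs.span B = V"
    using fin_dim_basis[OF V] by metis
  have "B \<subseteq> V" using B fs.span_superset by blast
  then have "L ` V \<subseteq> fs.span (L ` B)"
    using linear_image_span[OF L fin_dim_subspace[OF V]] B by blast
  then show ?thesis
    unfolding fin_dim_def using B subspace_image[OF L fin_dim_subspace[OF V]] by blast
qed

lemma subspace_dual: "fs.subspace (dual V)"
  unfolding fs.subspace_def dual_def by (auto simp: algebra_simps fun_apply)

lemma dual_add: "\<phi> \<in> dual V \<Longrightarrow> u \<in> V \<Longrightarrow> v \<in> V \<Longrightarrow> \<phi> (u + v) = \<phi> u + \<phi> v"
  and dual_scale: "\<phi> \<in> dual V \<Longrightarrow> u \<in> V \<Longrightarrow> \<phi> (cscale c u) = c * \<phi> u"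
  and dual_outside: "\<phi> \<in> dual V \<Longrightarrow> u \<notin> V \<Longrightarrow> \<phi> u = 0"
  by (auto simp: dual_def)

lemma dual_zero:
  assumes "\<phi> \<in> dual V" "fs.subspace V"
  shows "\<phi> 0 = 0"
  using dual_scale[OF assms(1), of 0 0] fs.subspace_0[OF assms(2)] fs.scale_zero_left[of 0]
  by (simp add: fs.subspace_0)

lemma dual_sum:
  assumes \<phi>: "\<phi> \<in> dual V" and V: "fs.subspace V" and "\<And>i. i \<in> I \<Longrightarrow> f i \<in> V"
  shows "\<phi> (\<Sum>i\<in>I. f i) = (\<Sum>i\<in>I. \<phi> (f i))"
  using assms(3)
proof (induction I rule: infinite_finite_induct)
  case (insert x F)
  then have "\<phi> (f x + sum f F) = \<phi> (f x) + \<phi> (sum f F)"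
    by (intro dual_add[OF \<phi>]) (auto intro: fs.subspace_sum[OF V])
  then show ?case using insert by (simp add: sum.insert)
qed (simp_all add: dual_zero[OF \<phi> V])

text \<open>
  The coordinate functionals of a basis span the dual; extended by 0, they are the restrictions of
  the coordinates to the space.
\<close>

lemma dual_spanned:
  assumes B: "finite B" "fs.independent B" "fs.span B = V"
  obtains C where "finite C" "card C \<le> card B" "dual V \<subseteq> fs.span C"
proof -
  define d where "d b = restr V (\<lambda>v. fs.representation B v b)" for b
  have V: "fs.subspace V" using B(3) fs.subspace_span by blast
  have "\<phi> \<in> fs.span (d ` B)" if \<phi>: "\<phi> \<in> dual V" for \<phi>
  proof -
    have "\<phi> = (\<Sum>b\<in>B. cscale (\<phi> b) (d b))"
    proof
      fix v
      show "\<phi> v = (\<Sum>b\<in>B. cscale (\<phi> b) (d b)) v"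
      proof (cases "v \<in> V")
        case True
        have "(\<Sum>b\<in>B. cscale (fs.representation B v b) b) = v"
          by (rule fs.sum_representation_eq) (use B True in auto)
        moreover have "\<phi> (\<Sum>b\<in>B. cscale (fs.representation B v b) b)
            = (\<Sum>b\<in>B. \<phi> (cscale (fs.representation B v b) b))"
          by (rule dual_sum[OF \<phi> V]) (metis B(3) fs.span_base V fs.subspace_scale)
        moreover have "\<phi> (cscale (fs.representation B v b) b) = fs.representation B v b * \<phi> b"
          if "b \<in> B" for b
          using dual_scale[OF \<phi>] that B fs.span_superset by blast
        ultimately show ?thesis
          using True by (simp add: sum_fun_apply fun_apply d_def restr_def mult.commute)
      next
        case False
        then show ?thesis using dual_outside[OF \<phi>] by (simp add: sum_fun_apply fun_apply d_def restr_def)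
      qed
    qed
    also have "\<dots> \<in> fs.span (d ` B)"
      by (intro fs.span_sum fs.span_scale fs.span_base) auto
    finally show ?thesis .
  qed
  then show ?thesis using that[of "d ` B"] B(1) card_image_le by blast
qed

lemma fin_dim_dual:
  assumes "fin_dim V"
  shows "fin_dim (dual V)"
proof -
  obtain B where "finite B" "fs.independent B" "fs.span B = V"
    using fin_dim_basis[OF assms] by metis
  then obtain C where "finite C" "dual V \<subseteq> fs.span C" using dual_spanned by metis
  then show ?thesis unfolding fin_dim_def using subspace_dual by blast
qed

text \<open>
  A dimension count. The image of a basis of \<open>V\<close> is independent; a vector of \<open>W\<close> outside its span
  would enlarge it to an independent set with more elements than a spanning set of \<open>W\<close>.
\<close>

lemma linear_inj_onto:
  assumes B: "finite B" "fs.independent B" "fs.span B = V"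
    and C: "finite C" "card C \<le> card B" "W \<subseteq> fs.span C"
    and L: "linear_map_on V W L" "inj_on L V"
  shows "L ` V = W"
proof -
  have V: "fs.subspace V" using B(3) fs.subspace_span by blast
  have BV: "B \<subseteq> V" using B(3) fs.span_superset by blast
  have inj: "inj_on L B" using L(2) BV inj_on_subset by blast
  have indep: "fs.independent (L ` B)"
  proof
    assume "fs.dependent (L ` B)"
    then obtain c where c: "\<exists>v\<in>L ` B. c v \<noteq> 0" "(\<Sum>v\<in>L ` B. cscale (c v) v) = 0"
      using fs.dependent_finite[of "L ` B"] B(1) by auto
    have "0 = (\<Sum>b\<in>B. cscale (c (L b)) (L b))"
      using c(2) by (simp add: sum.reindex[OF inj])
    also have "\<dots> = (\<Sum>b\<in>B. L (cscale (c (L b)) b))"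
      using BV by (intro sum.cong) (auto simp: linear_map_on_scale[OF L(1)])
    also have "\<dots> = L (\<Sum>b\<in>B. cscale (c (L b)) b)"
      using BV by (subst linear_map_on_sum[OF L(1) V]) (auto intro!: fs.subspace_scale[OF V])
    finally have "L (\<Sum>b\<in>B. cscale (c (L b)) b) = L 0"
      using linear_map_on_zero[OF L(1) V] by simp
    then have "(\<Sum>b\<in>B. cscale (c (L b)) b) = 0"
      using BV by (intro inj_onD[OF L(2)])
        (auto intro!: fs.subspace_sum[OF V] fs.subspace_scale[OF V] fs.subspace_0[OF V])
    then have "c (L b) = 0" if "b \<in> B" for b
      using fs.independentD[OF B(2) B(1) subset_refl, of "\<lambda>b. c (L b)"] that by simp
    then show False using c(1) by blast
  qed
  have LW: "L ` B \<subseteq> W" using BV linear_map_on_mem[OF L(1)] by blast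
  have "w \<in> fs.span (L ` B)" if w: "w \<in> W" for w
  proof (rule ccontr)
    assume n: "w \<notin> fs.span (L ` B)"
    then have "fs.independent (insert w (L ` B))" using fs.independent_insertI indep by blast
    then have "card (insert w (L ` B)) \<le> card C"
      using fs.independent_span_bound[OF C(1), of "insert w (L ` B)"] C(3) LW w by auto
    moreover have "w \<notin> L ` B" using n fs.span_base by metis
    ultimately show False using C(2) B(1) card_image[OF inj] by simp
  qed
  moreover have "fs.span (L ` B) \<subseteq> L ` V"
    by (rule fs.span_minimal) (use BV subspace_image[OF L(1) V] in auto)
  ultimately show ?thesis using linear_map_on_mem[OF L(1)] by blast
qed

text \<open>
  In this form the count makes every operator of the problem invertible once it is known to be
  injective: the hermitian operators \<open>V \<rightarrow> V*\<close> as well as the local Helmholtz operators, which are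
  not hermitian.
\<close>

lemma linear_inj_dual_onto:
  assumes "fin_dim V" "linear_map_on V (dual V) L" "inj_on L V"
  shows "L ` V = dual V"
proof -
  obtain B where B: "finite B" "fs.independent B" "fs.span B = V"
    using fin_dim_basis[OF assms(1)] by metis
  then obtain C where "finite C" "card C \<le> card B" "dual V \<subseteq> fs.span C" using dual_spanned by metis
  then show ?thesis using linear_inj_onto B assms(2,3) by metis
qed

lemma linear_inj_endo_onto:
  assumes "fin_dim V" "linear_map_on V V L" "inj_on L V"
  shows "L ` V = V"
  using fin_dim_basis[OF assms(1)] linear_inj_onto[OF _ _ _ _ _ _ assms(2,3)]
  by (metis le_refl subset_refl)

lemma linear_map_on_inj_onI:
  assumes L: "linear_map_on V W L" and V: "fs.subspace V"
    and ker: "\<And>u. u \<in> V \<Longrightarrow> L u = 0 \<Longrightarrow> u = 0"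
  shows "inj_on L V"
proof (rule inj_onI)
  fix u v assume uv: "u \<in> V" "v \<in> V" "L u = L v"
  then have "L (u - v) = 0" using linear_map_on_diff[OF L V] by simp
  then have "u - v = 0" using ker fs.subspace_diff[OF V] uv by blast
  then show "u = v" by simp
qed

lemma linear_map_on_inv_into:
  assumes L: "linear_map_on V W L" and V: "fs.subspace V" and b: "bij_betw L V W"
  shows "linear_map_on W V (inv_into V L)"
proof -
  have im: "L ` V = W" and inj: "inj_on L V" using b by (auto simp: bij_betw_def)
  have i: "inv_into V L w \<in> V" "L (inv_into V L w) = w" if "w \<in> W" for w
    using that im by (auto simp: inv_into_into f_inv_into_f)
  show ?thesis
    unfolding linear_map_on_def
  proof (intro conjI ballI allI)
    fix u v assume uv: "u \<in> W" "v \<in> W"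
    show "inv_into V L (u + v) = inv_into V L u + inv_into V L v"
      using i[OF uv(1)] i[OF uv(2)] linear_map_on_add[OF L] fs.subspace_add[OF V]
      by (intro inv_into_f_eq[OF inj]) auto
  next
    fix c u assume u: "u \<in> W"
    show "inv_into V L (cscale c u) = cscale c (inv_into V L u)"
      using i[OF u] linear_map_on_scale[OF L] fs.subspace_scale[OF V]
      by (intro inv_into_f_eq[OF inj]) auto
  qed (use i in auto)
qed

lemma linear_map_on_compose:
  assumes "linear_map_on U V L" "linear_map_on V W M"
  shows "linear_map_on U W (\<lambda>u. M (L u))"
  using assms unfolding linear_map_on_def by auto

lemma linear_map_on_combine:
  assumes "linear_map_on V W L" "linear_map_on V W M" "fs.subspace W"
  shows "linear_map_on V W (\<lambda>u. cscale a (L u) + cscale b (M u))"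
  using assms fs.subspace_add[OF assms(3)] fs.subspace_scale[OF assms(3)]
  unfolding linear_map_on_def
  by (auto simp: fun_eq_iff fun_apply algebra_simps)

lemma linear_map_on_id: "linear_map_on V V (\<lambda>u. u)"
  by (simp add: linear_map_on_def)

lemma linear_map_on_adjoint:
  assumes L: "linear_map_on V W L" and V: "fs.subspace V"
  shows "linear_map_on (dual W) (dual V) (adjoint_on V L)"
  unfolding linear_map_on_def
proof (intro conjI ballI allI)
  fix \<psi> assume \<psi>: "\<psi> \<in> dual W"
  show "adjoint_on V L \<psi> \<in> dual V"
    unfolding dual_def adjoint_on_def restr_def
    using fs.subspace_add[OF V] fs.subspace_scale[OF V] linear_map_on_mem[OF L] dual_add[OF \<psi>] dual_scale[OF \<psi>]
    by (auto simp: linear_map_on_add[OF L] linear_map_on_scale[OF L])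
qed (auto simp: adjoint_on_def restr_def fun_eq_iff fun_apply)

lemma adjoint_on_apply: "v \<in> V \<Longrightarrow> adjoint_on V L \<psi> v = \<psi> (L v)"
  by (simp add: adjoint_on_def restr_def)

lemma fin_dim_tuples:
  assumes V: "\<And>j. j \<in> {1..J} \<Longrightarrow> fin_dim (V j)"
  shows "fin_dim (tuples J V)"
proof -
  have "\<exists>B. \<forall>j\<in>{1..J}. finite (B j) \<and> V j \<subseteq> fs.span (B j)"
    using V unfolding fin_dim_def by metis
  then obtain B where B: "\<And>j. j \<in> {1..J} \<Longrightarrow> finite (B j) \<and> V j \<subseteq> fs.span (B j)" by blast
  define e where "e j u = (\<lambda>(i, x). if i = j then u x else 0 :: complex)" for j :: nat and u :: "'a \<Rightarrow> complex"
  define C where "C = (\<Union>j\<in>{1..J}. e j ` B j)"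
  have e: "linear_map_on UNIV UNIV (e j)" for j
    unfolding linear_map_on_def e_def by (auto simp: fun_eq_iff fun_apply)
  have "u \<in> fs.span C" if u: "u \<in> tuples J V" for u
  proof -
    have *: "u (i, x) = (\<Sum>j\<in>{1..J}. e j (\<lambda>x. u (j, x))) (i, x)" for i x
    proof (cases "i \<in> {1..J}")
      case True
      then show ?thesis
        by (simp add: sum_fun_apply e_def)
    next
      case False
      then have "u (i, x) = 0" using u by (auto simp: tuples_def)
      then show ?thesis using False by (simp add: sum_fun_apply e_def)
    qed
    have eq: "u = (\<Sum>j\<in>{1..J}. e j (\<lambda>x. u (j, x)))"
    proof
      fix z show "u z = (\<Sum>j\<in>{1..J}. e j (\<lambda>x. u (j, x))) z"
        using *[of "fst z" "snd z"] by (simp only: prod.collapse)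
    qed
    have "e j (\<lambda>x. u (j, x)) \<in> fs.span C" if j: "j \<in> {1..J}" for j
    proof -
      have "(\<lambda>x. u (j, x)) \<in> V j" using u j by (auto simp: tuples_def)
      then have "(\<lambda>x. u (j, x)) \<in> fs.span (B j)" using B[OF j] by blast
      then have "e j (\<lambda>x. u (j, x)) \<in> fs.span (e j ` B j)"
        using linear_image_span[OF e fs.subspace_UNIV subset_UNIV] by blast
      moreover have "e j ` B j \<subseteq> C" using j by (auto simp: C_def)
      ultimately show ?thesis using fs.span_mono by blast
    qed
    then have "(\<Sum>j\<in>{1..J}. e j (\<lambda>x. u (j, x))) \<in> fs.span C" by (rule fs.span_sum)
    then show ?thesis by (simp only: eq[symmetric])
  qed
  moreover have "finite C" using B by (auto simp: C_def)
  moreover have "fs.subspace (tuples J V)"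
  proof -
    have *: "fs.subspace (V j)" if "j \<in> {1..J}" for j using V[OF that] fin_dim_subspace by blast
    have "0 \<in> V j" if "j \<in> {1..J}" for j using *[OF that] fs.subspace_0 by blast
    moreover have "(\<lambda>x. u x + v x) \<in> V j" if "j \<in> {1..J}" "u \<in> V j" "v \<in> V j" for j u v
      using fs.subspace_add[OF *[OF that(1)] that(2,3)] by (simp add: plus_fun_def)
    moreover have "(\<lambda>x. c * u x) \<in> V j" if "j \<in> {1..J}" "u \<in> V j" for j u c
      using fs.subspace_scale[OF *[OF that(1)] that(2)] by (simp add: cscale_def)
    ultimately show ?thesis unfolding fs.subspace_def tuples_def
      by (auto simp: zero_fun_def fun_apply)
  qed
  ultimately show ?thesis unfolding fin_dim_def by blast
qed

section \<open>Hermitian positive definite operators\<close>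

text \<open>
  The operator \<open>T\<close> turns the bilinear pairing into the hermitian inner product
  \<open>\<langle>T u, cnj v\<rangle>\<close>; this makes sense because \<open>V\<close> is stable under conjugation.
\<close>

locale hermitian_space =
  fixes V :: "('x \<Rightarrow> complex) set" and T :: "('x \<Rightarrow> complex) \<Rightarrow> ('x \<Rightarrow> complex) \<Rightarrow> complex"
  assumes fd: "fin_dim V" and cnj_closed: "\<And>u. u \<in> V \<Longrightarrow> cnj_fun u \<in> V"
    and hpd: "hermitian_pos_def V T"
begin

lemma sub: "fs.subspace V"
  using fd fin_dim_subspace by blast

lemma zero_mem: "0 \<in> V" using fs.subspace_0[OF sub] .
lemma add_mem: "u \<in> V \<Longrightarrow> v \<in> V \<Longrightarrow> u + v \<in> V" using fs.subspace_add[OF sub] .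
lemma diff_mem: "u \<in> V \<Longrightarrow> v \<in> V \<Longrightarrow> u - v \<in> V" using fs.subspace_diff[OF sub] .
lemma scale_mem: "u \<in> V \<Longrightarrow> cscale c u \<in> V" using fs.subspace_scale[OF sub] .
lemma sum_mem: "(\<And>i. i \<in> I \<Longrightarrow> f i \<in> V) \<Longrightarrow> sum f I \<in> V" using fs.subspace_sum[OF sub] .
lemmas mems = zero_mem add_mem diff_mem scale_mem sum_mem

lemma linT: "linear_map_on V (dual V) T"
  using hpd by (simp add: hermitian_pos_def_def)

lemmas T_mem = linear_map_on_mem[OF linT]

definition ip where "ip u v = T u (cnj_fun v)"

lemma ip_cnj: "u \<in> V \<Longrightarrow> v \<in> V \<Longrightarrow> ip u v = cnj (ip v u)"
  using hpd unfolding hermitian_pos_def_def ip_def by blast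

lemma ip_add_left: "u \<in> V \<Longrightarrow> v \<in> V \<Longrightarrow> ip (u + v) w = ip u w + ip v w"
  by (simp add: ip_def linear_map_on_add[OF linT] fun_apply)

lemma ip_scale_left: "u \<in> V \<Longrightarrow> ip (cscale c u) w = c * ip u w"
  by (simp add: ip_def linear_map_on_scale[OF linT] fun_apply)

lemma ip_diff_left: "u \<in> V \<Longrightarrow> v \<in> V \<Longrightarrow> ip (u - v) w = ip u w - ip v w"
  by (simp add: ip_def linear_map_on_diff[OF linT sub] fun_apply)

lemma ip_zero_left: "ip 0 w = 0"
  by (simp add: ip_def linear_map_on_zero[OF linT sub] fun_apply)

lemma ip_add_right: "u \<in> V \<Longrightarrow> v \<in> V \<Longrightarrow> w \<in> V \<Longrightarrow> ip w (u + v) = ip w u + ip w v"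
  by (simp add: ip_def cnj_fun_add dual_add[OF T_mem] cnj_closed)

lemma ip_scale_right: "u \<in> V \<Longrightarrow> w \<in> V \<Longrightarrow> ip w (cscale c u) = cnj c * ip w u"
  by (simp add: ip_def cnj_fun_scale dual_scale[OF T_mem] cnj_closed)

lemma ip_zero_right: "w \<in> V \<Longrightarrow> ip w 0 = 0"
  by (simp add: ip_def cnj_fun_zero dual_zero[OF T_mem sub])

lemma ip_diff_right: "u \<in> V \<Longrightarrow> v \<in> V \<Longrightarrow> w \<in> V \<Longrightarrow> ip w (u - v) = ip w u - ip w v"
  by (metis ip_add_right add_diff_cancel_right' diff_add_cancel diff_mem)

lemma ip_sum_left: "(\<And>i. i \<in> I \<Longrightarrow> f i \<in> V) \<Longrightarrow> ip (sum f I) w = (\<Sum>i\<in>I. ip (f i) w)"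
  by (simp add: ip_def linear_map_on_sum[OF linT sub] sum_fun_apply)

lemma ip_sum_right:
  assumes "\<And>i. i \<in> I \<Longrightarrow> f i \<in> V" "w \<in> V"
  shows "ip w (sum f I) = (\<Sum>i\<in>I. ip w (f i))"
proof -
  have "ip w (sum f I) = cnj (ip (sum f I) w)" using assms by (intro ip_cnj sum_mem) auto
  also have "\<dots> = (\<Sum>i\<in>I. cnj (ip (f i) w))" using assms by (simp add: ip_sum_left)
  also have "\<dots> = (\<Sum>i\<in>I. ip w (f i))"
    by (intro sum.cong refl ip_cnj[symmetric] assms)
  finally show ?thesis .
qed

abbreviation nrm where "nrm \<equiv> op_norm_primal T"

lemma ip_self: "u \<in> V \<Longrightarrow> ip u u = complex_of_real (Re (ip u u))"
  using ip_cnj[of u u] unfolding complex_eq_iff by simp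

lemma ip_pos: "u \<in> V \<Longrightarrow> u \<noteq> 0 \<Longrightarrow> Re (ip u u) > 0"
  using hpd unfolding hermitian_pos_def_def ip_def by blast

lemma ip_nonneg: "u \<in> V \<Longrightarrow> Re (ip u u) \<ge> 0"
  using ip_pos[of u] ip_zero_left[of 0] by (cases "u = 0") auto

lemma nrm_sq: "u \<in> V \<Longrightarrow> (nrm u)\<^sup>2 = Re (ip u u)"
  using ip_nonneg[of u] by (simp add: op_norm_primal_def ip_def)

lemma nrm_nonneg: "u \<in> V \<Longrightarrow> nrm u \<ge> 0"
  using ip_nonneg[of u] by (simp add: op_norm_primal_def ip_def)

lemma nrm_eq_0: "u \<in> V \<Longrightarrow> nrm u = 0 \<longleftrightarrow> u = 0"
  using ip_pos[of u] ip_zero_left[of 0] nrm_sq[of u] by (cases "u = 0") auto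

lemma nrm_zero: "nrm 0 = 0"
  using nrm_eq_0[OF zero_mem] by simp

lemma nrm_scale: "u \<in> V \<Longrightarrow> nrm (cscale c u) = cmod c * nrm u"
proof -
  assume u: "u \<in> V"
  have "ip (cscale c u) (cscale c u) = (c * cnj c) * ip u u"
    using u by (simp add: ip_scale_left ip_scale_right mems)
  also have "\<dots> = of_real ((cmod c)\<^sup>2) * ip u u"
    by (simp only: complex_norm_square)
  finally have "(nrm (cscale c u))\<^sup>2 = (cmod c * nrm u)\<^sup>2"
    using u by (simp add: nrm_sq mems power_mult_distrib)
  then show ?thesis
    using u by (simp add: power2_eq_iff_nonneg nrm_nonneg mems)
qed

lemma nrm_add_sq:
  assumes "u \<in> V" "v \<in> V"
  shows "(nrm (u + v))\<^sup>2 = (nrm u)\<^sup>2 + (nrm v)\<^sup>2 + 2 * Re (ip u v)"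
proof -
  have "Re (ip v u) = Re (ip u v)" using ip_cnj[OF assms(2,1)] by simp
  then show ?thesis
    using assms by (simp add: nrm_sq mems ip_add_left ip_add_right)
qed

lemma nrm_diff_sq:
  assumes "u \<in> V" "v \<in> V"
  shows "(nrm (u - v))\<^sup>2 = (nrm u)\<^sup>2 + (nrm v)\<^sup>2 - 2 * Re (ip u v)"
proof -
  have "Re (ip v u) = Re (ip u v)" using ip_cnj[OF assms(2,1)] by simp
  then show ?thesis
    using assms by (simp add: nrm_sq mems ip_diff_left ip_diff_right)
qed

lemma Re_ip_le:
  assumes u: "u \<in> V" and v: "v \<in> V"
  shows "Re (ip u v) \<le> nrm u * nrm v"
proof (cases "v = 0")
  case True
  then show ?thesis using u by (simp add: ip_zero_right nrm_zero)
next
  case False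
  then have n: "nrm v > 0" using nrm_eq_0[OF v] nrm_nonneg[OF v] by simp
  (* the multiple of v nearest to u *)
  define t where "t = Re (ip u v) / (nrm v)\<^sup>2"
  have "0 \<le> (nrm (u - cscale (of_real t) v))\<^sup>2" by simp
  also have "\<dots> = (nrm u)\<^sup>2 + t\<^sup>2 * (nrm v)\<^sup>2 - 2 * t * Re (ip u v)"
    using u v by (simp add: nrm_diff_sq mems nrm_scale ip_scale_right power_mult_distrib)
  also have "\<dots> = (nrm u)\<^sup>2 - (Re (ip u v))\<^sup>2 / (nrm v)\<^sup>2"
    using n by (simp add: t_def field_simps power2_eq_square)
  finally have "(Re (ip u v))\<^sup>2 \<le> (nrm u * nrm v)\<^sup>2"
    using n by (simp add: field_simps power_mult_distrib)
  then show ?thesis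
    by (rule power2_le_imp_le) (intro mult_nonneg_nonneg nrm_nonneg u v)
qed

lemma nrm_triangle:
  assumes "u \<in> V" "v \<in> V"
  shows "nrm (u + v) \<le> nrm u + nrm v"
proof -
  have "(nrm (u + v))\<^sup>2 \<le> (nrm u + nrm v)\<^sup>2"
    using nrm_add_sq[OF assms] Re_ip_le[OF assms] by (simp add: power2_sum)
  then show ?thesis
    by (rule power2_le_imp_le) (intro add_nonneg_nonneg nrm_nonneg assms)
qed

lemma pythagoras:
  assumes "u \<in> V" "v \<in> V" "ip u v = 0"
  shows "(nrm (u + v))\<^sup>2 = (nrm u)\<^sup>2 + (nrm v)\<^sup>2"
  using nrm_add_sq[OF assms(1,2)] assms(3) by simp

text \<open>
  The Riesz representation theorem for the inner product of \<open>T\<close>. It identifies the dual with \<open>V\<close>, and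
  \<open>dnrm_T\<close> says that the identification is isometric, so that norm estimates on the dual can be
  made on \<open>V\<close>.
\<close>

lemma bij_T: "bij_betw T V (dual V)"
proof -
  have "inj_on T V"
  proof (rule linear_map_on_inj_onI[OF linT sub])
    fix u assume u: "u \<in> V" "T u = 0"
    then have "ip u u = 0" by (simp add: ip_def fun_apply)
    then show "u = 0" using ip_pos[OF u(1)] by force
  qed
  then show ?thesis
    using linear_inj_dual_onto[OF fd linT] by (simp add: bij_betw_def)
qed

abbreviation Ti where "Ti \<equiv> inv_into V T"

lemma lin_Ti: "linear_map_on (dual V) V Ti"
  using linear_map_on_inv_into[OF linT sub bij_T] .

lemma Ti_mem: "q \<in> dual V \<Longrightarrow> Ti q \<in> V"
  using linear_map_on_mem[OF lin_Ti] .

lemma T_Ti: "q \<in> dual V \<Longrightarrow> T (Ti q) = q"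
  using bij_T by (simp add: bij_betw_def f_inv_into_f)

lemma Ti_T: "u \<in> V \<Longrightarrow> Ti (T u) = u"
  using bij_T by (simp add: bij_betw_def)

abbreviation dnrm where "dnrm \<equiv> op_norm_dual V T"

lemma dnrm_T: "u \<in> V \<Longrightarrow> dnrm (T u) = nrm u"
proof -
  assume u: "u \<in> V"
  have "cnj_functional (T u) u = cnj (ip u u)"
    by (simp add: cnj_functional_def ip_def)
  then show ?thesis
    using u by (simp add: op_norm_dual_def Ti_T op_norm_primal_def ip_def)
qed

lemma dnrm_eq: "q \<in> dual V \<Longrightarrow> dnrm q = nrm (Ti q)"
  using dnrm_T[OF Ti_mem] T_Ti by metis

lemma dual_add_mem: "q \<in> dual V \<Longrightarrow> r \<in> dual V \<Longrightarrow> q + r \<in> dual V"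
  using fs.subspace_add[OF subspace_dual] .
lemma dual_diff_mem: "q \<in> dual V \<Longrightarrow> r \<in> dual V \<Longrightarrow> q - r \<in> dual V"
  using fs.subspace_diff[OF subspace_dual] .
lemma dual_scale_mem: "q \<in> dual V \<Longrightarrow> cscale c q \<in> dual V"
  using fs.subspace_scale[OF subspace_dual] .
lemma dual_zero_mem: "0 \<in> dual V"
  using fs.subspace_0[OF subspace_dual] .
lemmas dual_mems = dual_add_mem dual_diff_mem dual_scale_mem dual_zero_mem

lemma dnrm_nonneg: "q \<in> dual V \<Longrightarrow> dnrm q \<ge> 0"
  by (simp add: dnrm_eq nrm_nonneg Ti_mem)

lemma dnrm_eq_0: "q \<in> dual V \<Longrightarrow> dnrm q = 0 \<longleftrightarrow> q = 0"
proof -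
  assume q: "q \<in> dual V"
  have "dnrm q = 0 \<longleftrightarrow> Ti q = 0" using q by (simp add: dnrm_eq nrm_eq_0 Ti_mem)
  also have "\<dots> \<longleftrightarrow> q = 0"
    using T_Ti[OF q] linear_map_on_zero[OF linT sub] linear_map_on_zero[OF lin_Ti subspace_dual] by metis
  finally show ?thesis .
qed

lemma dnrm_triangle: "q \<in> dual V \<Longrightarrow> r \<in> dual V \<Longrightarrow> dnrm (q + r) \<le> dnrm q + dnrm r"
  by (simp add: dnrm_eq dual_mems linear_map_on_add[OF lin_Ti] nrm_triangle Ti_mem)

lemma dnrm_scale: "q \<in> dual V \<Longrightarrow> dnrm (cscale c q) = cmod c * dnrm q"
  by (simp add: dnrm_eq dual_mems linear_map_on_scale[OF lin_Ti] nrm_scale Ti_mem)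

lemma dnrm_minus_commute: "q \<in> dual V \<Longrightarrow> r \<in> dual V \<Longrightarrow> dnrm (q - r) = dnrm (r - q)"
proof -
  assume "q \<in> dual V" "r \<in> dual V"
  moreover have "q - r = cscale (- 1) (r - q)" by (auto simp: fun_eq_iff fun_apply)
  ultimately show ?thesis using dnrm_scale[OF dual_diff_mem, of r q "- 1"] by simp
qed

lemma dnrm_triangle_diff: "q \<in> dual V \<Longrightarrow> r \<in> dual V \<Longrightarrow> dnrm (q - r) \<le> dnrm q + dnrm r"
proof -
  assume qr: "q \<in> dual V" "r \<in> dual V"
  have "q - r = q + cscale (- 1) r" by (auto simp: fun_eq_iff fun_apply)
  then show ?thesis
    using dnrm_triangle[OF qr(1) dual_scale_mem[OF qr(2)], of "- 1"] dnrm_scale[OF qr(2), of "- 1"] by simp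
qed

lemma dual_inj_endo_onto:
  assumes "linear_map_on (dual V) (dual V) L" "inj_on L (dual V)"
  shows "bij_betw L (dual V) (dual V)"
  using linear_inj_endo_onto[OF fin_dim_dual[OF fd] assms] assms(2) by (simp add: bij_betw_def)

end

section \<open>Chebyshev polynomials\<close>

fun cheb :: "nat \<Rightarrow> complex poly" where
  "cheb 0 = 1"
| "cheb (Suc 0) = [:0, 1:]"
| "cheb (Suc (Suc n)) = [:0, 2:] * cheb (Suc n) - cheb n"

lemma degree_cheb: "degree (cheb n) \<le> n"
proof (induction n rule: cheb.induct)
  case (3 n)
  have "degree ([:0, 2:] * cheb (Suc n)) \<le> degree [:0, 2 :: complex:] + degree (cheb (Suc n))"
    by (rule degree_mult_le)
  then show ?case
    using 3 degree_diff_le[of "[:0, 2:] * cheb (Suc n)" "Suc (Suc n)" "cheb n"] by simp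
qed auto

text \<open>
  Both estimates for Chebyshev polynomials follow from this one identity: \<open>z\<close> on the unit circle
  gives the bound on \<open>[-1, 1]\<close>, and real \<open>z > 1\<close> gives the growth outside.
\<close>

lemma poly_cheb_joukowski:
  assumes z: "z \<noteq> 0"
  shows "poly (cheb n) ((z + inverse z) / 2) = (z ^ n + inverse z ^ n) / 2"
proof (induction n rule: cheb.induct)
  case (3 n)
  define w where "w = inverse z"
  have zw: "z * w = 1" using z by (simp add: w_def)
  have 1: "(z + w) * (z ^ Suc n + w ^ Suc n) = z ^ Suc (Suc n) + w ^ Suc (Suc n) + (z * w) * (z ^ n + w ^ n)"
    by (simp add: algebra_simps)
  have "poly (cheb (Suc (Suc n))) ((z + w) / 2) = (z + w) * ((z ^ Suc n + w ^ Suc n) / 2) - (z ^ n + w ^ n) / 2"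
  proof -
    have "poly [:0, 2:] ((z + w) / 2) = z + w" by simp
    then show ?thesis using 3 unfolding w_def[symmetric] by (simp only: cheb.simps poly_diff poly_mult)
  qed
  also have "\<dots> = ((z + w) * (z ^ Suc n + w ^ Suc n) - (z ^ n + w ^ n)) / 2"
    by (simp add: diff_divide_distrib)
  also have "\<dots> = (z ^ Suc (Suc n) + w ^ Suc (Suc n)) / 2"
    unfolding 1 zw by simp
  finally show ?case by (simp add: w_def)
qed (auto simp: field_simps)

lemma cmod_poly_cheb_le:
  assumes "\<bar>x\<bar> \<le> 1"
  shows "cmod (poly (cheb n) (of_real x)) \<le> 1"
proof -
  define z where "z = cis (arccos x)"
  have i: "inverse z = cnj z" by (simp add: z_def cis_cnj)
  have "(z + inverse z) / 2 = of_real x"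
    unfolding i using assms by (simp add: z_def complex_eq_iff)
  then have "poly (cheb n) (of_real x) = (z ^ n + inverse z ^ n) / 2"
    using poly_cheb_joukowski[of z n] by (simp add: z_def)
  also have "cmod \<dots> \<le> (cmod (z ^ n) + cmod (inverse z ^ n)) / 2"
    using norm_triangle_ineq[of "z ^ n" "inverse z ^ n"] by simp
  also have "\<dots> = 1" by (simp add: z_def norm_power norm_inverse)
  finally show ?thesis .
qed

text \<open>
  The rescaled Chebyshev polynomial is the classical residual polynomial of the conjugate gradient
  method. The affine map takes \<open>[a, b]\<close> to \<open>[-1, 1]\<close> and 0 to \<open>x0 = (b + a) / (b - a)\<close>, and
  \<open>x0 = (z + 1/z) / 2\<close> for \<open>z = (sqrt \<kappa> + 1) / (sqrt \<kappa> - 1)\<close>, so that dividing by the value at \<open>x0\<close>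
  gains the factor \<open>2 / z ^ k\<close>.
\<close>

lemma residual_polynomial:
  fixes a b :: real
  assumes a: "0 < a" and ab: "a \<le> b" and k: "k \<ge> 1"
  defines "\<kappa> \<equiv> b / a"
  shows "\<exists>p. degree p \<le> k \<and> poly p 0 = 1 \<and>
    (\<forall>x\<in>{a..b}. cmod (poly p (of_real x)) \<le> 2 * ((sqrt \<kappa> - 1) / (sqrt \<kappa> + 1)) ^ k)"
proof (cases "a = b")
  case True
  then show ?thesis
    using a k by (intro exI[of _ "[:1, - 1 / of_real a:]"]) (auto simp: \<kappa>_def)
next
  case False
  then have ab: "a < b" using ab by simp
  define s where "s = sqrt \<kappa>"
  have \<kappa>: "\<kappa> > 1" using a ab by (simp add: \<kappa>_def)
  then have s1: "s > 1" by (simp add: s_def)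
  have s2: "s * s = \<kappa>" using \<kappa> by (simp add: s_def)
  define z where "z = (s + 1) / (s - 1)"
  have z0: "z > 0" using s1 by (simp add: z_def)
  define x0 where "x0 = (b + a) / (b - a)"
  have bk: "b = \<kappa> * a" using a by (simp add: \<kappa>_def)
  have x0s: "x0 = (s * s + 1) / (s * s - 1)"
  proof -
    have "b + a = a * (\<kappa> + 1)" "b - a = a * (\<kappa> - 1)" by (simp_all add: bk algebra_simps)
    then show ?thesis using a by (simp add: x0_def s2)
  qed
  have "(s + 1) * (s - 1) = s * s - 1" by (simp add: algebra_simps)
  then have "(z + inverse z) / 2 = ((s + 1) * (s + 1) + (s - 1) * (s - 1)) / (2 * (s * s - 1))"
    using s1 by (simp add: z_def add_frac_eq mult.commute)
  also have "\<dots> = x0" using s1 \<kappa> s2 by (simp add: x0s field_simps)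
  finally have x0z: "(z + inverse z) / 2 = x0" .
  define t where "t = (z ^ k + inverse z ^ k) / 2"
  have "(of_real z + inverse (of_real z)) / 2 = complex_of_real x0"
    unfolding x0z[symmetric] by simp
  then have ct: "poly (cheb k) (of_real x0) = of_real t"
    using poly_cheb_joukowski[of "of_real z" k] z0 by (simp add: t_def)
  have t: "t \<ge> z ^ k / 2" "t > 0"
    using z0 by (auto simp: t_def intro!: add_pos_pos)
  define p where "p = smult (1 / of_real t) (pcompose (cheb k) [:of_real x0, - of_real (2 / (b - a)):])"
  have "degree (pcompose (cheb k) [:of_real x0, - of_real (2 / (b - a)):]) \<le> k"
    using degree_cheb[of k] ab by (simp add: degree_pcompose)
  then have "degree p \<le> k"
    unfolding p_def by (rule order_trans[OF degree_smult_le])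
  moreover have "poly p 0 = 1"
    using t by (simp add: p_def poly_pcompose ct)
  moreover have "cmod (poly p (of_real x)) \<le> 2 * ((s - 1) / (s + 1)) ^ k" if x: "x \<in> {a..b}" for x
  proof -
    define y where "y = x0 - 2 / (b - a) * x"
    have y: "y = (b + a - 2 * x) / (b - a)"
      by (simp add: y_def x0_def diff_divide_distrib)
    have "\<bar>y\<bar> \<le> 1"
      using x ab by (auto simp: y abs_le_iff field_simps)
    then have c: "cmod (poly (cheb k) (of_real y)) \<le> 1" by (rule cmod_poly_cheb_le)
    have "poly p (of_real x) = poly (cheb k) (of_real y) / of_real t"
      by (simp add: p_def poly_pcompose y_def algebra_simps)
    then have "cmod (poly p (of_real x)) \<le> 1 / t"
      using c t by (simp add: norm_divide divide_right_mono)
    also have "\<dots> \<le> 1 / (z ^ k / 2)"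
      using t z0 by (intro divide_left_mono) auto
    also have "\<dots> = 2 * ((s - 1) / (s + 1)) ^ k"
      by (simp add: z_def power_divide)
    finally show ?thesis .
  qed
  ultimately show ?thesis unfolding s_def by blast
qed

section \<open>Best approximation\<close>

context hermitian_space
begin

text \<open>
  Gram-Schmidt without a basis: the vectors may be dependent, as Krylov vectors are once the
  iteration has converged. In the induction step the new vector is replaced by its component \<open>a'\<close>
  orthogonal to the previous ones, and nothing has to be corrected if \<open>a' = 0\<close>.
\<close>

lemma orthogonal_combination:
  fixes k :: nat
  assumes a: "\<And>i. i < k \<Longrightarrow> a i \<in> V" and e: "e \<in> V"
  shows "\<exists>c. \<forall>j<k. ip (e - (\<Sum>i<k. cscale (c i) (a i))) (a j) = 0"
  using assms
proof (induction k arbitrary: e)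
  case (Suc k)
  define L where "L c = (\<Sum>i<k. cscale (c i) (a i))" for c
  have aV: "\<And>i. i \<le> k \<Longrightarrow> a i \<in> V" using Suc.prems by simp
  have L: "L c \<in> V" for c unfolding L_def using aV by (intro mems) auto
  obtain c where c: "\<And>j. j < k \<Longrightarrow> ip (e - L c) (a j) = 0"
    using Suc.IH[of e] Suc.prems unfolding L_def by (metis less_Suc_eq)
  obtain d where d: "\<And>j. j < k \<Longrightarrow> ip (a k - L d) (a j) = 0"
    using Suc.IH[of "a k"] Suc.prems unfolding L_def by (metis less_Suc_eq lessI)
  define e' where "e' = e - L c"
  define a' where "a' = a k - L d"
  have e': "e' \<in> V" and a': "a' \<in> V" using L aV Suc.prems by (auto simp: e'_def a'_def intro: mems)
  have ortL: "ip u (L f) = 0" if "u \<in> V" "\<And>j. j < k \<Longrightarrow> ip u (a j) = 0" for u f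
    unfolding L_def using that aV by (subst ip_sum_right) (auto intro: mems simp: ip_scale_right)
  define t where "t = (if a' = 0 then 0 else ip e' a' / ip a' a')"
  define u where "u = e' - cscale t a'"
  have u: "u \<in> V" using e' a' by (auto simp: u_def intro: mems)
  have uj: "ip u (a j) = 0" if "j < k" for j
    using c[OF that] d[OF that] e' a' unfolding u_def by (simp add: ip_diff_left ip_scale_left mems e'_def a'_def)
  have "ip u a' = 0"
  proof (cases "a' = 0")
    case True then show ?thesis using u by (simp add: ip_zero_right)
  next
    case False
    then have "ip a' a' \<noteq> 0" using ip_pos[OF a'] by force
    then show ?thesis using False e' a' by (simp add: u_def t_def ip_diff_left ip_scale_left mems)
  qed
  moreover have "a k = a' + L d" by (simp add: a'_def)
  ultimately have uk: "ip u (a k) = 0"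
    using ortL[OF u uj] u a' L by (simp add: ip_add_right)
  (* coefficients of e - u in the original vectors *)
  define f where "f i = (if i < k then c i - t * d i else t)" for i
  have "L f = L c - cscale t (L d)"
    unfolding L_def f_def
    by (auto simp: fun_eq_iff fun_apply sum_fun_apply algebra_simps sum_subtractf sum_distrib_left)
  then have "e - (\<Sum>i<Suc k. cscale (f i) (a i)) = u"
    unfolding u_def e'_def a'_def
    by (auto simp: fun_eq_iff fun_apply L_def[of f, symmetric] f_def[of k] algebra_simps)
  moreover have "ip u (a j) = 0" if "j < Suc k" for j
    using uj[of j] uk that by (cases "j = k") auto
  ultimately show ?case by metis
qed auto

text \<open>
  The point with orthogonal error is the minimiser, and by Pythagoras every other point is strictly
  worse. Uniqueness matters because PCG iterates are defined by a definite description.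
\<close>

lemma affine_minimiser:
  fixes k :: nat
  assumes x0: "x0 \<in> V" and a: "\<And>i. i < k \<Longrightarrow> a i \<in> V" and s: "s \<in> V"
  defines "K \<equiv> {x0 + (\<Sum>i<k. cscale (c i) (a i)) | c. True}"
  shows "\<exists>!\<eta>. \<eta> \<in> K \<and> (\<forall>\<zeta>\<in>K. nrm (s - \<eta>) \<le> nrm (s - \<zeta>))"
proof -
  define L where "L c = (\<Sum>i<k. cscale (c i) (a i))" for c
  have L: "L c \<in> V" for c unfolding L_def using a by (intro mems) auto
  obtain c where "\<forall>j<k. ip (s - x0 - (\<Sum>i<k. cscale (c i) (a i))) (a j) = 0"
    using orthogonal_combination[of k a "s - x0", OF a diff_mem[OF s x0]] by blast
  then have c: "ip (s - x0 - L c) (a j) = 0" if "j < k" for j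
    using that by (simp add: L_def)
  define \<eta> where "\<eta> = x0 + L c"
  have \<eta>: "\<eta> \<in> V" using x0 L by (simp add: \<eta>_def mems)
  have s\<eta>: "s - \<eta> = s - x0 - L c" by (simp add: \<eta>_def)
  have K: "\<zeta> \<in> K \<longleftrightarrow> (\<exists>d. \<zeta> = x0 + L d)" for \<zeta> by (auto simp: K_def L_def)
  have split: "(nrm (s - \<zeta>))\<^sup>2 = (nrm (s - \<eta>))\<^sup>2 + (nrm (\<eta> - \<zeta>))\<^sup>2" if \<zeta>K: "\<zeta> \<in> K" for \<zeta>
  proof -
    obtain d where d: "\<zeta> = x0 + L d" using \<zeta>K K by blast
    have \<zeta>: "\<zeta> \<in> V" using x0 L by (simp add: d mems)
    have "\<eta> - \<zeta> = L (\<lambda>i. c i - d i)"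
      by (auto simp: \<eta>_def d L_def fun_eq_iff fun_apply sum_fun_apply algebra_simps sum_subtractf)
    moreover have "ip (s - \<eta>) (L f) = 0" for f
    proof -
      have "ip (s - \<eta>) (L f) = (\<Sum>i<k. ip (s - \<eta>) (cscale (f i) (a i)))"
        unfolding L_def[of f] using a s \<eta> by (intro ip_sum_right mems) auto
      also have "\<dots> = (\<Sum>i<k. 0)"
        using a c s \<eta> by (intro sum.cong refl) (simp add: ip_scale_right diff_mem s\<eta>[symmetric])
      finally show ?thesis by simp
    qed
    ultimately have "ip (s - \<eta>) (\<eta> - \<zeta>) = 0" by simp
    then show ?thesis using pythagoras[of "s - \<eta>" "\<eta> - \<zeta>"] s \<eta> \<zeta> by (simp add: mems)
  qed
  have KV: "\<zeta> \<in> V" if "\<zeta> \<in> K" for \<zeta> using that K L x0 by (auto intro: mems)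
  have \<eta>K: "\<eta> \<in> K" using K \<eta>_def by blast
  show ?thesis
  proof (rule ex1I[of _ \<eta>], intro conjI ballI)
    fix \<zeta> assume \<zeta>: "\<zeta> \<in> K"
    have "(nrm (s - \<eta>))\<^sup>2 \<le> (nrm (s - \<zeta>))\<^sup>2" using split[OF \<zeta>] by simp
    then show "nrm (s - \<eta>) \<le> nrm (s - \<zeta>)"
      by (rule power2_le_imp_le) (intro nrm_nonneg diff_mem s KV[OF \<zeta>])
  next
    fix \<zeta> assume \<zeta>: "\<zeta> \<in> K \<and> (\<forall>\<zeta>'\<in>K. nrm (s - \<zeta>) \<le> nrm (s - \<zeta>'))"
    then have "nrm (s - \<zeta>) \<le> nrm (s - \<eta>)" using \<eta>K by blast
    then have "(nrm (s - \<zeta>))\<^sup>2 \<le> (nrm (s - \<eta>))\<^sup>2"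
      by (intro power_mono nrm_nonneg diff_mem s KV) (use \<zeta> in auto)
    then have "(nrm (\<eta> - \<zeta>))\<^sup>2 \<le> 0" using split[of \<zeta>] \<zeta> by linarith
    then have "nrm (\<eta> - \<zeta>) = 0" by simp
    then have "\<eta> - \<zeta> = 0" using nrm_eq_0[OF diff_mem[OF \<eta> KV]] \<zeta> by blast
    then show "\<zeta> = \<eta>" by simp
  qed (rule \<eta>K)
qed

lemma nrm_sum_orthogonal:
  assumes "finite I" "\<And>i. i \<in> I \<Longrightarrow> f i \<in> V"
    "\<And>i j. i \<in> I \<Longrightarrow> j \<in> I \<Longrightarrow> i \<noteq> j \<Longrightarrow> ip (f i) (f j) = 0"
  shows "(nrm (sum f I))\<^sup>2 = (\<Sum>i\<in>I. (nrm (f i))\<^sup>2)"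
  using assms
proof (induction I rule: finite_induct)
  case empty
  then show ?case by (simp add: nrm_zero)
next
  case (insert x F)
  have "ip (f x) (sum f F) = (\<Sum>i\<in>F. ip (f x) (f i))"
    using insert.prems by (intro ip_sum_right) auto
  also have "\<dots> = 0"
    using insert.prems insert.hyps by (intro sum.neutral) auto
  finally have "(nrm (f x + sum f F))\<^sup>2 = (nrm (f x))\<^sup>2 + (nrm (sum f F))\<^sup>2"
    using insert.prems by (intro pythagoras mems) auto
  then show ?case using insert by simp
qed

end

section \<open>Selfadjoint maps\<close>

definition poly_op :: "(('x \<Rightarrow> complex) \<Rightarrow> 'x \<Rightarrow> complex) \<Rightarrow> complex poly \<Rightarrow> ('x \<Rightarrow> complex) \<Rightarrow> 'x \<Rightarrow> complex" where
  "poly_op N p v = (\<Sum>i\<le>degree p. cscale (coeff p i) ((N ^^ i) v))"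

lemma poly_op_bound:
  assumes "degree p \<le> n"
  shows "poly_op N p v = (\<Sum>i\<le>n. cscale (coeff p i) ((N ^^ i) v))"
  unfolding poly_op_def
proof (rule sum.mono_neutral_left)
  show "\<forall>i\<in>{..n} - {..degree p}. cscale (coeff p i) ((N ^^ i) v) = 0"
    by (auto simp: coeff_eq_0 fun_eq_iff fun_apply)
qed (use assms in auto)

text \<open>
  The abstract form of preconditioned conjugate gradient: \<open>M\<close> is the matrix of the linear system and
  \<open>N\<close> the preconditioned matrix, which is selfadjoint and positive for the inner product of \<open>M\<close>.
\<close>

locale selfadjoint_map = hermitian_space V M
  for V :: "('x \<Rightarrow> complex) set" and M :: "('x \<Rightarrow> complex) \<Rightarrow> ('x \<Rightarrow> complex) \<Rightarrow> complex" +
  fixes N :: "('x \<Rightarrow> complex) \<Rightarrow> 'x \<Rightarrow> complex"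
  assumes linN: "linear_map_on V V N"
    and selfadjoint: "\<And>u v. u \<in> V \<Longrightarrow> v \<in> V \<Longrightarrow> ip (N u) v = ip u (N v)"
    and positive: "\<And>u. u \<in> V \<Longrightarrow> u \<noteq> 0 \<Longrightarrow> Re (ip (N u) u) > 0"
begin

lemmas N_mem = linear_map_on_mem[OF linN]

lemma lin_power: "linear_map_on V V (N ^^ i)"
proof (induction i)
  case 0
  then show ?case by (simp add: linear_map_on_def)
next
  case (Suc i)
  then show ?case using linear_map_on_compose[OF Suc linN] by (simp add: o_def)
qed

lemmas power_mem = linear_map_on_mem[OF lin_power]

lemma power_eigen:
  assumes "w \<in> V" "N w = cscale \<mu> w"
  shows "(N ^^ i) w = cscale (\<mu> ^ i) w"
proof (induction i)
  case (Suc i)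
  then show ?case using assms by (simp add: linear_map_on_scale[OF linN] fs.scale_scale mult.commute)
qed (simp add: fs.scale_one)

lemma poly_op_eigen:
  assumes "w \<in> V" "N w = cscale \<mu> w"
  shows "poly_op N p w = cscale (poly p \<mu>) w"
  unfolding poly_op_def
  by (auto simp: power_eigen[OF assms] fun_eq_iff fun_apply sum_fun_apply poly_altdef
      sum_distrib_right mult.assoc)

lemma lin_poly_op: "linear_map_on V V (poly_op N p)"
proof -
  have "linear_map_on V V (\<lambda>v. \<Sum>i\<in>I. cscale (c i) ((N ^^ i) v))" for I and c :: "nat \<Rightarrow> complex"
    unfolding linear_map_on_def
  proof (intro conjI ballI allI)
    fix u v assume "u \<in> V" "v \<in> V"
    then show "(\<Sum>i\<in>I. cscale (c i) ((N ^^ i) (u + v)))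
        = (\<Sum>i\<in>I. cscale (c i) ((N ^^ i) u)) + (\<Sum>i\<in>I. cscale (c i) ((N ^^ i) v))"
      by (simp add: linear_map_on_add[OF lin_power] fs.scale_right_distrib sum.distrib)
  next
    fix a u assume "u \<in> V"
    then show "(\<Sum>i\<in>I. cscale (c i) ((N ^^ i) (cscale a u))) = cscale a (\<Sum>i\<in>I. cscale (c i) ((N ^^ i) u))"
      by (simp add: linear_map_on_scale[OF lin_power] fs.scale_sum_right fs.scale_scale mult.commute)
  qed (auto intro: mems power_mem)
  then show ?thesis unfolding poly_op_def .
qed

lemma poly_op_root_factor:
  assumes v: "v \<in> V"
  shows "poly_op N ([:- r, 1:] * q) v = poly_op N q (N v - cscale r v)"
proof -
  define n where "n = degree q"
  have p: "[:- r, 1:] * q = pCons 0 q + smult (- r) q" by simp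
  have d: "degree ([:- r, 1:] * q) \<le> Suc n"
    using degree_mult_le[of "[:- r, 1:]" q] by (simp add: n_def)
  have "poly_op N ([:- r, 1:] * q) v
      = (\<Sum>i\<le>Suc n. cscale (coeff (pCons 0 q) i) ((N ^^ i) v) - cscale (r * coeff q i) ((N ^^ i) v))"
    unfolding poly_op_bound[OF d] by (intro sum.cong refl) (auto simp: p fun_eq_iff fun_apply algebra_simps)
  also have "\<dots> = (\<Sum>i\<le>Suc n. cscale (coeff (pCons 0 q) i) ((N ^^ i) v)) - (\<Sum>i\<le>Suc n. cscale (r * coeff q i) ((N ^^ i) v))"
    by (rule sum_subtractf)
  also have "(\<Sum>i\<le>Suc n. cscale (coeff (pCons 0 q) i) ((N ^^ i) v)) = (\<Sum>i\<le>n. cscale (coeff q i) ((N ^^ i) (N v)))"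
    by (subst sum.atMost_Suc_shift) (simp add: funpow_swap1)
  also have "(\<Sum>i\<le>Suc n. cscale (r * coeff q i) ((N ^^ i) v)) = cscale r (\<Sum>i\<le>n. cscale (coeff q i) ((N ^^ i) v))"
    by (simp add: coeff_eq_0 n_def fs.scale_sum_right fs.scale_scale)
  finally have "poly_op N ([:- r, 1:] * q) v = poly_op N q (N v) - cscale r (poly_op N q v)"
    by (simp add: poly_op_def n_def fun_diff_def)
  then show ?thesis
    using v N_mem by (simp add: linear_map_on_diff[OF lin_poly_op sub] linear_map_on_scale[OF lin_poly_op] mems)
qed

text \<open>
  More powers of \<open>N\<close> than the dimension, applied to one vector, satisfy a linear relation. If two of
  the powers coincide, the set of powers may be independent, and their difference is the relation.
\<close>

lemma annihilator_exists:
  assumes v: "v \<in> V"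
  obtains p where "p \<noteq> 0" "poly_op N p v = 0"
proof -
  obtain B where B: "finite B" "fs.span B = V" using fin_dim_basis[OF fd] by metis
  define n where "n = card B"
  define f where "f i = (N ^^ i) v" for i
  have f: "f i \<in> V" for i unfolding f_def using power_mem v by blast
  have "\<exists>c. (\<exists>i\<le>n. c i \<noteq> 0) \<and> (\<Sum>i\<le>n. cscale (c i) (f i)) = 0"
  proof (cases "inj_on f {..n}")
    case True
    have "\<not> fs.independent (f ` {..n})"
    proof
      assume "fs.independent (f ` {..n})"
      then have "card (f ` {..n}) \<le> card B"
        using fs.independent_span_bound[OF B(1), of "f ` {..n}"] f B(2) by auto
      then show False using card_image[OF True] by (simp add: n_def)
    qed
    then obtain c where c: "\<exists>u\<in>f ` {..n}. c u \<noteq> 0" "(\<Sum>u\<in>f ` {..n}. cscale (c u) u) = 0"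
      using fs.dependent_finite[of "f ` {..n}"] by auto
    have "(\<Sum>i\<le>n. cscale (c (f i)) (f i)) = 0"
      using c(2) by (simp add: sum.reindex[OF True])
    then show ?thesis using c(1) by (intro exI[of _ "\<lambda>i. c (f i)"]) auto
  next
    case False
    then obtain i j where ij: "i \<le> n" "j \<le> n" "i \<noteq> j" "f i = f j" by (auto simp: inj_on_def)
    define c :: "nat \<Rightarrow> complex" where "c l = (if l = i then 1 else 0) - (if l = j then 1 else 0)" for l
    have "(\<Sum>l\<le>n. cscale (c l) (f l)) x = 0" for x
      using ij(1-2) arg_cong[OF ij(4), of "\<lambda>g. g x"]
      by (simp add: c_def sum_fun_apply fun_apply left_diff_distrib sum_subtractf if_distrib[of "\<lambda>a. a * _"] cong: if_cong)
    then have "(\<Sum>l\<le>n. cscale (c l) (f l)) = 0" by (auto simp: fun_apply fun_eq_iff)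
    moreover have "c i \<noteq> 0" using ij by (simp add: c_def)
    ultimately show ?thesis using ij(1) by blast
  qed
  then obtain c where c: "\<exists>i\<le>n. c i \<noteq> 0" "(\<Sum>i\<le>n. cscale (c i) (f i)) = 0" by blast
  define p where "p = (\<Sum>i\<le>n. monom (c i) i)"
  have cp: "coeff p i = (if i \<le> n then c i else 0)" for i
    by (simp add: p_def coeff_sum)
  have "degree p \<le> n" by (rule degree_le) (simp add: cp)
  then have "poly_op N p v = (\<Sum>i\<le>n. cscale (c i) (f i))"
    by (simp add: poly_op_bound cp f_def)
  moreover have "p \<noteq> 0" using c(1) cp by (metis coeff_0)
  ultimately show ?thesis using that c(2) by metis
qed

lemma eigenvalue_real_pos:
  assumes w: "w \<in> V" "w \<noteq> 0" "N w = cscale \<mu> w"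
  shows "\<mu> = of_real (Re \<mu>)" "Re \<mu> > 0"
proof -
  have "\<mu> * ip w w = cnj \<mu> * ip w w"
    using selfadjoint[OF w(1) w(1)] w by (simp add: ip_scale_left ip_scale_right)
  moreover have "ip w w \<noteq> 0" using ip_pos[OF w(1,2)] by force
  ultimately have "\<mu> = cnj \<mu>" by simp
  then show *: "\<mu> = of_real (Re \<mu>)" by (simp add: complex_eq_iff)
  have "0 < Re (\<mu> * ip w w)" using positive[OF w(1,2)] w by (simp add: ip_scale_left)
  also have "\<dots> = Re \<mu> * Re (ip w w)" by (subst *) simp
  finally show "Re \<mu> > 0" using ip_pos[OF w(1,2)] by (simp add: zero_less_mult_iff)
qed

lemma eigen_orthogonal:
  assumes u: "u \<in> V" "N u = cscale \<nu> u" and w: "w \<in> V" "N w = cscale \<mu> w" and ne: "\<nu> \<noteq> \<mu>"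
  shows "ip u w = 0"
proof (cases "w = 0")
  case True
  then show ?thesis using u by (simp add: ip_zero_right)
next
  case False
  have "cnj \<mu> = \<mu>" using eigenvalue_real_pos(1)[OF w(1) False w(2)] by (metis complex_cnj_complex_of_real)
  moreover have "\<nu> * ip u w = cnj \<mu> * ip u w"
    using selfadjoint[OF u(1) w(1)] u w by (simp add: ip_scale_left ip_scale_right)
  ultimately show ?thesis using ne by simp
qed

text \<open>
  Selfadjointness excludes generalised eigenvectors, because
  \<open>ip w w = ip ((N - r) v) w = ip v ((N - r) w) = 0\<close> for a real eigenvalue \<open>r\<close>.
\<close>

lemma no_jordan_block:
  assumes v: "v \<in> V" and w: "w = N v - cscale r v" and eig: "N w = cscale r w"
  shows "w = 0"
proof (rule ccontr)
  assume nz: "w \<noteq> 0"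
  have wV: "w \<in> V" using v N_mem by (simp add: w mems)
  have r: "cnj r = r" using eigenvalue_real_pos(1)[OF wV nz eig] by (metis complex_cnj_complex_of_real)
  have "ip w w = ip (N v) w - r * ip v w"
    using v wV N_mem by (subst (1) w) (simp add: ip_diff_left ip_scale_left mems)
  also have "\<dots> = 0"
    using selfadjoint[OF v wV] eig v wV r by (simp add: ip_scale_right)
  finally show False using ip_pos[OF wV nz] by simp
qed

text \<open>
  The spectral theorem for one vector, by induction on the degree of an annihilating polynomial.
  Splitting off a root \<open>r\<close> leaves a polynomial that annihilates \<open>u = (N - r) v\<close>, so \<open>u\<close> is a sum of
  eigenvectors. Those with eigenvalue different from \<open>r\<close> have preimages under \<open>N - r\<close>; after
  subtracting these from \<open>v\<close>, the rest \<open>v'\<close> is a generalised eigenvector for \<open>r\<close>, hence an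
  eigenvector.
\<close>

lemma eigen_decomposition_aux:
  assumes "degree p = n" "p \<noteq> 0" "v \<in> V" "poly_op N p v = 0"
  shows "\<exists>\<Lambda> w. finite \<Lambda> \<and> (\<forall>\<mu>\<in>\<Lambda>. w \<mu> \<in> V \<and> N (w \<mu>) = cscale \<mu> (w \<mu>)) \<and> v = (\<Sum>\<mu>\<in>\<Lambda>. w \<mu>)"
  using assms
proof (induction n arbitrary: p v)
  case 0
  then obtain c where c: "p = [:c:]" using degree_0_id by metis
  then have "c \<noteq> 0" using 0 by simp
  moreover have "cscale c v = 0" using 0 c by (simp add: poly_op_def)
  ultimately have "v = 0" by (simp add: fs.scale_eq_0_iff)
  then show ?case by (intro exI[of _ "{}"]) simp
next
  case (Suc n)
  have "\<not> constant (poly p)" using Suc.prems(1) by (simp add: constant_degree)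
  then obtain r where "poly p r = 0" using fundamental_theorem_of_algebra by blast
  then obtain q where q: "p = [:- r, 1:] * q" by (metis poly_eq_0_iff_dvd dvdE)
  have q0: "q \<noteq> 0" using q Suc.prems(2) by auto
  have "degree ([:- r, 1:] * q) = degree [:- r, 1:] + degree q" using q0 by (intro degree_mult_eq) auto
  then have dq: "degree q = n" using Suc.prems(1) q by simp
  define u where "u = N v - cscale r v"
  have v: "v \<in> V" by fact
  have u: "u \<in> V" using v N_mem by (simp add: u_def mems)
  have "poly_op N q u = 0" using Suc.prems(4) poly_op_root_factor[OF v] by (simp add: q u_def)
  then obtain \<Lambda> w where fin: "finite \<Lambda>" and w: "\<And>\<mu>. \<mu> \<in> \<Lambda> \<Longrightarrow> w \<mu> \<in> V"
      "\<And>\<mu>. \<mu> \<in> \<Lambda> \<Longrightarrow> N (w \<mu>) = cscale \<mu> (w \<mu>)" and uw: "u = (\<Sum>\<mu>\<in>\<Lambda>. w \<mu>)"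
    using Suc.IH[OF dq q0 u] by blast
  define L where "L = \<Lambda> - {r}"
  define w' where "w' \<mu> = cscale (1 / (\<mu> - r)) (w \<mu>)" for \<mu>
  define v' where "v' = v - (\<Sum>\<mu>\<in>L. w' \<mu>)"
  (* the part of u in the eigenspace of r, which turns out to vanish *)
  define w0 where "w0 = (if r \<in> \<Lambda> then w r else 0)"
  have w': "w' \<mu> \<in> V" "N (w' \<mu>) = cscale \<mu> (w' \<mu>)" if "\<mu> \<in> L" for \<mu>
    using that w by (auto simp: L_def w'_def mems linear_map_on_scale[OF linN] fs.scale_scale mult.commute)
  have v': "v' \<in> V" using v w' by (auto simp: v'_def intro!: mems)
  have "N v' - cscale r v' = u - (\<Sum>\<mu>\<in>L. N (w' \<mu>) - cscale r (w' \<mu>))"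
  proof -
    have "N v' = N v - (\<Sum>\<mu>\<in>L. N (w' \<mu>))"
      unfolding v'_def using v w'
      by (simp add: linear_map_on_diff[OF linN sub] linear_map_on_sum[OF linN sub] mems)
    then show ?thesis
      by (simp add: v'_def u_def sum_subtractf fs.scale_right_diff_distrib fs.scale_sum_right)
  qed
  also have "(\<Sum>\<mu>\<in>L. N (w' \<mu>) - cscale r (w' \<mu>)) = (\<Sum>\<mu>\<in>L. w \<mu>)"
  proof (intro sum.cong refl)
    fix \<mu> assume m: "\<mu> \<in> L"
    have "N (w' \<mu>) - cscale r (w' \<mu>) = cscale (\<mu> - r) (w' \<mu>)"
      using w'(2)[OF m] by (simp add: fs.scale_left_diff_distrib)
    also have "\<dots> = w \<mu>" using m by (simp add: w'_def fs.scale_scale L_def)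
    finally show "N (w' \<mu>) - cscale r (w' \<mu>) = w \<mu>" .
  qed
  also have "u - (\<Sum>\<mu>\<in>L. w \<mu>) = w0"
    using fin by (auto simp: uw L_def w0_def sum.remove)
  finally have Nv': "w0 = N v' - cscale r v'" by (simp add: fun_diff_def)
  have "N w0 = cscale r w0"
    using w by (auto simp: w0_def linear_map_on_zero[OF linN sub])
  then have "w0 = 0" using no_jordan_block[OF v' Nv'] by blast
  then have Nv'r: "N v' = cscale r v'" using Nv' by simp
  define W where "W \<mu> = (if \<mu> = r then v' else w' \<mu>)" for \<mu>
  have "(\<Sum>\<mu>\<in>insert r L. W \<mu>) = v' + (\<Sum>\<mu>\<in>L. W \<mu>)"
    using fin by (subst sum.insert) (auto simp: L_def W_def)
  also have "(\<Sum>\<mu>\<in>L. W \<mu>) = (\<Sum>\<mu>\<in>L. w' \<mu>)"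
    by (intro sum.cong) (auto simp: L_def W_def)
  finally have "v = (\<Sum>\<mu>\<in>insert r L. W \<mu>)" by (simp only: v'_def diff_add_cancel)
  moreover have "W \<mu> \<in> V \<and> N (W \<mu>) = cscale \<mu> (W \<mu>)" if "\<mu> \<in> insert r L" for \<mu>
    using that v' Nv'r w' by (auto simp: W_def)
  ultimately show ?case using fin by (intro exI[of _ "insert r L"] exI[of _ W]) (auto simp: L_def)
qed

lemma eigen_decomposition:
  assumes "v \<in> V"
  obtains \<Lambda> w where "finite \<Lambda>" "\<And>\<mu>. \<mu> \<in> \<Lambda> \<Longrightarrow> w \<mu> \<in> V"
    "\<And>\<mu>. \<mu> \<in> \<Lambda> \<Longrightarrow> N (w \<mu>) = cscale \<mu> (w \<mu>)" "v = (\<Sum>\<mu>\<in>\<Lambda>. w \<mu>)"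
proof -
  obtain p where "p \<noteq> 0" "poly_op N p v = 0" using annihilator_exists[OF assms] by blast
  then show ?thesis using eigen_decomposition_aux[OF refl _ assms] that by metis
qed

text \<open>
  An eigenvector whose eigenvalue does not occur in the decompositions of the basis vectors is
  orthogonal to the whole space. Finiteness makes the supremum and infimum in the condition number
  genuine bounds of the spectrum.
\<close>

lemma finite_spectrum: "finite (spectrum_on V N)"
proof -
  obtain B where B: "finite B" "fs.span B = V" using fin_dim_basis[OF fd] by metis
  have BV: "B \<subseteq> V" using B fs.span_superset by blast
  have "\<exists>\<Lambda> w. finite \<Lambda> \<and> (\<forall>\<mu>\<in>\<Lambda>. w \<mu> \<in> V \<and> N (w \<mu>) = cscale \<mu> (w \<mu>)) \<and> b = (\<Sum>\<mu>\<in>\<Lambda>. w \<mu>)" if "b \<in> B" for b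
    using eigen_decomposition[of b] BV that by (metis subsetD)
  then obtain \<Lambda> w where \<Lambda>: "\<And>b. b \<in> B \<Longrightarrow> finite (\<Lambda> b)"
      and w: "\<And>b \<mu>. b \<in> B \<Longrightarrow> \<mu> \<in> \<Lambda> b \<Longrightarrow> w b \<mu> \<in> V \<and> N (w b \<mu>) = cscale \<mu> (w b \<mu>)"
      and b: "\<And>b. b \<in> B \<Longrightarrow> b = (\<Sum>\<mu>\<in>\<Lambda> b. w b \<mu>)"
    by metis
  have "spectrum_on V N \<subseteq> (\<Union>b\<in>B. \<Lambda> b)"
  proof
    fix \<mu> assume "\<mu> \<in> spectrum_on V N"
    then obtain v where v: "v \<in> V" "v \<noteq> 0" "N v = cscale \<mu> v" by (auto simp: spectrum_on_def)
    show "\<mu> \<in> (\<Union>b\<in>B. \<Lambda> b)"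
    proof (rule ccontr)
      assume n: "\<mu> \<notin> (\<Union>b\<in>B. \<Lambda> b)"
      have ortB: "ip b v = 0" if bB: "b \<in> B" for b
      proof -
        have "ip b v = ip (\<Sum>\<mu>\<in>\<Lambda> b. w b \<mu>) v" using b[OF bB] by simp
        also have "\<dots> = (\<Sum>\<mu>\<in>\<Lambda> b. ip (w b \<mu>) v)" using w bB by (intro ip_sum_left) auto
        also have "\<dots> = 0"
        proof (intro sum.neutral ballI)
          fix \<nu> assume "\<nu> \<in> \<Lambda> b"
          moreover from this have "\<nu> \<noteq> \<mu>" using n bB by blast
          ultimately show "ip (w b \<nu>) v = 0"
            using w[OF bB] eigen_orthogonal[OF _ _ v(1,3)] by blast
        qed
        finally show ?thesis .
      qed
      have "u \<in> V \<and> ip u v = 0" if "u \<in> fs.span B" for u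
        using that
      proof (induction rule: fs.span_induct_alt)
        case base
        then show ?case using zero_mem ip_zero_left by blast
      next
        case (step c x y)
        then show ?case using ortB BV by (auto simp: ip_add_left ip_scale_left mems)
      qed
      then have "ip v v = 0" using v(1) B(2) by blast
      then show False using ip_pos[OF v(1,2)] by simp
    qed
  qed
  then show ?thesis using B(1) \<Lambda> by (meson finite_UN_I finite_subset)
qed

lemma spectrum_nonempty:
  assumes "v \<in> V" "v \<noteq> 0"
  shows "spectrum_on V N \<noteq> {}"
proof -
  obtain \<Lambda> w where fin: "finite \<Lambda>" and w: "\<And>\<mu>. \<mu> \<in> \<Lambda> \<Longrightarrow> w \<mu> \<in> V"
      "\<And>\<mu>. \<mu> \<in> \<Lambda> \<Longrightarrow> N (w \<mu>) = cscale \<mu> (w \<mu>)" and v: "v = (\<Sum>\<mu>\<in>\<Lambda>. w \<mu>)"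
    using eigen_decomposition[OF assms(1)] by metis
  obtain \<mu> where "\<mu> \<in> \<Lambda>" "w \<mu> \<noteq> 0" using v assms(2) by (metis sum.neutral)
  then show ?thesis using w by (auto simp: spectrum_on_def)
qed

text \<open>
  The eigencomponents are orthogonal and \<open>p(N)\<close> multiplies each of them by a value of \<open>p\<close> on the
  spectrum.
\<close>

lemma nrm_poly_op_le:
  assumes v: "v \<in> V" and \<delta>: "\<delta> \<ge> 0"
    and p: "\<And>\<mu>. \<mu> \<in> spectrum_on V N \<Longrightarrow> cmod (poly p \<mu>) \<le> \<delta>"
  shows "nrm (poly_op N p v) \<le> \<delta> * nrm v"
proof -
  obtain \<Lambda> w where fin: "finite \<Lambda>" and w: "\<And>\<mu>. \<mu> \<in> \<Lambda> \<Longrightarrow> w \<mu> \<in> V"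
      "\<And>\<mu>. \<mu> \<in> \<Lambda> \<Longrightarrow> N (w \<mu>) = cscale \<mu> (w \<mu>)" and vw: "v = (\<Sum>\<mu>\<in>\<Lambda>. w \<mu>)"
    using eigen_decomposition[OF v] by metis
  have ort: "ip (w \<mu>) (w \<nu>) = 0" if "\<mu> \<in> \<Lambda>" "\<nu> \<in> \<Lambda>" "\<mu> \<noteq> \<nu>" for \<mu> \<nu>
    using eigen_orthogonal w that by blast
  have "poly_op N p v = (\<Sum>\<mu>\<in>\<Lambda>. cscale (poly p \<mu>) (w \<mu>))"
    unfolding vw using w by (subst linear_map_on_sum[OF lin_poly_op sub]) (auto simp: poly_op_eigen intro!: sum.cong)
  then have "(nrm (poly_op N p v))\<^sup>2 = (\<Sum>\<mu>\<in>\<Lambda>. (nrm (cscale (poly p \<mu>) (w \<mu>)))\<^sup>2)"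
    using fin w ort by (simp only:) (rule nrm_sum_orthogonal; simp add: mems ip_scale_left ip_scale_right)
  also have "\<dots> \<le> (\<Sum>\<mu>\<in>\<Lambda>. \<delta>\<^sup>2 * (nrm (w \<mu>))\<^sup>2)"
  proof (rule sum_mono)
    fix \<mu> assume m: "\<mu> \<in> \<Lambda>"
    show "(nrm (cscale (poly p \<mu>) (w \<mu>)))\<^sup>2 \<le> \<delta>\<^sup>2 * (nrm (w \<mu>))\<^sup>2"
    proof (cases "w \<mu> = 0")
      case True
      then show ?thesis using zero_mem by (simp add: nrm_zero nrm_scale)
    next
      case False
      then have "cmod (poly p \<mu>) \<le> \<delta>" using w[OF m] p by (auto simp: spectrum_on_def)
      then have "(cmod (poly p \<mu>))\<^sup>2 \<le> \<delta>\<^sup>2" by (intro power_mono) auto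
      then show ?thesis using w(1)[OF m] by (simp add: nrm_scale power_mult_distrib mult_right_mono)
    qed
  qed
  also have "\<dots> = (\<delta> * nrm v)\<^sup>2"
    using nrm_sum_orthogonal[OF fin w(1) ort] by (simp add: vw power_mult_distrib sum_distrib_left)
  finally show ?thesis
    by (rule power2_le_imp_le) (intro mult_nonneg_nonneg nrm_nonneg v \<delta>)
qed

lemma spectrum_bounds:
  assumes \<mu>: "\<mu> \<in> spectrum_on V N"
  defines "X \<equiv> Re ` spectrum_on V N"
  shows "\<mu> = of_real (Re \<mu>)" "0 < Inf X" "Inf X \<le> Re \<mu>" "Re \<mu> \<le> Sup X"
proof -
  have fin: "finite X" and ne: "X \<noteq> {}" using finite_spectrum \<mu> by (auto simp: X_def)
  show "\<mu> = of_real (Re \<mu>)" using \<mu> eigenvalue_real_pos by (auto simp: spectrum_on_def)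
  show "Inf X \<le> Re \<mu>" "Re \<mu> \<le> Sup X"
    using fin \<mu> by (auto intro!: cInf_lower cSup_upper bdd_below_finite bdd_above_finite simp: X_def)
  have "Inf X \<in> X" using fin ne by (simp add: cInf_eq_Min)
  then show "0 < Inf X" using eigenvalue_real_pos by (auto simp: X_def spectrum_on_def)
qed

lemma cond_ge_1:
  assumes "v \<in> V" "v \<noteq> 0"
  shows "cond_on V N \<ge> 1"
proof -
  obtain \<mu> where "\<mu> \<in> spectrum_on V N" using spectrum_nonempty[OF assms] by blast
  from spectrum_bounds[OF this] show ?thesis by (simp add: cond_on_def)
qed

text \<open>
  The errors \<open>s - \<zeta>\<close> attainable in the Krylov space are the vectors \<open>p(N) (s - x0)\<close> with
  \<open>degree p \<le> k\<close> and \<open>p(0) = 1\<close>. The minimiser is at least as good as the residual polynomial.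
\<close>

theorem cg_error_bound:
  assumes s: "s \<in> V" and x0: "x0 \<in> V" and k: "k \<ge> 1" and nt: "u0 \<in> V" "u0 \<noteq> 0"
  defines "K \<equiv> krylov_affine k N x0 (N (s - x0))"
    and "\<epsilon> \<equiv> 2 * ((sqrt (cond_on V N) - 1) / (sqrt (cond_on V N) + 1)) ^ k"
  defines "\<eta> \<equiv> THE \<eta>. \<eta> \<in> K \<and> (\<forall>\<zeta>\<in>K. nrm (s - \<eta>) \<le> nrm (s - \<zeta>))"
  shows "\<eta> \<in> V" "nrm (s - \<eta>) \<le> \<epsilon> * nrm (s - x0)"
proof -
  define e where "e = s - x0"
  have e: "e \<in> V" using s x0 by (simp add: e_def mems)
  define f where "f i = (N ^^ i) (N e)" for i
  have f: "f i \<in> V" for i unfolding f_def by (intro power_mem N_mem e)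
  have K: "K = {x0 + (\<Sum>i<k. cscale (c i) (f i)) | c. True}"
    by (simp add: K_def krylov_affine_def f_def e_def)
  have "\<exists>!\<eta>. \<eta> \<in> K \<and> (\<forall>\<zeta>\<in>K. nrm (s - \<eta>) \<le> nrm (s - \<zeta>))"
    unfolding K by (rule affine_minimiser[OF x0 f s])
  then have \<eta>: "\<eta> \<in> K" "\<And>\<zeta>. \<zeta> \<in> K \<Longrightarrow> nrm (s - \<eta>) \<le> nrm (s - \<zeta>)"
    unfolding \<eta>_def by (auto dest!: theI')
  have KV: "K \<subseteq> V" using x0 f by (auto simp: K intro!: mems)
  then show "\<eta> \<in> V" using \<eta>(1) by blast
  define a where "a = Inf (Re ` spectrum_on V N)"
  define b where "b = Sup (Re ` spectrum_on V N)"
  have c: "cond_on V N = b / a" by (simp add: cond_on_def a_def b_def)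
  obtain \<mu>0 where "\<mu>0 \<in> spectrum_on V N" using spectrum_nonempty[OF nt] by blast
  from spectrum_bounds[OF this] have ab: "0 < a" "a \<le> b" by (auto simp: a_def b_def)
  obtain p where p: "degree p \<le> k" "poly p 0 = 1"
      "\<And>x. x \<in> {a..b} \<Longrightarrow> cmod (poly p (of_real x)) \<le> \<epsilon>"
    using residual_polynomial[OF ab k] unfolding \<epsilon>_def c by blast
  have \<epsilon>: "\<epsilon> \<ge> 0" using p(3)[of a] ab by (meson norm_ge_zero order_trans atLeastAtMost_iff order_refl)
  define \<zeta> where "\<zeta> = x0 + (\<Sum>i<k. cscale (- coeff p (Suc i)) (f i))"
  have \<zeta>K: "\<zeta> \<in> K" unfolding K \<zeta>_def mem_Collect_eq
    by (intro exI[of _ "\<lambda>i. - coeff p (Suc i)"] conjI refl TrueI)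
  obtain k' where k': "k = Suc k'" using k by (cases k) auto
  have "poly_op N p e = (\<Sum>i\<le>Suc k'. cscale (coeff p i) ((N ^^ i) e))"
    using poly_op_bound[OF p(1)] k' by simp
  also have "\<dots> = cscale (coeff p 0) e + (\<Sum>i\<le>k'. cscale (coeff p (Suc i)) (f i))"
    by (subst sum.atMost_Suc_shift) (simp add: f_def funpow_swap1)
  also have "\<dots> = s - \<zeta>"
    using p(2) by (simp add: \<zeta>_def e_def poly_0_coeff_0 k' lessThan_Suc_atMost sum_negf)
  finally have "s - \<zeta> = poly_op N p e" by simp
  moreover have "nrm (poly_op N p e) \<le> \<epsilon> * nrm e"
  proof (rule nrm_poly_op_le[OF e \<epsilon>])
    fix \<mu> assume "\<mu> \<in> spectrum_on V N"
    from spectrum_bounds[OF this] show "cmod (poly p \<mu>) \<le> \<epsilon>"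
      using p(3)[of "Re \<mu>"] by (auto simp: a_def b_def)
  qed
  ultimately show "nrm (s - \<eta>) \<le> \<epsilon> * nrm (s - x0)"
    using \<eta>(2)[OF \<zeta>K] by (simp add: e_def)
qed

end

section \<open>Polynomials and their derivatives\<close>

text \<open>
  Continuity of all directional derivatives is what makes the gradient products integrable.
\<close>

definition C1 :: "('a::real_normed_vector \<Rightarrow> complex) \<Rightarrow> bool" where
  "C1 f \<longleftrightarrow> (\<exists>f'. (\<forall>x. (f has_derivative f' x) (at x)) \<and> (\<forall>h. continuous_on UNIV (\<lambda>x. f' x h)))"

lemma C1_continuous: "C1 f \<Longrightarrow> continuous_on S f"
  unfolding C1_def by (meson has_derivative_continuous continuous_at_imp_continuous_on)

lemma C1_const: "C1 (\<lambda>x. c)"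
  unfolding C1_def by (intro exI[of _ "\<lambda>x h. 0"]) auto

lemma C1_coordinate: "C1 (\<lambda>x :: 'a::euclidean_space. complex_of_real (x \<bullet> b))"
  unfolding C1_def
  by (intro exI[of _ "\<lambda>x h. complex_of_real (h \<bullet> b)"]) (auto intro!: derivative_eq_intros)

lemma C1_add:
  assumes "C1 f" "C1 g"
  shows "C1 (\<lambda>x. f x + g x)"
proof -
  obtain f' g' where f: "\<And>x. (f has_derivative f' x) (at x)" "\<And>h. continuous_on UNIV (\<lambda>x. f' x h)"
    and g: "\<And>x. (g has_derivative g' x) (at x)" "\<And>h. continuous_on UNIV (\<lambda>x. g' x h)"
    using assms unfolding C1_def by blast
  show ?thesis
    unfolding C1_def
    by (intro exI[of _ "\<lambda>x h. f' x h + g' x h"] conjI allI has_derivative_add continuous_on_add f g)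
qed

lemma C1_mult:
  assumes "C1 f" "C1 g"
  shows "C1 (\<lambda>x. f x * g x)"
proof -
  obtain f' g' where f: "\<And>x. (f has_derivative f' x) (at x)" "\<And>h. continuous_on UNIV (\<lambda>x. f' x h)"
    and g: "\<And>x. (g has_derivative g' x) (at x)" "\<And>h. continuous_on UNIV (\<lambda>x. g' x h)"
    using assms unfolding C1_def by blast
  show ?thesis
    unfolding C1_def
    by (intro exI[of _ "\<lambda>x h. f x * g' x h + f' x h * g x"] conjI allI has_derivative_mult
        continuous_on_add continuous_on_mult f g C1_continuous assms)
qed

lemma C1_sum: "(\<And>i. i \<in> I \<Longrightarrow> C1 (f i)) \<Longrightarrow> C1 (\<lambda>x. \<Sum>i\<in>I. f i x)"
  by (induction I rule: infinite_finite_induct) (auto intro: C1_const C1_add)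

lemma C1_prod: "(\<And>i. i \<in> I \<Longrightarrow> C1 (f i)) \<Longrightarrow> C1 (\<lambda>x. \<Prod>i\<in>I. f i x)"
  by (induction I rule: infinite_finite_induct) (auto intro: C1_const C1_mult)

lemma C1_power: "C1 f \<Longrightarrow> C1 (\<lambda>x. f x ^ n)"
  by (induction n) (auto intro: C1_const C1_mult)

definition multi_indices :: "nat \<Rightarrow> ('a::euclidean_space \<Rightarrow> nat) set" where
  "multi_indices m = {\<alpha>. (\<forall>b. b \<notin> Basis \<longrightarrow> \<alpha> b = 0) \<and> (\<Sum>b\<in>Basis. \<alpha> b) \<le> m}"

definition monomial_fun :: "('a::euclidean_space \<Rightarrow> nat) \<Rightarrow> 'a \<Rightarrow> complex" where
  "monomial_fun \<alpha> x = of_real (\<Prod>b\<in>Basis. (x \<bullet> b) ^ \<alpha> b)"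

definition poly_fun :: "nat \<Rightarrow> (('a::euclidean_space \<Rightarrow> nat) \<Rightarrow> complex) \<Rightarrow> 'a \<Rightarrow> complex" where
  "poly_fun m c x = (\<Sum>\<alpha>\<in>multi_indices m. c \<alpha> * monomial_fun \<alpha> x)"

lemma poly_on_iff: "poly_on m K u \<longleftrightarrow> (\<exists>c. \<forall>x\<in>K. u x = poly_fun m c x)"
  by (simp add: poly_on_def poly_fun_def multi_indices_def monomial_fun_def)

lemma finite_multi_indices: "finite (multi_indices m :: ('a::euclidean_space \<Rightarrow> nat) set)"
proof (rule finite_subset)
  let ?A = "{\<alpha> :: 'a \<Rightarrow> nat. \<forall>b. (b \<in> Basis \<longrightarrow> \<alpha> b \<in> {..m}) \<and> (b \<notin> Basis \<longrightarrow> \<alpha> b = 0)}"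
  show "multi_indices m \<subseteq> ?A"
  proof
    fix \<alpha> :: "'a \<Rightarrow> nat" assume \<alpha>: "\<alpha> \<in> multi_indices m"
    have "\<alpha> b \<le> m" if "b \<in> Basis" for b
    proof -
      have "\<alpha> b \<le> (\<Sum>b\<in>Basis. \<alpha> b)" using that by (intro member_le_sum) auto
      then show ?thesis using \<alpha> by (simp add: multi_indices_def)
    qed
    then show "\<alpha> \<in> ?A" using \<alpha> by (simp add: multi_indices_def)
  qed
qed (rule finite_set_of_finite_funs; simp)

lemma C1_poly_fun: "C1 (poly_fun m c)"
proof -
  have "C1 (\<lambda>x. \<Sum>\<alpha>\<in>multi_indices m. c \<alpha> * (\<Prod>b\<in>Basis. complex_of_real (x \<bullet> b) ^ \<alpha> b))"
    by (intro C1_sum C1_mult C1_const C1_prod C1_power C1_coordinate)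
  then show ?thesis by (simp add: poly_fun_def[abs_def] monomial_fun_def)
qed

lemma poly_on_zero: "poly_on m K (\<lambda>x. 0)"
  unfolding poly_on_iff by (intro exI[of _ "\<lambda>\<alpha>. 0"]) (simp add: poly_fun_def)

lemma poly_on_add: "poly_on m K u \<Longrightarrow> poly_on m K v \<Longrightarrow> poly_on m K (\<lambda>x. u x + v x)"
  unfolding poly_on_iff
proof (elim exE)
  fix c d assume "\<forall>x\<in>K. u x = poly_fun m c x" "\<forall>x\<in>K. v x = poly_fun m d x"
  then show "\<exists>e. \<forall>x\<in>K. u x + v x = poly_fun m e x"
    by (intro exI[of _ "\<lambda>\<alpha>. c \<alpha> + d \<alpha>"]) (simp add: poly_fun_def sum.distrib algebra_simps)
qed

lemma poly_on_scale: "poly_on m K u \<Longrightarrow> poly_on m K (\<lambda>x. a * u x)"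
  unfolding poly_on_iff
proof (elim exE)
  fix c assume "\<forall>x\<in>K. u x = poly_fun m c x"
  then show "\<exists>e. \<forall>x\<in>K. a * u x = poly_fun m e x"
    by (intro exI[of _ "\<lambda>\<alpha>. a * c \<alpha>"]) (simp add: poly_fun_def sum_distrib_left algebra_simps)
qed

lemma poly_on_cnj: "poly_on m K u \<Longrightarrow> poly_on m K (\<lambda>x. cnj (u x))"
  unfolding poly_on_iff
proof (elim exE)
  fix c assume "\<forall>x\<in>K. u x = poly_fun m c x"
  then show "\<exists>e. \<forall>x\<in>K. cnj (u x) = poly_fun m e x"
    by (intro exI[of _ "\<lambda>\<alpha>. cnj (c \<alpha>)"]) (simp add: poly_fun_def monomial_fun_def)
qed

lemma poly_on_cong: "(\<And>x. x \<in> K \<Longrightarrow> u x = v x) \<Longrightarrow> poly_on m K u \<Longrightarrow> poly_on m K v"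
  unfolding poly_on_iff by metis

text \<open>
  No differentiability is assumed: functions that agree near \<open>x\<close> have the same derivatives, so the
  choice operator returns the same value for both. Hence integrands over a subdomain do not change
  when functions are restricted to its closure.
\<close>

lemma frechet_derivative_cong_open:
  assumes "open G" "x \<in> G" "\<And>y. y \<in> G \<Longrightarrow> f y = g y"
  shows "frechet_derivative f (at x) = frechet_derivative g (at x)"
proof -
  have "(f has_derivative f') (at x) \<longleftrightarrow> (g has_derivative f') (at x)" for f'
    using has_derivative_transform_within_open[OF _ assms(1,2)] assms(3) by metis
  then show ?thesis by (simp add: frechet_derivative_def)
qed

lemma grad_prod_cong_open:
  assumes "open G" "x \<in> G" "\<And>y. y \<in> G \<Longrightarrow> f y = f' y" "\<And>y. y \<in> G \<Longrightarrow> g y = g' y"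
  shows "grad_prod f g x = grad_prod f' g' x"
  using frechet_derivative_cong_open[OF assms(1,2), of f f'] frechet_derivative_cong_open[OF assms(1,2), of g g']
    assms(3,4) by (simp add: grad_prod_def)

lemma grad_prod_commute: "grad_prod f g x = grad_prod g f x"
  by (simp add: grad_prod_def mult.commute)

lemma grad_prod_add:
  assumes "f differentiable at x" "f' differentiable at x"
  shows "grad_prod (f + f') g x = grad_prod f g x + grad_prod f' g x"
proof -
  have "((\<lambda>x. f x + f' x) has_derivative (\<lambda>h. frechet_derivative f (at x) h + frechet_derivative f' (at x) h)) (at x)"
    using assms by (intro has_derivative_add) (auto simp: frechet_derivative_works)
  from frechet_derivative_at[OF this, symmetric] show ?thesis
    by (simp add: grad_prod_def plus_fun_def sum.distrib algebra_simps)
qed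

lemma grad_prod_scale:
  assumes "f differentiable at x"
  shows "grad_prod (cscale a f) g x = a * grad_prod f g x"
proof -
  have "((\<lambda>x. a * f x) has_derivative (\<lambda>h. a * frechet_derivative f (at x) h)) (at x)"
    using assms by (intro has_derivative_mult_right) (auto simp: frechet_derivative_works)
  from frechet_derivative_at[OF this, symmetric] show ?thesis
    by (simp add: grad_prod_def cscale_def sum_distrib_left algebra_simps)
qed

lemma grad_prod_cnj:
  assumes "f differentiable at x" "g differentiable at x"
  shows "grad_prod (cnj_fun f) (cnj_fun g) x = cnj (grad_prod f g x)"
proof -
  have *: "frechet_derivative (cnj_fun f) (at x) = (\<lambda>h. cnj (frechet_derivative f (at x) h))"
    if "f differentiable at x" for f :: "'a \<Rightarrow> complex"
  proof -
    have "((\<lambda>x. cnj (f x)) has_derivative (\<lambda>h. cnj (frechet_derivative f (at x) h))) (at x)"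
      using that by (intro bounded_linear.has_derivative[OF bounded_linear_cnj]) (auto simp: frechet_derivative_works)
    from frechet_derivative_at[OF this, symmetric] show ?thesis by (simp add: cnj_fun_def)
  qed
  show ?thesis by (simp add: grad_prod_def *[OF assms(1)] *[OF assms(2)])
qed

section \<open>Integration over facets\<close>

text \<open>
  The prism over the facet is compact, and the foot of the perpendicular depends continuously on the
  point, so the facet measure is the image of a finite measure under a measurable map.
\<close>

lemma facet_measure_finite:
  assumes F: "compact F" "convex F" "F \<noteq> {}"
  shows "finite_measure (facet_measure F)"
proof -
  define \<nu> where "\<nu> = facet_normal F"
  define P where "P = {x + t *\<^sub>R \<nu> |x t. x \<in> F \<and> t \<in> {0..1}}"
  have "P = {x + y |x y. x \<in> F \<and> y \<in> (\<lambda>t. t *\<^sub>R \<nu>) ` {0..1}}"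
    unfolding P_def by blast
  moreover have "compact ((\<lambda>t::real. t *\<^sub>R \<nu>) ` {0..1})"
    by (intro compact_continuous_image continuous_intros) auto
  ultimately have P: "compact P" using compact_sums[OF F(1)] by simp
  interpret M: finite_measure "restrict_space lborel P"
  proof (rule finite_measureI)
    have "emeasure (restrict_space lborel P) P = emeasure lborel P"
      using borel_compact[OF P] by (intro emeasure_restrict_space) auto
    then show "emeasure (restrict_space lborel P) (space (restrict_space lborel P)) \<noteq> \<infinity>"
      using emeasure_compact_finite[OF P] by (simp add: space_restrict_space)
  qed
  have cl: "closed F" using F(1) compact_imp_closed by blast
  have "closest_point F \<in> borel_measurable (restrict_space borel P)"
    using continuous_on_closest_point[OF F(2) cl F(3)] by (rule borel_measurable_continuous_on_restrict)
  moreover have "sets (restrict_space lborel P) = sets (restrict_space borel P)"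
    by (simp add: sets_restrict_space)
  ultimately have "closest_point F \<in> borel_measurable (restrict_space lborel P)"
    by (simp cong: measurable_cong_sets)
  then have "closest_point F \<in> measurable (restrict_space lborel P) (restrict_space borel F)"
    using closest_point_in_set[OF cl F(3)] by (intro measurable_restrict_space2) auto
  then show ?thesis
    unfolding facet_measure_def P_def[symmetric] \<nu>_def[symmetric]
    by (rule M.finite_measure_distr)
qed

lemma space_facet_measure: "space (facet_measure F) = F"
  by (simp add: facet_measure_def space_restrict_space)

lemma borel_measurable_facet:
  "continuous_on F h \<Longrightarrow> h \<in> borel_measurable (facet_measure F)"
  using borel_measurable_continuous_on_restrict[of F h] by (simp add: facet_measure_def)

lemma facet_integral_bounded:
  fixes h :: "'a::euclidean_space \<Rightarrow> complex"
  assumes F: "compact F" and h: "continuous_on F h"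
  obtains B where "B \<ge> 0" "\<And>x. x \<in> F \<Longrightarrow> cmod (h x) \<le> B"
proof -
  have "bounded (h ` F)" using compact_continuous_image[OF h F] compact_imp_bounded by blast
  then obtain B where "\<And>x. x \<in> F \<Longrightarrow> cmod (h x) \<le> B" by (auto simp: bounded_iff)
  then show ?thesis using that[of "max 0 B"] by (meson max.cobounded1 max.coboundedI2)
qed

lemma integrable_facet_continuous:
  fixes h :: "'a::euclidean_space \<Rightarrow> complex"
  assumes F: "compact F" "convex F" "F \<noteq> {}" and h: "continuous_on F h"
  shows "integrable (facet_measure F) h"
proof -
  interpret finite_measure "facet_measure F" using F by (rule facet_measure_finite)
  obtain B where "\<And>x. x \<in> F \<Longrightarrow> cmod (h x) \<le> B" using facet_integral_bounded[OF F(1) h] by metis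
  then show ?thesis
    by (intro integrable_const_bound[of _ B] borel_measurable_facet h AE_I2) (simp add: space_facet_measure)
qed

lemma integrable_facet_L2_times_continuous:
  fixes f h :: "'a::euclidean_space \<Rightarrow> complex"
  assumes F: "compact F" "convex F" "F \<noteq> {}" and h: "continuous_on F h"
    and f: "f \<in> borel_measurable (facet_measure F)" "integrable (facet_measure F) (\<lambda>x. (cmod (f x))\<^sup>2)"
  shows "integrable (facet_measure F) (\<lambda>x. f x * h x)"
proof -
  interpret finite_measure "facet_measure F" using F by (rule facet_measure_finite)
  obtain B where B: "B \<ge> 0" "\<And>x. x \<in> F \<Longrightarrow> cmod (h x) \<le> B" using facet_integral_bounded[OF F(1) h] by metis
  show ?thesis
  proof (rule Bochner_Integration.integrable_bound)
    show "integrable (facet_measure F) (\<lambda>x. (1 + (cmod (f x))\<^sup>2) * B)"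
      using f(2) by (intro integrable_mult_left Bochner_Integration.integrable_add) auto
    show "(\<lambda>x. f x * h x) \<in> borel_measurable (facet_measure F)"
      using f(1) borel_measurable_facet[OF h] by measurable
    show "AE x in facet_measure F. norm (f x * h x) \<le> norm ((1 + (cmod (f x))\<^sup>2) * B)"
    proof (rule AE_I2)
      fix x assume "x \<in> space (facet_measure F)"
      then have x: "x \<in> F" by (simp add: space_facet_measure)
      (* on a finite measure, square integrability implies integrability *)
      have "0 \<le> (cmod (f x) - 1)\<^sup>2" by simp
      then have "2 * cmod (f x) \<le> 1 + (cmod (f x))\<^sup>2" by (simp add: power2_eq_square algebra_simps)
      then have "cmod (f x) \<le> 1 + (cmod (f x))\<^sup>2" using norm_ge_zero[of "f x"] by linarith
      then have "cmod (f x) * cmod (h x) \<le> (1 + (cmod (f x))\<^sup>2) * B"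
        using B x by (intro mult_mono) auto
      then show "norm (f x * h x) \<le> norm ((1 + (cmod (f x))\<^sup>2) * B)"
        using B(1) by (simp add: norm_mult)
    qed
  qed
qed

section \<open>The finite element setting\<close>

locale helmholtz =
  fixes D :: "'a::euclidean_space helmholtz_ddm"
  assumes setting: "helmholtz_setting D"
begin

lemma open_Dom: "open (Dom D)" and bounded_Dom: "bounded (Dom D)" and Dom_nonempty: "Dom D \<noteq> {}"
  and Dom_regular: "Dom D = interior (closure (Dom D))"
  and finite_Mesh: "finite (Mesh D)" and Mesh_cover: "\<Union>(Mesh D) = closure (Dom D)"
  and kappa_pos: "Wavenum D > 0" and L2: "L2_boundary D (Bdata D)"
  and Dom_cover: "closure (Dom D) = (\<Union>j\<in>{1..Nsub D}. closure (Sub D j))"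
  and unique_solution: "\<exists>!u. u \<in> Vh D \<and> (\<forall>v\<in>Vh D. form_a D u v = form_l D v)"
  using setting by (auto simp: helmholtz_setting_def polyhedral_open_def triangulation_def)

lemma Mesh_simplex: "K \<in> Mesh D \<Longrightarrow> int DIM('a) simplex K"
  and Mesh_Int_face: "K \<in> Mesh D \<Longrightarrow> K' \<in> Mesh D \<Longrightarrow> K \<inter> K' face_of K"
  using setting by (auto simp: helmholtz_setting_def triangulation_def)

lemma compact_Mesh: "K \<in> Mesh D \<Longrightarrow> compact K"
  and convex_Mesh: "K \<in> Mesh D \<Longrightarrow> convex K"
  using Mesh_simplex compact_simplex convex_simplex by blast+

lemma interior_Mesh:
  assumes "K \<in> Mesh D"
  shows "rel_interior K = interior K" "interior K \<noteq> {}"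
proof -
  have "aff_dim K = int DIM('a)" using Mesh_simplex[OF assms] aff_dim_simplex by blast
  then show "rel_interior K = interior K" by (simp add: aff_dim_eq_full rel_interior_interior)
  moreover have "K \<noteq> {}" using \<open>aff_dim K = int DIM('a)\<close> by (auto simp: aff_dim_empty)
  ultimately show "interior K \<noteq> {}" using rel_interior_eq_empty[OF convex_Mesh[OF assms]] by simp
qed

lemma open_Sub: "j \<in> {1..Nsub D} \<Longrightarrow> open (Sub D j)"
  and bounded_Sub: "j \<in> {1..Nsub D} \<Longrightarrow> bounded (Sub D j)"
  and Sub_nonempty: "j \<in> {1..Nsub D} \<Longrightarrow> Sub D j \<noteq> {}"
  and Sub_regular: "j \<in> {1..Nsub D} \<Longrightarrow> interior (closure (Sub D j)) = Sub D j"
  and Sub_mesh: "j \<in> {1..Nsub D} \<Longrightarrow> \<exists>\<M>\<subseteq>Mesh D. closure (Sub D j) = \<Union>\<M>"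
  and Sub_disjoint: "i \<in> {1..Nsub D} \<Longrightarrow> j \<in> {1..Nsub D} \<Longrightarrow> i \<noteq> j \<Longrightarrow> Sub D i \<inter> Sub D j = {}"
  using setting by (auto simp: helmholtz_setting_def polyhedral_open_def)

lemma Sub_subset: "j \<in> {1..Nsub D} \<Longrightarrow> Sub D j \<subseteq> Dom D"
  using interior_mono[of "closure (Sub D j)" "closure (Dom D)"] Dom_cover Dom_regular Sub_regular by blast

lemma closure_Sub_subset: "j \<in> {1..Nsub D} \<Longrightarrow> closure (Sub D j) \<subseteq> closure (Dom D)"
  using Dom_cover by blast

lemma frontier_Sub_subset: "frontier (Sub D j) \<subseteq> closure (Sub D j)"
  by (simp add: frontier_def)

lemma closure_Sub_disjoint:
  assumes "i \<in> {1..Nsub D}" "j \<in> {1..Nsub D}" "i \<noteq> j"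
  shows "closure (Sub D i) \<inter> Sub D j = {}"
  using Sub_disjoint[OF assms] open_Sub[OF assms(2)] by (simp add: open_Int_closure_eq_empty Int_commute)

lemma closure_Sub_split: "j \<in> {1..Nsub D} \<Longrightarrow> closure (Sub D j) = Sub D j \<union> frontier (Sub D j)"
  using open_Sub[of j] closure_Un_frontier by blast

definition mesh_skeleton where "mesh_skeleton = (\<Union>K\<in>Mesh D. frontier K)"

lemma negligible_mesh_skeleton: "negligible mesh_skeleton"
  unfolding mesh_skeleton_def
  using finite_Mesh convex_Mesh negligible_convex_frontier by (intro negligible_Union) auto

lemma Mesh_interior_cases:
  assumes "K \<in> Mesh D" "x \<in> K" "x \<notin> mesh_skeleton"
  shows "x \<in> interior K"
  using assms compact_imp_closed[OF compact_Mesh[OF assms(1)]] by (auto simp: mesh_skeleton_def frontier_def)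

text \<open>
  If interiors meet, the common face contains an interior point of each simplex and is therefore the
  whole simplex.
\<close>

lemma Mesh_eqI:
  assumes "K \<in> Mesh D" "K' \<in> Mesh D" "interior K \<inter> interior K' \<noteq> {}"
  shows "K = K'"
proof -
  have *: "K \<subseteq> K'" if "K \<in> Mesh D" "K' \<in> Mesh D" "interior K \<inter> interior K' \<noteq> {}" for K K'
  proof -
    have "(K \<inter> K') \<inter> rel_interior K \<noteq> {}"
      using that interior_Mesh(1) interior_subset by blast
    then have "K \<inter> K' = K" using face_of_disjoint_rel_interior[OF Mesh_Int_face[OF that(1,2)]] by blast
    then show ?thesis by blast
  qed
  show ?thesis using *[OF assms] *[OF assms(2,1)] assms(3) by blast
qed

text \<open>
  A point inside \<open>K\<close> and off the mesh skeleton lies in the closure of some subdomain, hence in an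
  element of that closure, and this element can only be \<open>K\<close>.
\<close>

lemma Mesh_in_Sub:
  assumes K: "K \<in> Mesh D"
  obtains j where "j \<in> {1..Nsub D}" "K \<subseteq> closure (Sub D j)"
proof -
  have "\<not> interior K \<subseteq> mesh_skeleton"
    using open_not_negligible[OF open_interior interior_Mesh(2)[OF K]]
      negligible_subset[OF negligible_mesh_skeleton] by blast
  then obtain x where x: "x \<in> interior K" "x \<notin> mesh_skeleton" by blast
  have "x \<in> closure (Dom D)" using x K Mesh_cover interior_subset by blast
  then obtain j where j: "j \<in> {1..Nsub D}" "x \<in> closure (Sub D j)" using Dom_cover by blast
  obtain \<M> where M: "\<M> \<subseteq> Mesh D" "closure (Sub D j) = \<Union>\<M>" using Sub_mesh[OF j(1)] by blast
  then obtain K' where K': "K' \<in> \<M>" "x \<in> K'" using j(2) by blast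
  then have "x \<in> interior K'" using Mesh_interior_cases x M by blast
  then have "K = K'" using Mesh_eqI[OF K] x K' M by blast
  then show ?thesis using that[OF j(1)] M K' by blast
qed

lemma closure_Sub_minus_Sub: "j \<in> {1..Nsub D} \<Longrightarrow> closure (Sub D j) - Sub D j \<subseteq> mesh_skeleton"
proof
  fix x assume j: "j \<in> {1..Nsub D}" and x: "x \<in> closure (Sub D j) - Sub D j"
  obtain \<M> where M: "\<M> \<subseteq> Mesh D" "closure (Sub D j) = \<Union>\<M>" using Sub_mesh[OF j(1)] by blast
  then obtain K where K: "K \<in> \<M>" "x \<in> K" using x by blast
  show "x \<in> mesh_skeleton"
  proof (rule ccontr)
    assume "x \<notin> mesh_skeleton"
    then have "x \<in> interior K" using Mesh_interior_cases K M by blast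
    also have "interior K \<subseteq> interior (closure (Sub D j))" using K M by (intro interior_mono) auto
    finally show False using x Sub_regular[OF j] by blast
  qed
qed

lemma interior_Mesh_subset: "K \<in> Mesh D \<Longrightarrow> interior K \<subseteq> Dom D"
  using Mesh_cover interior_mono[of K "closure (Dom D)"] Dom_regular by blast

lemma Dom_minus_interiors: "Dom D - (\<Union>K\<in>Mesh D. interior K) \<subseteq> mesh_skeleton"
proof
  fix x assume x: "x \<in> Dom D - (\<Union>K\<in>Mesh D. interior K)"
  then have "x \<in> closure (Dom D)" using closure_subset by blast
  then obtain K where "K \<in> Mesh D" "x \<in> K" using Mesh_cover by blast
  then show "x \<in> mesh_skeleton" using x Mesh_interior_cases by blast
qed

subsection \<open>The discrete space\<close>

lemma Vh_D: "u \<in> Vh D \<Longrightarrow> continuous_on (closure (Dom D)) u"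
  "u \<in> Vh D \<Longrightarrow> K \<in> Mesh D \<Longrightarrow> poly_on (Deg D) K u"
  "u \<in> Vh D \<Longrightarrow> x \<notin> closure (Dom D) \<Longrightarrow> u x = 0"
  by (auto simp: Vh_def)

lemma subspace_Vh: "fs.subspace (Vh D)"
  unfolding fs.subspace_def Vh_def
  by (auto simp: plus_fun_def cscale_def zero_fun_def intro!: continuous_intros poly_on_zero poly_on_add poly_on_scale)

lemma cnj_Vh: "u \<in> Vh D \<Longrightarrow> cnj_fun u \<in> Vh D"
  unfolding Vh_def cnj_fun_def by (auto intro!: continuous_on_cnj poly_on_cnj)

text \<open>
  A discrete function is determined by its coefficients on the elements. To express it as one linear
  combination although closed elements overlap, each point is assigned to a single element.
\<close>

lemma fin_dim_Vh: "fin_dim (Vh D)"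
proof -
  define el where "el x = (SOME K. K \<in> Mesh D \<and> x \<in> K)" for x
  have el: "el x \<in> Mesh D" "x \<in> el x" if "x \<in> closure (Dom D)" for x
    using that Mesh_cover someI_ex[of "\<lambda>K. K \<in> Mesh D \<and> x \<in> K"] unfolding el_def by blast+
  define g where "g K \<alpha> x = (if x \<in> closure (Dom D) \<and> el x = K then monomial_fun \<alpha> x else 0)" for K :: "'a set" and \<alpha> x
  define C where "C = (\<lambda>(K, \<alpha>). g K \<alpha>) ` (Mesh D \<times> multi_indices (Deg D))"
  have "u \<in> fs.span C" if u: "u \<in> Vh D" for u
  proof -
    have "\<exists>c. \<forall>K\<in>Mesh D. \<forall>x\<in>K. u x = poly_fun (Deg D) (c K) x"
      using Vh_D(2)[OF u] unfolding poly_on_iff by metis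
    then obtain c where c: "\<And>K x. K \<in> Mesh D \<Longrightarrow> x \<in> K \<Longrightarrow> u x = poly_fun (Deg D) (c K) x" by blast
    have "u x = (\<Sum>K\<in>Mesh D. \<Sum>\<alpha>\<in>multi_indices (Deg D). cscale (c K \<alpha>) (g K \<alpha>)) x" for x
    proof (cases "x \<in> closure (Dom D)")
      case True
      have "(\<Sum>K\<in>Mesh D. \<Sum>\<alpha>\<in>multi_indices (Deg D). c K \<alpha> * g K \<alpha> x)
          = (\<Sum>K\<in>Mesh D. if K = el x then poly_fun (Deg D) (c K) x else 0)"
        by (intro sum.cong refl) (auto simp: g_def True poly_fun_def)
      also have "\<dots> = u x" using finite_Mesh el[OF True] c by simp
      finally show ?thesis by (simp add: sum_fun_apply fun_apply)
    next
      case False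
      then show ?thesis using Vh_D(3)[OF u] by (simp add: sum_fun_apply fun_apply g_def)
    qed
    then have eq: "u = (\<Sum>K\<in>Mesh D. \<Sum>\<alpha>\<in>multi_indices (Deg D). cscale (c K \<alpha>) (g K \<alpha>))" by (rule ext)
    have "(\<Sum>K\<in>Mesh D. \<Sum>\<alpha>\<in>multi_indices (Deg D). cscale (c K \<alpha>) (g K \<alpha>)) \<in> fs.span C"
      by (intro fs.span_sum fs.span_scale fs.span_base) (auto simp: C_def)
    then show ?thesis by (simp only: eq[symmetric])
  qed
  moreover have "finite C" using finite_Mesh finite_multi_indices by (auto simp: C_def)
  ultimately show ?thesis unfolding fin_dim_def using subspace_Vh by blast
qed

lemma one_Vh: "restr (closure (Dom D)) (\<lambda>x. 1) \<in> Vh D"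
proof -
  have one: "poly_on (Deg D) K (\<lambda>x. 1 :: complex)" for K :: "'a set"
  proof -
    define z :: "'a \<Rightarrow> nat" where "z = (\<lambda>b. 0)"
    have z: "z \<in> multi_indices (Deg D)" by (simp add: multi_indices_def z_def)
    have "poly_fun (Deg D) (\<lambda>\<alpha>. if \<alpha> = z then 1 else 0) x = 1" for x :: 'a
    proof -
      have "poly_fun (Deg D) (\<lambda>\<alpha>. if \<alpha> = z then 1 else 0) x
          = (\<Sum>\<alpha>\<in>multi_indices (Deg D). if \<alpha> = z then monomial_fun z x else 0)"
        unfolding poly_fun_def by (intro sum.cong) auto
      also have "\<dots> = monomial_fun z x" using z by (simp add: finite_multi_indices)
      also have "\<dots> = 1" by (simp add: monomial_fun_def z_def)
      finally show ?thesis .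
    qed
    then show ?thesis unfolding poly_on_iff by metis
  qed
  have "poly_on (Deg D) K (restr (closure (Dom D)) (\<lambda>x. 1))" if "K \<in> Mesh D" for K
  proof (rule poly_on_cong[OF _ one])
    fix x assume "x \<in> K"
    then have "x \<in> closure (Dom D)" using that Mesh_cover by blast
    then show "1 = restr (closure (Dom D)) (\<lambda>x. 1) x" by (simp add: restr_def)
  qed
  moreover have "continuous_on (closure (Dom D)) (restr (closure (Dom D)) (\<lambda>x. 1 :: complex))"
    by (rule continuous_on_eq[of _ "\<lambda>x. 1"]) (auto simp: restr_def)
  ultimately show ?thesis by (auto simp: Vh_def restr_def)
qed

lemma Vh_differentiable:
  assumes u: "u \<in> Vh D" and x: "x \<in> Dom D" "x \<notin> mesh_skeleton"
  shows "u differentiable at x"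
proof -
  obtain K where K: "K \<in> Mesh D" "x \<in> interior K" using x Dom_minus_interiors by blast
  obtain c where c: "\<And>y. y \<in> K \<Longrightarrow> u y = poly_fun (Deg D) c y"
    using Vh_D(2)[OF u K(1)] unfolding poly_on_iff by blast
  obtain f' where "(poly_fun (Deg D) c has_derivative f') (at x)"
    using C1_poly_fun unfolding C1_def by blast
  then have "(u has_derivative f') (at x)"
    by (rule has_derivative_transform_within_open[OF _ open_interior K(2)]) (metis c interior_subset subsetD)
  then show ?thesis by (auto simp: differentiable_def)
qed

subsection \<open>Volume integrals\<close>

definition vol_density where
  "vol_density u v x = grad_prod u v x - of_real ((Wavenum D)\<^sup>2) * u x * v x"

definition vol where
  "vol G u v = (LINT x:G|lebesgue. vol_density u v x)"

text \<open>
  Inside an element the integrand is continuous up to the boundary, and the mesh skeleton, where the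
  derivatives are arbitrary, is a null set.
\<close>

lemma vol_density_integrable:
  assumes u: "u \<in> Vh D" and v: "v \<in> Vh D"
  shows "vol_density u v absolutely_integrable_on Dom D"
proof -
  have "vol_density u v absolutely_integrable_on interior K" if K: "K \<in> Mesh D" for K
  proof -
    obtain c where c: "\<And>y. y \<in> K \<Longrightarrow> u y = poly_fun (Deg D) c y"
      using Vh_D(2)[OF u K] unfolding poly_on_iff by blast
    obtain d where d: "\<And>y. y \<in> K \<Longrightarrow> v y = poly_fun (Deg D) d y"
      using Vh_D(2)[OF v K] unfolding poly_on_iff by blast
    define p q where "p = poly_fun (Deg D) c" and "q = poly_fun (Deg D) d"
    obtain p' where p: "\<And>x. (p has_derivative p' x) (at x)" "\<And>h. continuous_on UNIV (\<lambda>x. p' x h)"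
      using C1_poly_fun[of "Deg D" c] unfolding C1_def p_def by blast
    obtain q' where q: "\<And>x. (q has_derivative q' x) (at x)" "\<And>h. continuous_on UNIV (\<lambda>x. q' x h)"
      using C1_poly_fun[of "Deg D" d] unfolding C1_def q_def by blast
    define h where "h x = (\<Sum>b\<in>Basis. p' x b * q' x b) - of_real ((Wavenum D)\<^sup>2) * p x * q x" for x
    have eq: "vol_density u v x = h x" if x: "x \<in> interior K" for x
    proof -
      have "grad_prod u v x = grad_prod p q x"
        using c d interior_subset by (intro grad_prod_cong_open[OF open_interior x]) (auto simp: p_def q_def)
      also have "\<dots> = (\<Sum>b\<in>Basis. p' x b * q' x b)"
        using frechet_derivative_at[OF p(1)[of x]] frechet_derivative_at[OF q(1)[of x]]
        by (simp add: grad_prod_def)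
      finally show ?thesis using c d x interior_subset[of K] by (auto simp: vol_density_def h_def p_def q_def)
    qed
    have h: "continuous_on UNIV h"
      unfolding h_def[abs_def] p_def q_def
      by (intro continuous_intros p(2) q(2) C1_continuous C1_poly_fun)
    obtain a b where ab: "K \<subseteq> cbox a b"
      using bounded_subset_cbox_symmetric[OF compact_imp_bounded[OF compact_Mesh[OF K]]] by metis
    have "h absolutely_integrable_on cbox a b"
      by (intro absolutely_integrable_continuous continuous_on_subset[OF h]) auto
    then have "h absolutely_integrable_on interior K"
      by (rule set_integrable_subset) (use ab interior_subset in auto)
    then show ?thesis using eq by (simp cong: set_integrable_cong)
  qed
  then have "vol_density u v absolutely_integrable_on (\<Union>K\<in>Mesh D. interior K)"
    by (intro set_integrable_UN finite_Mesh) auto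
  moreover have "negligible {x \<in> (\<Union>K\<in>Mesh D. interior K) - Dom D. vol_density u v x \<noteq> 0}"
    by (rule negligible_subset[of "{}"]) (use interior_Mesh_subset in auto)
  moreover have "negligible {x \<in> Dom D - (\<Union>K\<in>Mesh D. interior K). vol_density u v x \<noteq> 0}"
    by (rule negligible_subset[OF negligible_mesh_skeleton]) (use Dom_minus_interiors in auto)
  ultimately show ?thesis using absolutely_integrable_spike_set_eq by blast
qed

context
  fixes G assumes G: "open G" "G \<subseteq> Dom D"
begin

lemma vol_density_integrable_sub:
  "u \<in> Vh D \<Longrightarrow> v \<in> Vh D \<Longrightarrow> vol_density u v absolutely_integrable_on G"
  using set_integrable_subset[OF vol_density_integrable _ G(2)] G(1) by auto

lemma vol_integral:
  "u \<in> Vh D \<Longrightarrow> v \<in> Vh D \<Longrightarrow> vol G u v = integral G (vol_density u v)"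
  "u \<in> Vh D \<Longrightarrow> v \<in> Vh D \<Longrightarrow> vol_density u v integrable_on G"
  unfolding vol_def using set_lebesgue_integral_eq_integral[OF vol_density_integrable_sub] by auto

lemma vol_add:
  assumes "u \<in> Vh D" "w \<in> Vh D" "v \<in> Vh D"
  shows "vol G (u + w) v = vol G u v + vol G w v"
proof -
  have "vol G (u + w) v = integral G (vol_density (u + w) v)"
    using assms fs.subspace_add[OF subspace_Vh] by (intro vol_integral) auto
  also have "\<dots> = integral G (\<lambda>x. vol_density u v x + vol_density w v x)"
  proof (rule integral_spike[OF negligible_mesh_skeleton])
    fix x assume "x \<in> G - mesh_skeleton"
    then have "u differentiable at x" "w differentiable at x" using Vh_differentiable assms G by auto
    then show "vol_density u v x + vol_density w v x = vol_density (u + w) v x"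
      by (simp add: vol_density_def grad_prod_add fun_apply algebra_simps)
  qed
  also have "\<dots> = vol G u v + vol G w v"
    using assms by (simp add: Henstock_Kurzweil_Integration.integral_add vol_integral)
  finally show ?thesis .
qed

lemma vol_scale:
  assumes "u \<in> Vh D" "v \<in> Vh D"
  shows "vol G (cscale a u) v = a * vol G u v"
proof -
  have "vol G (cscale a u) v = integral G (vol_density (cscale a u) v)"
    using assms fs.subspace_scale[OF subspace_Vh] by (intro vol_integral) auto
  also have "\<dots> = integral G (\<lambda>x. a * vol_density u v x)"
  proof (rule integral_spike[OF negligible_mesh_skeleton])
    fix x assume "x \<in> G - mesh_skeleton"
    then have "u differentiable at x" using Vh_differentiable assms G by auto
    then show "a * vol_density u v x = vol_density (cscale a u) v x"
      by (simp add: vol_density_def grad_prod_scale fun_apply algebra_simps)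
  qed
  also have "\<dots> = a * vol G u v"
    using assms by (simp add: vol_integral)
  finally show ?thesis .
qed

lemma vol_cnj_real:
  assumes "u \<in> Vh D"
  shows "Im (vol G u (cnj_fun u)) = 0"
proof -
  let ?f = "vol_density u (cnj_fun u)"
  have cu: "cnj_fun u \<in> Vh D" using assms cnj_Vh by blast
  have "integral G ?f = integral G (\<lambda>x. cnj (?f x))"
  proof (rule integral_spike[OF negligible_mesh_skeleton])
    fix x assume "x \<in> G - mesh_skeleton"
    then have "u differentiable at x" "cnj_fun u differentiable at x" using Vh_differentiable assms cu G by auto
    then have "cnj (grad_prod u (cnj_fun u) x) = grad_prod u (cnj_fun u) x"
      by (simp add: grad_prod_cnj[symmetric] grad_prod_commute)
    then show "cnj (?f x) = ?f x"
      by (simp add: vol_density_def cnj_fun_def algebra_simps)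
  qed
  also have "\<dots> = cnj (integral G ?f)" by (rule integral_cnj[symmetric])
  finally show ?thesis using assms cu by (simp add: vol_integral complex_eq_iff)
qed

lemma vol_cong:
  assumes "\<And>x. x \<in> G \<Longrightarrow> u x = u' x" "\<And>x. x \<in> G \<Longrightarrow> v x = v' x"
  shows "vol G u v = vol G u' v'"
  unfolding vol_def
  using assms grad_prod_cong_open[OF G(1) _ assms] G(1)
  by (intro set_lebesgue_integral_cong) (auto simp: vol_density_def)

end

lemma vol_commute: "vol G u v = vol G v u"
  by (simp add: vol_def vol_density_def[abs_def] grad_prod_commute[of u] ac_simps)

lemma vol_split:
  assumes "u \<in> Vh D" "v \<in> Vh D"
  shows "vol (Dom D) u v = (\<Sum>j\<in>{1..Nsub D}. vol (Sub D j) u v)"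
proof -
  let ?f = "vol_density u v"
  let ?U = "\<Union>j\<in>{1..Nsub D}. Sub D j"
  have "(?f has_integral vol (Sub D j) u v) (Sub D j)" if "j \<in> {1..Nsub D}" for j
    using vol_integral[OF open_Sub[OF that] Sub_subset[OF that] assms] by (simp add: has_integral_iff)
  then have "(?f has_integral (\<Sum>j\<in>{1..Nsub D}. vol (Sub D j) u v)) ?U"
    using Sub_disjoint by (intro has_integral_UN) (auto simp: pairwise_def)
  then have "integral ?U ?f = (\<Sum>j\<in>{1..Nsub D}. vol (Sub D j) u v)" by (rule integral_unique)
  moreover have "integral (Dom D) ?f = integral ?U ?f"
  proof (rule integral_spike_set)
    show "negligible {x \<in> Dom D - ?U. ?f x \<noteq> 0}"
    proof (rule negligible_subset[OF negligible_mesh_skeleton], rule subsetI)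
      fix x assume x: "x \<in> {x \<in> Dom D - ?U. ?f x \<noteq> 0}"
      then have "x \<in> closure (Dom D)" using closure_subset by blast
      then obtain j where j: "j \<in> {1..Nsub D}" "x \<in> closure (Sub D j)" using Dom_cover by blast
      then have "x \<in> closure (Sub D j) - Sub D j" using x by blast
      then show "x \<in> mesh_skeleton" using closure_Sub_minus_Sub[OF j(1)] by blast
    qed
    show "negligible {x \<in> ?U - Dom D. ?f x \<noteq> 0}"
    proof -
      have "{x \<in> ?U - Dom D. ?f x \<noteq> 0} = {}" using Sub_subset by blast
      then show ?thesis by (simp only: negligible_empty)
    qed
  qed
  ultimately show ?thesis using vol_integral[OF open_Dom subset_refl assms] by simp
qed

subsection \<open>Boundary integrals\<close>

lemma boundary_facet:
  assumes "F \<in> boundary_facets D G"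
  shows "compact F" "convex F" "F \<noteq> {}" "F \<subseteq> G" "F \<subseteq> closure (Dom D)"
proof -
  obtain K where K: "K \<in> Mesh D" "F facet_of K" "F \<subseteq> G" using assms by (auto simp: boundary_facets_def)
  then have f: "F face_of K" "F \<noteq> {}" by (auto simp: facet_of_def)
  show "compact F" "convex F" "F \<noteq> {}" "F \<subseteq> G"
    using f K face_of_imp_compact[OF convex_Mesh[OF K(1)] compact_Mesh[OF K(1)]] face_of_imp_convex by auto
  show "F \<subseteq> closure (Dom D)" using face_of_imp_subset[OF f(1)] K(1) Mesh_cover by blast
qed

lemma surf_add:
  assumes "\<And>F. F \<in> boundary_facets D G \<Longrightarrow> integrable (facet_measure F) g"
    "\<And>F. F \<in> boundary_facets D G \<Longrightarrow> integrable (facet_measure F) h"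
  shows "surf_int D G (\<lambda>x. g x + h x) = surf_int D G g + surf_int D G h"
  using assms by (simp add: surf_int_def sum.distrib)

lemma surf_scale: "surf_int D G (\<lambda>x. a * g x) = a * surf_int D G g"
  by (simp add: surf_int_def sum_distrib_left)

lemma surf_zero:
  assumes "\<And>x. x \<in> G \<Longrightarrow> g x = 0"
  shows "surf_int D G g = 0"
proof -
  have "integral\<^sup>L (facet_measure F) g = 0" if "F \<in> boundary_facets D G" for F
  proof -
    have "integral\<^sup>L (facet_measure F) g = integral\<^sup>L (facet_measure F) (\<lambda>x. 0)"
      using assms boundary_facet(4)[OF that]
      by (intro Bochner_Integration.integral_cong) (auto simp: space_facet_measure)
    then show ?thesis by simp
  qed
  then show ?thesis by (simp add: surf_int_def)
qed

text \<open>
  With the factor \<open>-\<i> \<kappa>\<close>, this is the energy that leaves through the outer boundary.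
\<close>

lemma surf_modulus:
  "\<exists>r\<ge>0. surf_int D G (\<lambda>x. u x * cnj (u x)) = of_real r"
proof -
  have "surf_int D G (\<lambda>x. u x * cnj (u x)) = of_real (\<Sum>F\<in>boundary_facets D G. integral\<^sup>L (facet_measure F) (\<lambda>x. (cmod (u x))\<^sup>2))"
    by (simp only: surf_int_def complex_norm_square[symmetric] integral_complex_of_real of_real_sum)
  moreover have "0 \<le> (\<Sum>F\<in>boundary_facets D G. integral\<^sup>L (facet_measure F) (\<lambda>x. (cmod (u x))\<^sup>2))"
    by (intro sum_nonneg integral_nonneg_AE) auto
  ultimately show ?thesis by blast
qed

end

section \<open>Local and trace spaces\<close>

text \<open>
  All local and trace spaces are built from images of the discrete space under restriction, so
  finite dimension and stability under conjugation carry over.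
\<close>

lemma linear_restr: "linear_map_on V (restr S ` V) (restr S)"
  unfolding linear_map_on_def by (auto simp: restr_def fun_eq_iff fun_apply)

lemma cnj_fun_restr: "cnj_fun (restr S u) = restr S (cnj_fun u)"
  by (auto simp: cnj_fun_def restr_def)

lemma restr_add: "restr S (u + v) = restr S u + restr S v"
  and restr_scale: "restr S (cscale c u) = cscale c (restr S u)"
  by (auto simp: restr_def fun_eq_iff fun_apply)

lemma restr_dual:
  assumes "fs.subspace V" "\<And>u v. u \<in> V \<Longrightarrow> v \<in> V \<Longrightarrow> \<psi> (u + v) = \<psi> u + \<psi> v"
    "\<And>c u. u \<in> V \<Longrightarrow> \<psi> (cscale c u) = c * \<psi> u"
  shows "restr V \<psi> \<in> dual V"
  using assms(2,3) fs.subspace_add[OF assms(1)] fs.subspace_scale[OF assms(1)]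
  unfolding dual_def restr_def by auto

definition component :: "nat \<Rightarrow> (nat \<times> 'a \<Rightarrow> complex) \<Rightarrow> 'a \<Rightarrow> complex" where
  "component j u = (\<lambda>x. u (j, x))"

lemma component_add: "component j (u + v) = component j u + component j v"
  and component_scale: "component j (cscale c u) = cscale c (component j u)"
  and component_cnj: "component j (cnj_fun u) = cnj_fun (component j u)"
  by (auto simp: component_def cnj_fun_def fun_eq_iff fun_apply)

lemma tuples_iff: "u \<in> tuples J V \<longleftrightarrow> (\<forall>j\<in>{1..J}. component j u \<in> V j) \<and> (\<forall>j x. j \<notin> {1..J} \<longrightarrow> u (j, x) = 0)"
  by (simp add: tuples_def component_def)

lemma tuples_cnj:
  assumes "\<And>j v. j \<in> {1..J} \<Longrightarrow> v \<in> V j \<Longrightarrow> cnj_fun v \<in> V j" "u \<in> tuples J V"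
  shows "cnj_fun u \<in> tuples J V"
  using assms by (auto simp: tuples_iff component_cnj) (auto simp: cnj_fun_def)

context helmholtz
begin

lemma fin_dim_restr: "fin_dim (restr S ` Vh D)"
  using fin_dim_image[OF linear_restr fin_dim_Vh] .

lemma cnj_restr: "u \<in> restr S ` Vh D \<Longrightarrow> cnj_fun u \<in> restr S ` Vh D"
  using cnj_Vh by (auto simp: cnj_fun_restr)

lemma fin_dim_VVh_Omega: "fin_dim (VVh_Omega D)"
  unfolding VVh_Omega_def by (intro fin_dim_tuples fin_dim_restr)

lemma fin_dim_VVh_Sigma: "fin_dim (VVh_Sigma D)"
  unfolding VVh_Sigma_def by (intro fin_dim_tuples fin_dim_restr)

lemma fin_dim_Vh_Sigma: "fin_dim (Vh_Sigma D)"
  unfolding Vh_Sigma_def by (rule fin_dim_restr)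

lemma cnj_VVh_Omega: "u \<in> VVh_Omega D \<Longrightarrow> cnj_fun u \<in> VVh_Omega D"
  unfolding VVh_Omega_def by (rule tuples_cnj) (rule cnj_restr)

lemma cnj_VVh_Sigma: "u \<in> VVh_Sigma D \<Longrightarrow> cnj_fun u \<in> VVh_Sigma D"
  unfolding VVh_Sigma_def by (rule tuples_cnj) (rule cnj_restr)

lemma cnj_Vh_Sigma: "u \<in> Vh_Sigma D \<Longrightarrow> cnj_fun u \<in> Vh_Sigma D"
  unfolding Vh_Sigma_def by (rule cnj_restr)

lemma Rop_cnj: "Rop D (cnj_fun v) = cnj_fun (Rop D v)"
  by (auto simp: Rop_def cnj_fun_def)

lemma component_Bop: "j \<in> {1..Nsub D} \<Longrightarrow> component j (Bop D u) = restr (frontier (Sub D j)) (component j u)"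
  and component_Rop: "j \<in> {1..Nsub D} \<Longrightarrow> component j (Rop D v) = restr (frontier (Sub D j)) v"
  by (auto simp: component_def Bop_def Rop_def restr_def)

lemma linear_Bop: "linear_map_on (VVh_Omega D) (VVh_Sigma D) (Bop D)"
  unfolding linear_map_on_def
proof (intro conjI ballI allI)
  fix u assume u: "u \<in> VVh_Omega D"
  show "Bop D u \<in> VVh_Sigma D"
    unfolding VVh_Sigma_def tuples_iff
  proof (intro conjI ballI allI impI)
    fix j assume j: "j \<in> {1..Nsub D}"
    obtain w where w: "w \<in> Vh D" "component j u = restr (closure (Sub D j)) w"
      using u j unfolding VVh_Omega_def tuples_iff by blast
    have "component j (Bop D u) = restr (frontier (Sub D j)) w"
      unfolding component_Bop[OF j] w(2) using frontier_Sub_subset[of j] by (auto simp: restr_def fun_eq_iff)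
    then show "component j (Bop D u) \<in> restr (frontier (Sub D j)) ` Vh D" using w by blast
  qed (auto simp: Bop_def)
qed (auto simp: Bop_def fun_eq_iff fun_apply)

lemma linear_Rop: "linear_map_on (Vh_Sigma D) (VVh_Sigma D) (Rop D)"
  unfolding linear_map_on_def
proof (intro conjI ballI allI)
  fix u assume u: "u \<in> Vh_Sigma D"
  then obtain w where w: "w \<in> Vh D" "u = restr (skeleton D) w" by (auto simp: Vh_Sigma_def)
  show "Rop D u \<in> VVh_Sigma D"
    unfolding VVh_Sigma_def tuples_iff
  proof (intro conjI ballI allI impI)
    fix j assume j: "j \<in> {1..Nsub D}"
    have "component j (Rop D u) = restr (frontier (Sub D j)) w"
      unfolding component_Rop[OF j] w(2) using j by (auto simp: restr_def skeleton_def fun_eq_iff)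
    then show "component j (Rop D u) \<in> restr (frontier (Sub D j)) ` Vh D" using w by blast
  qed (auto simp: Rop_def)
qed (auto simp: Rop_def fun_eq_iff fun_apply)

lemma Rop_eq_0:
  assumes v: "v \<in> Vh_Sigma D" and R: "Rop D v = 0"
  shows "v = 0"
proof
  fix x
  show "v x = 0 x"
  proof (cases "x \<in> skeleton D")
    case True
    then obtain j where "j \<in> {1..Nsub D}" "x \<in> frontier (Sub D j)" by (auto simp: skeleton_def)
    then show ?thesis using fun_cong[OF R, of "(j, x)"] by (simp add: Rop_def fun_apply)
  next
    case False
    then show ?thesis using v by (auto simp: Vh_Sigma_def restr_def fun_apply)
  qed
qed

text \<open>
  The constant function 1 has a nonzero trace, since a nonempty bounded set has a nonempty boundary. This
  gives the preconditioned matrix a nonempty spectrum and a condition number of at least 1.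
\<close>

lemma Vh_Sigma_nontrivial: "\<exists>v\<in>Vh_Sigma D. v \<noteq> 0"
proof -
  have "closure (Dom D) \<noteq> {}" using Dom_nonempty by simp
  then have "{1..Nsub D} \<noteq> {}" using Dom_cover by (metis UN_empty)
  then obtain j where j: "j \<in> {1..Nsub D}" by blast
  have "Sub D j \<noteq> UNIV" using bounded_Sub[OF j] not_bounded_UNIV by metis
  then obtain x where x: "x \<in> frontier (Sub D j)"
    using Sub_nonempty[OF j] frontier_eq_empty[of "Sub D j"] by blast
  let ?v = "restr (skeleton D) (restr (closure (Dom D)) (\<lambda>x. 1))"
  have "x \<in> closure (Dom D)" using x frontier_Sub_subset[of j] closure_Sub_subset[OF j] by blast
  then have "?v x = 1" using x j by (auto simp: restr_def skeleton_def)
  then have "?v \<noteq> 0" by (auto simp: fun_apply fun_eq_iff intro!: exI[of _ x])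
  then show ?thesis using one_Vh unfolding Vh_Sigma_def by blast
qed

subsection \<open>The local bilinear forms\<close>

abbreviation local_space where
  "local_space j \<equiv> restr (closure (Sub D j)) ` Vh D"

abbreviation outer where
  "outer j \<equiv> frontier (Dom D) \<inter> frontier (Sub D j)"

definition local_form where
  "local_form j f g = vol (Sub D j) f g - \<i> * of_real (Wavenum D) * surf_int D (outer j) (\<lambda>x. f x * g x)"

lemma local_form_commute: "local_form j f g = local_form j g f"
  by (simp add: local_form_def vol_commute mult.commute)

lemma continuous_on_outer_facet:
  assumes f: "f \<in> local_space j" and F: "F \<in> boundary_facets D (outer j)"
  shows "continuous_on F f"
proof -
  obtain w where w: "w \<in> Vh D" "f = restr (closure (Sub D j)) w" using f by blast
  have "continuous_on F w"
    using Vh_D(1)[OF w(1)] boundary_facet(5)[OF F] continuous_on_subset by blast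
  moreover have "w x = f x" if "x \<in> F" for x
    using that boundary_facet(4)[OF F] frontier_Sub_subset[of j] by (auto simp: w(2) restr_def)
  ultimately show ?thesis by (rule continuous_on_eq)
qed

lemma outer_product_integrable:
  assumes "f \<in> local_space j" "g \<in> local_space j" "F \<in> boundary_facets D (outer j)"
  shows "integrable (facet_measure F) (\<lambda>x. f x * g x)"
  using assms boundary_facet[OF assms(3)]
  by (intro integrable_facet_continuous continuous_on_mult continuous_on_outer_facet) auto

lemma vol_restr:
  assumes j: "j \<in> {1..Nsub D}"
  shows "vol (Sub D j) (restr (closure (Sub D j)) u) (restr (closure (Sub D j)) v) = vol (Sub D j) u v"
  using closure_subset[of "Sub D j"]
  by (intro vol_cong open_Sub Sub_subset j) (auto simp: restr_def)

lemma local_form_add: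
  assumes j: "j \<in> {1..Nsub D}" and f: "f \<in> local_space j" "f' \<in> local_space j" and g: "g \<in> local_space j"
  shows "local_form j (f + f') g = local_form j f g + local_form j f' g"
proof -
  obtain u u' v where r: "u \<in> Vh D" "f = restr (closure (Sub D j)) u"
      "u' \<in> Vh D" "f' = restr (closure (Sub D j)) u'" "v \<in> Vh D" "g = restr (closure (Sub D j)) v"
    using f g by blast
  have "vol (Sub D j) (f + f') g = vol (Sub D j) f g + vol (Sub D j) f' g"
    unfolding r(2,4,6) restr_add[symmetric] vol_restr[OF j]
    by (intro vol_add open_Sub Sub_subset j r)
  moreover have "surf_int D (outer j) (\<lambda>x. (f + f') x * g x)
      = surf_int D (outer j) (\<lambda>x. f x * g x) + surf_int D (outer j) (\<lambda>x. f' x * g x)"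
    unfolding fun_apply distrib_right
    by (intro surf_add outer_product_integrable[of _ j] f g)
  ultimately show ?thesis by (simp add: local_form_def algebra_simps)
qed

lemma local_form_scale:
  assumes j: "j \<in> {1..Nsub D}" and f: "f \<in> local_space j" and g: "g \<in> local_space j"
  shows "local_form j (cscale c f) g = c * local_form j f g"
proof -
  obtain u v where r: "u \<in> Vh D" "f = restr (closure (Sub D j)) u" "v \<in> Vh D" "g = restr (closure (Sub D j)) v"
    using f g by blast
  have "vol (Sub D j) (cscale c f) g = c * vol (Sub D j) f g"
    unfolding r(2,4) restr_scale[symmetric] vol_restr[OF j]
    by (intro vol_scale open_Sub Sub_subset j r)
  moreover have "surf_int D (outer j) (\<lambda>x. cscale c f x * g x) = c * surf_int D (outer j) (\<lambda>x. f x * g x)"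
    unfolding fun_apply mult.assoc by (rule surf_scale)
  ultimately show ?thesis by (simp add: local_form_def algebra_simps)
qed

text \<open>
  The volume part is real, and the boundary part contributes \<open>-\<kappa>\<close> times a nonnegative number: the
  impedance condition is dissipative.
\<close>

lemma local_form_Im:
  assumes j: "j \<in> {1..Nsub D}" and f: "f \<in> local_space j"
  shows "Im (local_form j f (cnj_fun f)) \<le> 0"
proof -
  obtain u where r: "u \<in> Vh D" "f = restr (closure (Sub D j)) u" using f by blast
  have "Im (vol (Sub D j) f (cnj_fun f)) = 0"
    unfolding r(2) cnj_fun_restr vol_restr[OF j] by (intro vol_cnj_real open_Sub Sub_subset j r)
  moreover obtain s where "s \<ge> 0" "surf_int D (outer j) (\<lambda>x. f x * cnj_fun f x) = of_real s"
    using surf_modulus[of "outer j" f] by (auto simp: cnj_fun_def)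
  ultimately show ?thesis using kappa_pos by (simp add: local_form_def)
qed

lemma component_local: "u \<in> VVh_Omega D \<Longrightarrow> j \<in> {1..Nsub D} \<Longrightarrow> component j u \<in> local_space j"
  by (simp add: VVh_Omega_def tuples_iff)

lemma Aop_eq:
  "Aop D u = restr (VVh_Omega D) (\<lambda>v. \<Sum>j\<in>{1..Nsub D}. local_form j (component j u) (component j v))"
  by (simp add: Aop_def local_form_def vol_def vol_density_def component_def)

lemma sub_VVh_Omega: "fs.subspace (VVh_Omega D)"
  using fin_dim_VVh_Omega fin_dim_subspace by blast

lemma linear_Aop: "linear_map_on (VVh_Omega D) (dual (VVh_Omega D)) (Aop D)"
  unfolding linear_map_on_def
proof (intro conjI ballI allI)
  fix u assume u: "u \<in> VVh_Omega D"
  show "Aop D u \<in> dual (VVh_Omega D)"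
    unfolding Aop_eq
  proof (rule restr_dual[OF sub_VVh_Omega])
    fix v w assume "v \<in> VVh_Omega D" "w \<in> VVh_Omega D"
    then show "(\<Sum>j\<in>{1..Nsub D}. local_form j (component j u) (component j (v + w)))
        = (\<Sum>j\<in>{1..Nsub D}. local_form j (component j u) (component j v)) + (\<Sum>j\<in>{1..Nsub D}. local_form j (component j u) (component j w))"
      unfolding sum.distrib[symmetric] component_add local_form_commute[of _ "component _ u"]
      by (intro sum.cong refl local_form_add component_local u)
  next
    fix c v assume "v \<in> VVh_Omega D"
    then show "(\<Sum>j\<in>{1..Nsub D}. local_form j (component j u) (component j (cscale c v)))
        = c * (\<Sum>j\<in>{1..Nsub D}. local_form j (component j u) (component j v))"
      unfolding sum_distrib_left component_scale local_form_commute[of _ "component _ u"]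
      by (intro sum.cong refl local_form_scale component_local u)
  qed
next
  fix u v assume uv: "u \<in> VVh_Omega D" "v \<in> VVh_Omega D"
  show "Aop D (u + v) = Aop D u + Aop D v"
  proof
    fix w
    have "(\<Sum>j\<in>{1..Nsub D}. local_form j (component j (u + v)) (component j w))
        = (\<Sum>j\<in>{1..Nsub D}. local_form j (component j u) (component j w))
          + (\<Sum>j\<in>{1..Nsub D}. local_form j (component j v) (component j w))" if "w \<in> VVh_Omega D"
      unfolding sum.distrib[symmetric] component_add
      by (intro sum.cong refl local_form_add component_local uv that)
    then show "Aop D (u + v) w = (Aop D u + Aop D v) w" by (simp add: Aop_eq restr_def fun_apply)
  qed
next
  fix c u assume u: "u \<in> VVh_Omega D"
  show "Aop D (cscale c u) = cscale c (Aop D u)"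
  proof
    fix w
    have "(\<Sum>j\<in>{1..Nsub D}. local_form j (component j (cscale c u)) (component j w))
        = c * (\<Sum>j\<in>{1..Nsub D}. local_form j (component j u) (component j w))" if "w \<in> VVh_Omega D"
      unfolding sum_distrib_left component_scale
      by (intro sum.cong refl local_form_scale component_local u that)
    then show "Aop D (cscale c u) w = cscale c (Aop D u) w" by (simp add: Aop_eq restr_def fun_apply)
  qed
qed

lemma Aop_Im:
  assumes u: "u \<in> VVh_Omega D"
  shows "Im (Aop D u (cnj_fun u)) \<le> 0"
proof -
  have "Aop D u (cnj_fun u) = (\<Sum>j\<in>{1..Nsub D}. local_form j (component j u) (cnj_fun (component j u)))"
    using cnj_VVh_Omega[OF u] by (simp add: Aop_eq restr_def component_cnj)
  moreover have "(\<Sum>j\<in>{1..Nsub D}. Im (local_form j (component j u) (cnj_fun (component j u)))) \<le> 0"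
    using u by (intro sum_nonpos local_form_Im component_local)
  ultimately show ?thesis by simp
qed

lemma lvec_dual: "lvec D \<in> dual (VVh_Omega D)"
  unfolding lvec_def
proof (rule restr_dual[OF sub_VVh_Omega])
  have int: "integrable (facet_measure F) (\<lambda>x. Bdata D x * g x)"
    if g: "g \<in> local_space j" and F: "F \<in> boundary_facets D (outer j)" for g j F
  proof -
    have "F \<in> boundary_facets D (frontier (Dom D))" using F by (auto simp: boundary_facets_def)
    then show ?thesis
      using L2 boundary_facet[OF F] continuous_on_outer_facet[OF g F]
      unfolding L2_boundary_def by (intro integrable_facet_L2_times_continuous) auto
  qed
  fix u v assume uv: "u \<in> VVh_Omega D" "v \<in> VVh_Omega D"
  have "surf_int D (outer j) (\<lambda>x. Bdata D x * (u + v) (j, x))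
     = surf_int D (outer j) (\<lambda>x. Bdata D x * u (j, x)) + surf_int D (outer j) (\<lambda>x. Bdata D x * v (j, x))"
    if j: "j \<in> {1..Nsub D}" for j
    unfolding fun_apply distrib_left
    using int[OF component_local[OF uv(1) j]] int[OF component_local[OF uv(2) j]]
    by (intro surf_add) (auto simp: component_def)
  then show "(\<Sum>j\<in>{1..Nsub D}. surf_int D (outer j) (\<lambda>x. Bdata D x * (u + v) (j, x)))
     = (\<Sum>j\<in>{1..Nsub D}. surf_int D (outer j) (\<lambda>x. Bdata D x * u (j, x)))
       + (\<Sum>j\<in>{1..Nsub D}. surf_int D (outer j) (\<lambda>x. Bdata D x * v (j, x)))"
    by (simp add: sum.distrib)
next
  fix c u assume "u \<in> VVh_Omega D"
  show "(\<Sum>j\<in>{1..Nsub D}. surf_int D (outer j) (\<lambda>x. Bdata D x * cscale c u (j, x)))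
     = c * (\<Sum>j\<in>{1..Nsub D}. surf_int D (outer j) (\<lambda>x. Bdata D x * u (j, x)))"
    unfolding sum_distrib_left fun_apply mult.left_commute[of _ c] by (intro sum.cong refl surf_scale)
qed

subsection \<open>Local fields without trace\<close>

text \<open>
  A local function that vanishes on the interface is continuous when extended by 0, and every mesh
  element is either contained in the closure of the subdomain or disjoint from the subdomain.
\<close>

lemma zero_trace_in_Vh:
  assumes j: "j \<in> {1..Nsub D}" and f: "f \<in> local_space j"
    and tr: "\<And>x. x \<in> frontier (Sub D j) \<Longrightarrow> f x = 0"
  shows "f \<in> Vh D"
proof -
  obtain w where w: "w \<in> Vh D" "f = restr (closure (Sub D j)) w" using f by blast
  have off: "f x = 0" if "x \<notin> Sub D j" for x
    using that tr closure_Sub_split[OF j] by (auto simp: w(2) restr_def)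
  let ?C = "closure (Sub D j)" and ?E = "closure (Dom D) - Sub D j"
  have "continuous_on (?C \<union> ?E) (\<lambda>x. if x \<in> ?C then w x else 0)"
  proof (rule continuous_on_cases)
    show "closed ?C" "closed ?E" using open_Sub[OF j] by (auto intro: closed_Diff)
    show "continuous_on ?C w"
      using Vh_D(1)[OF w(1)] closure_Sub_subset[OF j] continuous_on_subset by blast
    show "\<forall>x. x \<in> ?C \<and> x \<notin> ?C \<or> x \<in> ?E \<and> x \<in> ?C \<longrightarrow> w x = 0"
    proof (intro allI impI)
      fix x assume x: "x \<in> ?C \<and> x \<notin> ?C \<or> x \<in> ?E \<and> x \<in> ?C"
      then have "f x = 0" using off by blast
      then show "w x = 0" using x by (auto simp: w(2) restr_def)
    qed
  qed auto
  moreover have "?C \<union> ?E = closure (Dom D)" using closure_Sub_subset[OF j] closure_subset by blast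
  ultimately have c: "continuous_on (closure (Dom D)) f" by (simp add: w(2) restr_def[abs_def])
  have p: "poly_on (Deg D) K f" if K: "K \<in> Mesh D" for K
  proof -
    obtain i where i: "i \<in> {1..Nsub D}" "K \<subseteq> closure (Sub D i)" using Mesh_in_Sub[OF K] by blast
    show ?thesis
    proof (cases "i = j")
      case True
      then show ?thesis
        using i by (intro poly_on_cong[OF _ Vh_D(2)[OF w(1) K]]) (auto simp: w(2) restr_def)
    next
      case False
      then have "K \<inter> Sub D j = {}" using closure_Sub_disjoint[OF i(1) j] i(2) by blast
      then show ?thesis by (intro poly_on_cong[OF _ poly_on_zero]) (metis off disjoint_iff)
    qed
  qed
  have "f x = 0" if "x \<notin> closure (Dom D)" for x
    using that closure_Sub_subset[OF j] by (auto simp: w(2) restr_def)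
  then show ?thesis using c p by (auto simp: Vh_def)
qed

lemma form_a_eq: "form_a D u v
    = vol (Dom D) u (cnj_fun v) - \<i> * of_real (Wavenum D) * surf_int D (frontier (Dom D)) (\<lambda>x. u x * cnj_fun v x)"
  by (simp add: form_a_def vol_def vol_density_def cnj_fun_def)

lemma form_a_add:
  assumes "u \<in> Vh D" "w \<in> Vh D" "v \<in> Vh D"
  shows "form_a D (u + w) v = form_a D u v + form_a D w v"
proof -
  have int: "integrable (facet_measure F) (\<lambda>x. u x * cnj_fun v x)"
    if "F \<in> boundary_facets D (frontier (Dom D))" "u \<in> Vh D" for u F
    using boundary_facet[OF that(1)] that assms cnj_Vh
    by (intro integrable_facet_continuous continuous_on_mult continuous_on_subset[OF Vh_D(1)]) auto
  have "surf_int D (frontier (Dom D)) (\<lambda>x. (u + w) x * cnj_fun v x)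
    = surf_int D (frontier (Dom D)) (\<lambda>x. u x * cnj_fun v x) + surf_int D (frontier (Dom D)) (\<lambda>x. w x * cnj_fun v x)"
    unfolding fun_apply distrib_right by (intro surf_add int assms)
  moreover have "vol (Dom D) (u + w) (cnj_fun v) = vol (Dom D) u (cnj_fun v) + vol (Dom D) w (cnj_fun v)"
    by (intro vol_add open_Dom subset_refl assms cnj_Vh)
  ultimately show ?thesis by (simp add: form_a_eq algebra_simps)
qed

lemma form_a_injective:
  assumes u: "u \<in> Vh D" and 0: "\<And>v. v \<in> Vh D \<Longrightarrow> form_a D u v = 0"
  shows "u = 0"
proof -
  (* adding a kernel element to the unique solution gives another solution *)
  obtain w where w: "w \<in> Vh D" "\<And>v. v \<in> Vh D \<Longrightarrow> form_a D w v = form_l D v"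
    using unique_solution by blast
  have "w + u \<in> Vh D" using w u fs.subspace_add[OF subspace_Vh] by blast
  moreover have "\<forall>v\<in>Vh D. form_a D (w + u) v = form_l D v" using form_a_add w u 0 by simp
  ultimately have "w + u = w" using unique_solution w by blast
  then show ?thesis by (metis add_cancel_right_right)
qed

text \<open>
  Extended by 0, the components of \<open>u\<close> add up to a discrete function \<open>w\<close> on the whole domain. Testing
  \<open>A u = 0\<close> with the restrictions of a global test function gives \<open>a(w, v) = 0\<close>, since all boundary
  terms of \<open>w\<close> vanish; unique solvability of the global discrete problem then forces \<open>w = 0\<close>.
\<close>

lemma traceless_kernel:
  assumes u: "u \<in> VVh_Omega D" and B: "Bop D u = 0" and A: "\<And>v. v \<in> VVh_Omega D \<Longrightarrow> Aop D u v = 0"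
  shows "u = 0"
proof -
  let ?J = "{1..Nsub D}"
  define f where "f j = component j u" for j
  have floc: "f j \<in> local_space j" if "j \<in> ?J" for j using component_local[OF u that] by (simp add: f_def)
  have tr: "f j x = 0" if "j \<in> ?J" "x \<in> frontier (Sub D j)" for j x
    using fun_cong[OF B, of "(j, x)"] that by (simp add: Bop_def f_def component_def fun_apply)
  have fV: "f j \<in> Vh D" if "j \<in> ?J" for j using zero_trace_in_Vh[OF that floc[OF that] tr[OF that]] .
  have off: "f j x = 0" if "j \<in> ?J" "x \<notin> Sub D j" for j x
  proof (cases "x \<in> closure (Sub D j)")
    case True
    then show ?thesis using that tr closure_Sub_split[OF that(1)] by blast
  next
    case False
    then show ?thesis using floc[OF that(1)] by (auto simp: restr_def)
  qed
  define w where "w = (\<Sum>j\<in>?J. f j)"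
  have wV: "w \<in> Vh D" unfolding w_def using fV by (intro fs.subspace_sum[OF subspace_Vh])
  have wj: "w x = f j x" if "j \<in> ?J" "x \<in> Sub D j" for j x
  proof -
    have "w x = (\<Sum>i\<in>?J. if i = j then f j x else 0)"
      unfolding w_def sum_fun_apply
    proof (intro sum.cong refl)
      fix i assume i: "i \<in> ?J"
      show "f i x = (if i = j then f j x else 0)"
        using off[OF i, of x] Sub_disjoint[OF i that(1)] that(2) by auto
    qed
    then show ?thesis using that(1) by simp
  qed
  have w0: "w x = 0" if "x \<in> frontier (Dom D)" for x
  proof -
    have "x \<notin> Dom D" using that open_Dom by (simp add: frontier_def interior_open)
    then show ?thesis using off Sub_subset unfolding w_def sum_fun_apply by (intro sum.neutral) blast
  qed
  have "form_a D w v = 0" if v: "v \<in> Vh D" for v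
  proof -
    define g where "g = cnj_fun v"
    have g: "g \<in> Vh D" using v cnj_Vh by (simp add: g_def)
    define z where "z = (\<lambda>(j, x). if j \<in> ?J then restr (closure (Sub D j)) g x else 0)"
    have cz: "component j z = restr (closure (Sub D j)) g" if "j \<in> ?J" for j
      using that by (auto simp: component_def z_def)
    have z: "z \<in> VVh_Omega D"
      unfolding VVh_Omega_def tuples_iff using cz g by (auto simp: z_def)
    have "form_a D w v = vol (Dom D) w g"
      unfolding form_a_eq g_def[symmetric] using w0 by (simp add: surf_zero)
    also have "\<dots> = (\<Sum>j\<in>?J. vol (Sub D j) w g)" by (rule vol_split[OF wV g])
    also have "\<dots> = (\<Sum>j\<in>?J. local_form j (f j) (component j z))"
    proof (intro sum.cong refl)
      fix j assume j: "j \<in> ?J"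
      have "surf_int D (outer j) (\<lambda>x. f j x * component j z x) = 0"
        using tr[OF j] by (intro surf_zero) auto
      then have "local_form j (f j) (component j z) = vol (Sub D j) (f j) (component j z)"
        by (simp add: local_form_def)
      also have "\<dots> = vol (Sub D j) w g"
        using wj[OF j] closure_subset[of "Sub D j"]
        by (intro vol_cong open_Sub Sub_subset j) (auto simp: cz[OF j] restr_def)
      finally show "vol (Sub D j) w g = local_form j (f j) (component j z)" by simp
    qed
    also have "\<dots> = Aop D u z" using z by (simp add: Aop_eq restr_def f_def)
    also have "\<dots> = 0" by (rule A[OF z])
    finally show ?thesis .
  qed
  then have "w = 0" using form_a_injective[OF wV] by blast
  have "u (j, x) = 0" for j x
  proof (cases "j \<in> ?J")
    case True
    then have "f j x = 0" using off[OF True, of x] wj[OF True, of x] \<open>w = 0\<close> by (auto simp: fun_apply)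
    then show ?thesis by (simp add: f_def component_def)
  next
    case False
    then show ?thesis using u unfolding VVh_Omega_def tuples_iff by blast
  qed
  then show ?thesis by (auto simp: fun_eq_iff fun_apply)
qed

end

section \<open>A two-term recurrence\<close>

text \<open>
  The recurrence has the matrix with rows \<open>(\<rho> + 2 \<epsilon>, 2 (1 + \<epsilon>))\<close> and \<open>(\<epsilon>, \<epsilon>)\<close> in the variables
  \<open>(x, y)\<close>. Measuring \<open>y\<close> in the unit \<open>t = sqrt (\<epsilon> / (1 + \<epsilon>))\<close> changes the off-diagonal entries to
  \<open>2 s\<close> and \<open>s\<close> with \<open>s = sqrt (\<epsilon> (1 + \<epsilon>))\<close>, and the result is bounded entrywise by \<open>R\<close>. The case
  \<open>\<epsilon> = 0\<close>, in which \<open>t = 0\<close>, is harmless because then \<open>y\<close> vanishes.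
\<close>

lemma matrix_recurrence_decay:
  fixes x y :: "nat \<Rightarrow> real" and R :: "real^2^2"
  assumes nonneg: "\<And>n. 0 \<le> x n" "\<And>n. 0 \<le> y n" "0 \<le> \<epsilon>"
    and y: "y 0 = 0" "\<And>n. y (Suc n) \<le> \<epsilon> * (x n + y n)"
    and x: "\<And>n. x (Suc n) \<le> \<rho> * x n + 2 * (y (Suc n) + y n)"
    and R: "R = vector [vector [\<rho> + 2 * \<epsilon>, 2 * sqrt (\<epsilon> * (1 + \<epsilon>))],
                        vector [2 * sqrt (\<epsilon> * (1 + \<epsilon>)), 2 * \<epsilon>]]"
  shows "x n \<le> onorm ((*v) R) ^ n * x 0" "y n \<le> onorm ((*v) R) ^ n * x 0"
proof -
  define t where "t = sqrt (\<epsilon> / (1 + \<epsilon>))"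
  define s where "s = sqrt (\<epsilon> * (1 + \<epsilon>))"
  have t: "0 \<le> t" "t \<le> 1" using nonneg(3) by (auto simp: t_def)
  have s0: "0 \<le> s" using nonneg(3) by (simp add: s_def)
  have ts: "t * (1 + \<epsilon>) = s"
  proof -
    have "t * (1 + \<epsilon>) = sqrt (\<epsilon> / (1 + \<epsilon>)) * sqrt ((1 + \<epsilon>)\<^sup>2)"
      using nonneg(3) by (simp add: t_def)
    also have "\<dots> = sqrt (\<epsilon> / (1 + \<epsilon>) * (1 + \<epsilon>)\<^sup>2)" by (simp only: real_sqrt_mult)
    also have "\<epsilon> / (1 + \<epsilon>) * (1 + \<epsilon>)\<^sup>2 = \<epsilon> * (1 + \<epsilon>)"
      using nonneg(3) by (simp add: power2_eq_square)
    finally show ?thesis by (simp add: s_def)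
  qed
  have st: "s * t = \<epsilon>"
  proof -
    have "s * t = sqrt ((\<epsilon> * (1 + \<epsilon>)) * (\<epsilon> / (1 + \<epsilon>)))" by (simp only: s_def t_def real_sqrt_mult)
    also have "(\<epsilon> * (1 + \<epsilon>)) * (\<epsilon> / (1 + \<epsilon>)) = \<epsilon>\<^sup>2" using nonneg(3) by (simp add: power2_eq_square)
    finally show ?thesis using nonneg(3) by simp
  qed
  define z where "z n = y n / t" for n
  have y_zero: "y n = 0" if "\<epsilon> = 0" for n
  proof (cases n)
    case (Suc m)
    then show ?thesis using that y(2)[of m] nonneg(2)[of n] by simp
  qed (simp add: y(1))
  have yz: "y n = t * z n" for n
    using y_zero[of n] by (cases "\<epsilon> = 0") (use nonneg(3) in \<open>auto simp: z_def t_def\<close>)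
  have z0: "0 \<le> z n" for n using nonneg(2) t by (simp add: z_def)
  define w where "w n = (vector [x n, z n] :: real^2)" for n
  have xs: "x (Suc n) \<le> (\<rho> + 2 * \<epsilon>) * x n + 2 * s * z n" for n
  proof -
    have "x (Suc n) \<le> \<rho> * x n + 2 * (\<epsilon> * (x n + y n) + y n)"
      by (rule order_trans[OF x add_left_mono[OF mult_left_mono[OF add_right_mono[OF y(2)]]]]) simp
    also have "\<dots> = (\<rho> + 2 * \<epsilon>) * x n + 2 * (t * (1 + \<epsilon>)) * z n"
      by (simp add: yz algebra_simps)
    finally show ?thesis by (simp add: ts)
  qed
  have zs: "z (Suc n) \<le> 2 * s * x n + 2 * \<epsilon> * z n" for n
  proof (cases "\<epsilon> = 0")
    case True
    then show ?thesis using y_zero nonneg(1) s0 by (simp add: z_def)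
  next
    case False
    then have t0: "t > 0" using nonneg(3) by (simp add: t_def)
    have "t * z (Suc n) \<le> \<epsilon> * x n + \<epsilon> * (t * z n)"
      using y(2)[of n] by (simp add: yz algebra_simps)
    also have "\<dots> = t * (s * x n + \<epsilon> * z n)"
      by (subst (1) st[symmetric]) (simp add: algebra_simps)
    finally have "z (Suc n) \<le> s * x n + \<epsilon> * z n" using t0 by simp
    moreover have "0 \<le> s * x n" "0 \<le> \<epsilon> * z n" using s0 nonneg z0 by auto
    ultimately show ?thesis by linarith
  qed
  have Rw: "(R *v w n) $ 1 = (\<rho> + 2 * \<epsilon>) * x n + 2 * s * z n" "(R *v w n) $ 2 = 2 * s * x n + 2 * \<epsilon> * z n" for n
    by (simp_all add: R w_def matrix_vector_mult_def sum_2 s_def)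
  have step: "norm (w (Suc n)) \<le> onorm ((*v) R) * norm (w n)" for n
  proof -
    have "norm (w (Suc n) $ i) \<le> norm ((R *v w n) $ i)" for i
      using exhaust_2[of i] xs[of n] zs[of n] nonneg(1)[of "Suc n"] z0[of "Suc n"]
      by (auto simp: Rw) (auto simp: w_def)
    then have "norm (w (Suc n)) \<le> norm (R *v w n)" by (rule norm_le_componentwise_cart)
    also have "\<dots> \<le> onorm ((*v) R) * norm (w n)"
      by (rule onorm[OF matrix_vector_mul_bounded_linear])
    finally show ?thesis .
  qed
  have o: "0 \<le> onorm ((*v) R)" by (rule onorm_pos_le[OF matrix_vector_mul_bounded_linear])
  have "norm (w n) \<le> onorm ((*v) R) ^ n * norm (w 0)"
  proof (induction n)
    case (Suc n)
    have "norm (w (Suc n)) \<le> onorm ((*v) R) * (onorm ((*v) R) ^ n * norm (w 0))"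
      using step[of n] mult_left_mono[OF Suc o] by linarith
    then show ?case by simp
  qed simp
  moreover have "norm (w 0) = x 0"
    using nonneg(1)[of 0] by (simp add: norm_vec_def L2_set_def sum_2 w_def z_def y(1))
  moreover have "x n \<le> norm (w n)" "z n \<le> norm (w n)"
    using component_le_norm_cart[of "w n" 1] component_le_norm_cart[of "w n" 2] by (auto simp: w_def)
  moreover have "y n \<le> z n" using yz[of n] t z0[of n] by (simp add: mult_left_le_one_le)
  ultimately show "x n \<le> onorm ((*v) R) ^ n * x 0" "y n \<le> onorm ((*v) R) ^ n * x 0" by auto
qed

text \<open>
  The difference of \<open>E n\<close> and the bound increases with \<open>n\<close> and tends to 0, so it is nonpositive.
  This replaces the summation of the series of increments.
\<close>

lemma telescoped_geometric_bound:
  fixes E x :: "nat \<Rightarrow> real"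
  assumes r: "r < 1" and lim: "E \<longlonglongrightarrow> 0" "(\<lambda>n. r ^ n * c) \<longlonglongrightarrow> 0"
    and E: "\<And>n. E n \<le> x n + E (Suc n)" and x: "\<And>n. x n \<le> r ^ n * c"
  shows "E n \<le> c * r ^ n / (1 - r)"
proof -
  define F where "F n = E n - r ^ n * c / (1 - r)" for n
  have "incseq F"
  proof (rule incseq_SucI)
    fix n
    have "r ^ n * c / (1 - r) - r ^ Suc n * c / (1 - r) = (r ^ n * c - r ^ Suc n * c) / (1 - r)"
      by (simp only: diff_divide_distrib)
    also have "\<dots> = r ^ n * c * (1 - r) / (1 - r)" by (simp add: algebra_simps)
    also have "\<dots> = r ^ n * c" using r by simp
    finally show "F n \<le> F (Suc n)" using E[of n] x[of n] by (simp add: F_def)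
  qed
  moreover have "F \<longlonglongrightarrow> 0 - 0 / (1 - r)"
    unfolding F_def using r by (intro tendsto_diff tendsto_divide lim tendsto_const) auto
  ultimately have "F n \<le> 0" using incseq_le[of F 0 n] by simp
  then show ?thesis by (simp add: F_def mult.commute)
qed

section \<open>Scattering and exchange operators\<close>

text \<open>
  Below, \<open>tr\<close> refers to the traces on all subdomain boundaries with the inner product of \<open>T\<close>, and \<open>sk\<close>
  to the traces on the skeleton with the inner product of \<open>R* T R\<close>. The map \<open>R\<close> is isometric between
  them.
\<close>

locale helmholtz_ddm_ops = helmholtz D
  for D :: "'a::euclidean_space helmholtz_ddm" +
  fixes T :: "'a transmission_op" and P :: "'a precond"
  assumes T: "hermitian_pos_def (VVh_Sigma D) T"
    and P: "hermitian_pos_def_dual (Vh_Sigma D) P"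

sublocale helmholtz_ddm_ops \<subseteq> tr: hermitian_space "VVh_Sigma D" T
  using fin_dim_VVh_Sigma cnj_VVh_Sigma T by unfold_locales

context helmholtz_ddm_ops
begin

lemma sub_Vh_Sigma: "fs.subspace (Vh_Sigma D)"
  using fin_dim_Vh_Sigma fin_dim_subspace by blast

lemmas Rop_mem = linear_map_on_mem[OF linear_Rop]

lemma linear_Rstar: "linear_map_on (dual (VVh_Sigma D)) (dual (Vh_Sigma D)) (Rstar D)"
  unfolding Rstar_def by (rule linear_map_on_adjoint[OF linear_Rop sub_Vh_Sigma])

lemma linear_Bstar: "linear_map_on (dual (VVh_Sigma D)) (dual (VVh_Omega D)) (Bstar D)"
  unfolding Bstar_def by (rule linear_map_on_adjoint[OF linear_Bop sub_VVh_Omega])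

lemma linear_TR: "linear_map_on (Vh_Sigma D) (dual (VVh_Sigma D)) (\<lambda>\<eta>. T (Rop D \<eta>))"
  by (rule linear_map_on_compose[OF linear_Rop tr.linT])

lemma linear_RTR: "linear_map_on (Vh_Sigma D) (dual (Vh_Sigma D)) (RTR D T)"
  unfolding RTR_def[abs_def] by (rule linear_map_on_compose[OF linear_TR linear_Rstar])

lemma RTR_ip: "v \<in> Vh_Sigma D \<Longrightarrow> RTR D T u (cnj_fun v) = tr.ip (Rop D u) (Rop D v)"
  by (simp add: RTR_def Rstar_def adjoint_on_apply cnj_Vh_Sigma tr.ip_def Rop_cnj)

lemma RTR_hermitian_pos_def: "hermitian_pos_def (Vh_Sigma D) (RTR D T)"
  unfolding hermitian_pos_def_def
proof (intro conjI ballI impI)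
  fix u v assume "u \<in> Vh_Sigma D" "v \<in> Vh_Sigma D"
  then show "RTR D T u (cnj_fun v) = cnj (RTR D T v (cnj_fun u))"
    using tr.ip_cnj[OF Rop_mem Rop_mem, of u v] by (simp only: RTR_ip)
next
  fix v assume "v \<in> Vh_Sigma D" "v \<noteq> 0"
  then show "Re (RTR D T v (cnj_fun v)) > 0"
    using Rop_eq_0 Rop_mem tr.ip_pos by (metis RTR_ip)
qed (rule linear_RTR)

end

sublocale helmholtz_ddm_ops \<subseteq> sk: hermitian_space "Vh_Sigma D" "RTR D T"
  using fin_dim_Vh_Sigma cnj_Vh_Sigma RTR_hermitian_pos_def by unfold_locales

context helmholtz_ddm_ops
begin

lemma sk_nrm: "v \<in> Vh_Sigma D \<Longrightarrow> sk.nrm v = tr.nrm (Rop D v)"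
  by (simp add: op_norm_primal_def RTR_ip tr.ip_def)

lemma P_facts:
  shows linear_P: "linear_map_on (dual (Vh_Sigma D)) (Vh_Sigma D) P"
    and P_sym: "b \<in> dual (Vh_Sigma D) \<Longrightarrow> c \<in> dual (Vh_Sigma D)
      \<Longrightarrow> cnj_functional c (P b) = cnj (cnj_functional b (P c))"
    and P_pos: "b \<in> dual (Vh_Sigma D) \<Longrightarrow> b \<noteq> 0 \<Longrightarrow> Re (cnj_functional b (P b)) > 0"
  using P unfolding hermitian_pos_def_dual_def by blast+

lemma cnj_functional_RTR: "cnj_functional (RTR D T v) u = cnj (sk.ip v u)"
  by (simp add: cnj_functional_def sk.ip_def)

lemma RTR_selfadjoint_map: "selfadjoint_map (Vh_Sigma D) (RTR D T) (\<lambda>\<eta>. P (RTR D T \<eta>))"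
proof
  show lin: "linear_map_on (Vh_Sigma D) (Vh_Sigma D) (\<lambda>\<eta>. P (RTR D T \<eta>))"
    by (rule linear_map_on_compose[OF linear_RTR linear_P])
  fix u assume u: "u \<in> Vh_Sigma D"
  note mem = linear_map_on_mem[OF lin] linear_map_on_mem[OF linear_RTR]
  have *: "sk.ip (P (RTR D T u)) v = cnj_functional (RTR D T v) (P (RTR D T u))" if "v \<in> Vh_Sigma D" for v
    unfolding cnj_functional_RTR using that u mem by (intro sk.ip_cnj) auto
  show "sk.ip (P (RTR D T u)) v = sk.ip u (P (RTR D T v))" if v: "v \<in> Vh_Sigma D" for v
  proof -
    have "cnj_functional (RTR D T v) (P (RTR D T u)) = cnj (cnj_functional (RTR D T u) (P (RTR D T v)))"
      using u v mem by (intro P_sym) auto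
    then show ?thesis by (simp add: *[OF v] cnj_functional_RTR)
  qed
  show "Re (sk.ip (P (RTR D T u)) u) > 0" if "u \<noteq> 0"
  proof -
    have "RTR D T u \<noteq> 0"
      using sk.Ti_T[OF u] linear_map_on_zero[OF sk.lin_Ti subspace_dual] that by metis
    then show ?thesis unfolding *[OF u] using u mem by (intro P_pos) auto
  qed
qed

end

sublocale helmholtz_ddm_ops \<subseteq> cg: selfadjoint_map "Vh_Sigma D" "RTR D T" "\<lambda>\<eta>. P (RTR D T \<eta>)"
  by (rule RTR_selfadjoint_map)

context helmholtz_ddm_ops
begin

text \<open>
  The residual \<open>P b - P M x0\<close> is \<open>N\<close> applied to the initial error, so that the Krylov space is the one
  of the abstract conjugate gradient bound.
\<close>

lemma PCG_error:
  assumes x0: "x0 \<in> Vh_Sigma D" and b: "b \<in> dual (Vh_Sigma D)" and k: "k \<ge> 1"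
  defines "\<epsilon> \<equiv> 2 * ((sqrt (cond_on (Vh_Sigma D) (\<lambda>\<eta>. P (RTR D T \<eta>))) - 1)
                    / (sqrt (cond_on (Vh_Sigma D) (\<lambda>\<eta>. P (RTR D T \<eta>))) + 1)) ^ k"
  shows "PCG D T P k x0 b \<in> Vh_Sigma D"
    "sk.nrm (sk.Ti b - PCG D T P k x0 b) \<le> \<epsilon> * sk.nrm (sk.Ti b - x0)"
proof -
  obtain u0 where u0: "u0 \<in> Vh_Sigma D" "u0 \<noteq> 0" using Vh_Sigma_nontrivial by blast
  have s: "sk.Ti b \<in> Vh_Sigma D" using sk.Ti_mem[OF b] .
  have "P b - P (RTR D T x0) = P (RTR D T (sk.Ti b - x0))"
    using linear_map_on_diff[OF cg.linN sub_Vh_Sigma s x0] sk.T_Ti[OF b] by simp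
  then have "PCG D T P k x0 b = (THE \<eta>. \<eta> \<in> krylov_affine k (\<lambda>\<eta>. P (RTR D T \<eta>)) x0 (P (RTR D T (sk.Ti b - x0))) \<and>
      (\<forall>\<zeta>\<in>krylov_affine k (\<lambda>\<eta>. P (RTR D T \<eta>)) x0 (P (RTR D T (sk.Ti b - x0))).
         sk.nrm (sk.Ti b - \<eta>) \<le> sk.nrm (sk.Ti b - \<zeta>)))"
    by (simp add: PCG_def Let_def)
  then show "PCG D T P k x0 b \<in> Vh_Sigma D"
    "sk.nrm (sk.Ti b - PCG D T P k x0 b) \<le> \<epsilon> * sk.nrm (sk.Ti b - x0)"
    unfolding \<epsilon>_def using cg.cg_error_bound[OF s x0 k u0] by simp_all
qed

subsection \<open>The scattering operator is a contraction\<close>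

text \<open>
  The local operator with impedance boundary conditions on the subdomain boundaries, that is
  \<open>A - \<i> B* T B\<close>.
\<close>

definition robin_op where "robin_op u = Aop D u - cscale \<i> (Bstar D (T (Bop D u)))"

lemma linear_TB: "linear_map_on (VVh_Omega D) (dual (VVh_Sigma D)) (\<lambda>u. T (Bop D u))"
  by (rule linear_map_on_compose[OF linear_Bop tr.linT])

lemma linear_robin_op: "linear_map_on (VVh_Omega D) (dual (VVh_Omega D)) robin_op"
proof -
  have eq: "robin_op = (\<lambda>u. cscale 1 (Aop D u) + cscale (- \<i>) (Bstar D (T (Bop D u))))"
    by (auto simp: robin_op_def fun_eq_iff fun_apply)
  show ?thesis
    unfolding eq
    by (rule linear_map_on_combine[OF linear_Aop linear_map_on_compose[OF linear_TB linear_Bstar] subspace_dual])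
qed

lemma Bop_cnj: "Bop D (cnj_fun u) = cnj_fun (Bop D u)"
  by (auto simp: Bop_def cnj_fun_def)

lemma robin_op_cnj:
  "u \<in> VVh_Omega D \<Longrightarrow> robin_op u (cnj_fun u) = Aop D u (cnj_fun u) - \<i> * tr.ip (Bop D u) (Bop D u)"
  by (simp add: robin_op_def fun_apply Bstar_def adjoint_on_apply cnj_VVh_Omega Bop_cnj tr.ip_def)

text \<open>
  Testing \<open>A u = \<i> B* T B u\<close> with \<open>cnj u\<close> and taking imaginary parts gives \<open>\<parallel>B u\<parallel>\<^sup>2\<close> on one side and a
  nonpositive number on the other. Hence \<open>B u = 0\<close>, and \<open>u\<close> is in the kernel excluded above.
\<close>

lemma bij_robin_op: "bij_betw robin_op (VVh_Omega D) (dual (VVh_Omega D))"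
proof -
  have "inj_on robin_op (VVh_Omega D)"
  proof (rule linear_map_on_inj_onI[OF linear_robin_op sub_VVh_Omega])
    fix u assume u: "u \<in> VVh_Omega D" and L: "robin_op u = 0"
    have Bu: "Bop D u \<in> VVh_Sigma D" using linear_map_on_mem[OF linear_Bop u] .
    have "Im (Aop D u (cnj_fun u)) = Re (tr.ip (Bop D u) (Bop D u))"
      using robin_op_cnj[OF u] L by (simp add: fun_apply)
    then have "Re (tr.ip (Bop D u) (Bop D u)) \<le> 0" using Aop_Im[OF u] by simp
    then have B0: "Bop D u = 0" using tr.ip_pos[OF Bu] by force
    have "Aop D u v = 0" if "v \<in> VVh_Omega D" for v
    proof -
      have "0 = Aop D u v - \<i> * T (Bop D u) (Bop D v)"
        using fun_cong[OF L, of v] that by (simp add: robin_op_def fun_apply Bstar_def adjoint_on_apply)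
      then show ?thesis by (simp add: B0 linear_map_on_zero[OF tr.linT tr.sub] fun_apply)
    qed
    then show "u = 0" by (rule traceless_kernel[OF u B0])
  qed
  then show ?thesis
    using linear_inj_dual_onto[OF fin_dim_VVh_Omega linear_robin_op] by (simp add: bij_betw_def)
qed

lemma local_solve_eq: "local_solve D T = inv_into (VVh_Omega D) robin_op"
  by (simp add: local_solve_def robin_op_def[abs_def])

lemma linear_local_solve: "linear_map_on (dual (VVh_Omega D)) (VVh_Omega D) (local_solve D T)"
  unfolding local_solve_eq by (rule linear_map_on_inv_into[OF linear_robin_op sub_VVh_Omega bij_robin_op])

lemma robin_op_local_solve: "b \<in> dual (VVh_Omega D) \<Longrightarrow> robin_op (local_solve D T b) = b"
  unfolding local_solve_eq using bij_robin_op by (simp add: bij_betw_def f_inv_into_f)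

lemma linear_scattering: "linear_map_on (dual (VVh_Sigma D)) (dual (VVh_Sigma D)) (scattering D T)"
proof -
  have eq: "scattering D T = (\<lambda>q. cscale 1 q + cscale (2 * \<i>) (T (Bop D (local_solve D T (Bstar D q)))))"
    by (auto simp: scattering_def fun_eq_iff fun_apply)
  show ?thesis
    unfolding eq
    by (rule linear_map_on_combine[OF linear_map_on_id
        linear_map_on_compose[OF linear_map_on_compose[OF linear_Bstar linear_local_solve] linear_TB] subspace_dual])
qed

lemma gvec_dual: "gvec D T \<in> dual (VVh_Sigma D)"
  unfolding gvec_def
  by (intro tr.dual_scale_mem linear_map_on_mem[OF linear_TB] linear_map_on_mem[OF linear_local_solve] lvec_dual)

text \<open>
  Energy conservation: \<open>\<parallel>S q\<parallel>\<^sup>2 = \<parallel>q\<parallel>\<^sup>2 + 4 Im \<langle>A u, cnj u\<rangle>\<close> for the local solution \<open>u\<close> with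
  data \<open>q\<close>, and the last term accounts for the energy lost through the outer boundary. The identity comes from
  expanding \<open>\<parallel>w + 2 \<i> b\<parallel>\<^sup>2\<close> for \<open>w = T\<^sup>-\<^sup>1 q\<close> and \<open>b = B u\<close>, where \<open>B* q\<close> tested with \<open>cnj u\<close>
  yields the mixed term.
\<close>

lemma scattering_contraction:
  assumes q: "q \<in> dual (VVh_Sigma D)"
  shows "tr.dnrm (scattering D T q) \<le> tr.dnrm q"
proof -
  define w where "w = tr.Ti q"
  define u where "u = local_solve D T (Bstar D q)"
  define b where "b = Bop D u"
  have w: "w \<in> VVh_Sigma D" "T w = q" using tr.Ti_mem[OF q] tr.T_Ti[OF q] by (auto simp: w_def)
  have Bq: "Bstar D q \<in> dual (VVh_Omega D)" using linear_map_on_mem[OF linear_Bstar q] .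
  have u: "u \<in> VVh_Omega D" "robin_op u = Bstar D q"
    using linear_map_on_mem[OF linear_local_solve Bq] robin_op_local_solve[OF Bq] by (auto simp: u_def)
  have b: "b \<in> VVh_Sigma D" using linear_map_on_mem[OF linear_Bop u(1)] by (simp add: b_def)
  have bb: "tr.ip b b = of_real ((tr.nrm b)\<^sup>2)" using tr.ip_self[OF b] tr.nrm_sq[OF b] by simp
  have "tr.ip w b = q (Bop D (cnj_fun u))" by (simp add: tr.ip_def w(2) b_def Bop_cnj)
  also have "\<dots> = Bstar D q (cnj_fun u)" using cnj_VVh_Omega[OF u(1)] by (simp add: Bstar_def adjoint_on_apply)
  also have "\<dots> = Aop D u (cnj_fun u) - \<i> * tr.ip b b"
    using robin_op_cnj[OF u(1)] u(2) by (simp add: b_def)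
  finally have wb: "tr.ip w b = Aop D u (cnj_fun u) - \<i> * of_real ((tr.nrm b)\<^sup>2)" by (simp add: bb)
  have "scattering D T q = T (w + cscale (2 * \<i>) b)"
    using w b by (simp add: scattering_def u_def b_def linear_map_on_add[OF tr.linT] linear_map_on_scale[OF tr.linT] tr.mems)
  then have "tr.dnrm (scattering D T q) = tr.nrm (w + cscale (2 * \<i>) b)"
    using w b by (simp add: tr.dnrm_T tr.mems)
  moreover have "(tr.nrm (w + cscale (2 * \<i>) b))\<^sup>2 = (tr.nrm w)\<^sup>2 + 4 * Im (Aop D u (cnj_fun u))"
    using w b by (simp add: tr.nrm_add_sq tr.mems tr.nrm_scale tr.ip_scale_right wb power_mult_distrib norm_mult)
  moreover have "tr.dnrm q = tr.nrm w" using tr.dnrm_T[OF w(1)] w(2) by simp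
  ultimately have "(tr.dnrm (scattering D T q))\<^sup>2 \<le> (tr.dnrm q)\<^sup>2" using Aop_Im[OF u(1)] by simp
  then show ?thesis by (rule power2_le_imp_le) (rule tr.dnrm_nonneg[OF q])
qed

subsection \<open>The exchange operator is an isometry\<close>

text \<open>
  The map \<open>(R* T R)\<^sup>-\<^sup>1 R*\<close>. After composition with \<open>R\<close> it is, up to the identification of \<open>q\<close>
  with \<open>T\<^sup>-\<^sup>1 q\<close>, the orthogonal projection onto the range of \<open>R\<close>.
\<close>

definition proj where "proj q = sk.Ti (Rstar D q)"

lemma linear_proj: "linear_map_on (dual (VVh_Sigma D)) (Vh_Sigma D) proj"
  unfolding proj_def[abs_def] by (rule linear_map_on_compose[OF linear_Rstar sk.lin_Ti])

lemmas proj_mem = linear_map_on_mem[OF linear_proj]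

lemma proj_orthogonal:
  assumes q: "q \<in> dual (VVh_Sigma D)" and v: "v \<in> Vh_Sigma D"
  shows "tr.ip (Rop D (proj q) - tr.Ti q) (Rop D v) = 0"
proof -
  have "tr.ip (Rop D (proj q)) (Rop D v) = RTR D T (proj q) (cnj_fun v)" using v by (simp add: RTR_ip)
  also have "\<dots> = q (Rop D (cnj_fun v))"
    using sk.T_Ti[OF linear_map_on_mem[OF linear_Rstar q]] cnj_Vh_Sigma[OF v]
    by (simp add: proj_def Rstar_def adjoint_on_apply)
  also have "\<dots> = tr.ip (tr.Ti q) (Rop D v)" by (simp add: tr.ip_def tr.T_Ti[OF q] Rop_cnj)
  finally show ?thesis
    using Rop_mem[OF proj_mem[OF q]] tr.Ti_mem[OF q] by (simp add: tr.ip_diff_left)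
qed

text \<open>
  An orthogonal projection does not increase norms, and the corresponding reflection \<open>\<Pi>\<close> preserves
  them.
\<close>

lemma proj_facts:
  assumes q: "q \<in> dual (VVh_Sigma D)"
  shows proj_le: "sk.nrm (proj q) \<le> tr.dnrm q"
    and exchange_isometry: "tr.dnrm (exchange D T q) = tr.dnrm q"
proof -
  define w where "w = tr.Ti q"
  define a where "a = Rop D (proj q)"
  define c where "c = a - w"
  have w: "w \<in> VVh_Sigma D" "T w = q" using tr.Ti_mem[OF q] tr.T_Ti[OF q] by (auto simp: w_def)
  have a: "a \<in> VVh_Sigma D" using Rop_mem[OF proj_mem[OF q]] by (simp add: a_def)
  have c: "c \<in> VVh_Sigma D" using a w by (simp add: c_def tr.mems)
  have "tr.ip c a = 0" using proj_orthogonal[OF q proj_mem[OF q]] by (simp add: c_def a_def w_def)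
  then have ac: "tr.ip a c = 0" using tr.ip_cnj[OF a c] by simp
  have "w = a - c" by (simp add: c_def)
  then have nw: "(tr.nrm w)\<^sup>2 = (tr.nrm a)\<^sup>2 + (tr.nrm c)\<^sup>2" using tr.nrm_diff_sq[OF a c] ac by simp
  have dq: "tr.dnrm q = tr.nrm w" using tr.dnrm_T[OF w(1)] w(2) by simp
  have "(tr.nrm a)\<^sup>2 \<le> (tr.nrm w)\<^sup>2" using nw by simp
  then have "tr.nrm a \<le> tr.nrm w" by (rule power2_le_imp_le) (rule tr.nrm_nonneg[OF w(1)])
  then show "sk.nrm (proj q) \<le> tr.dnrm q" using proj_mem[OF q] by (simp add: sk_nrm a_def dq)
  have "exchange D T q = cscale 2 (T a) - T w"
    by (simp add: exchange_def proj_def a_def w(2))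
  also have "\<dots> = T (cscale 2 a - w)"
    using a w(1) by (simp add: linear_map_on_diff[OF tr.linT tr.sub] linear_map_on_scale[OF tr.linT] tr.mems)
  also have "cscale 2 a - w = a + c" by (auto simp: c_def fun_eq_iff fun_apply)
  finally have "tr.dnrm (exchange D T q) = tr.nrm (a + c)" using a c by (simp add: tr.dnrm_T tr.mems)
  moreover have "(tr.nrm (a + c))\<^sup>2 = (tr.nrm w)\<^sup>2" using tr.nrm_add_sq[OF a c] ac nw by simp
  ultimately show "tr.dnrm (exchange D T q) = tr.dnrm q"
    using tr.nrm_nonneg[OF tr.add_mem[OF a c]] tr.nrm_nonneg[OF w(1)] dq by (simp add: power2_eq_iff_nonneg)
qed

lemma linear_exchange: "linear_map_on (dual (VVh_Sigma D)) (dual (VVh_Sigma D)) (exchange D T)"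
proof -
  have eq: "exchange D T = (\<lambda>q. cscale 2 (T (Rop D (proj q))) + cscale (- 1) q)"
    by (auto simp: exchange_def proj_def fun_eq_iff fun_apply)
  show ?thesis
    unfolding eq
    by (rule linear_map_on_combine[OF linear_map_on_compose[OF linear_proj linear_TR] linear_map_on_id subspace_dual])
qed

lemma dnrm_TR: "\<eta> \<in> Vh_Sigma D \<Longrightarrow> tr.dnrm (T (Rop D \<eta>)) = sk.nrm \<eta>"
  using tr.dnrm_T[OF Rop_mem] by (simp add: sk_nrm)

subsection \<open>The relaxed iteration operator\<close>

definition relax where
  "relax \<alpha> x = cscale (of_real (1 - \<alpha>)) x - cscale (of_real \<alpha>) (exchange D T (scattering D T x))" for \<alpha> :: real

lemma linear_exchange_scattering:
  "linear_map_on (dual (VVh_Sigma D)) (dual (VVh_Sigma D)) (\<lambda>x. exchange D T (scattering D T x))"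
  by (rule linear_map_on_compose[OF linear_scattering linear_exchange])

lemmas exchange_scattering_mem = linear_map_on_mem[OF linear_exchange_scattering]

lemma exchange_scattering_le:
  "x \<in> dual (VVh_Sigma D) \<Longrightarrow> tr.dnrm (exchange D T (scattering D T x)) \<le> tr.dnrm x"
  using exchange_isometry[OF linear_map_on_mem[OF linear_scattering]] scattering_contraction by simp

lemma linear_relax: "linear_map_on (dual (VVh_Sigma D)) (dual (VVh_Sigma D)) (relax \<alpha>)"
proof -
  have eq: "relax \<alpha> = (\<lambda>x. cscale (of_real (1 - \<alpha>)) x + cscale (- of_real \<alpha>) (exchange D T (scattering D T x)))"
    by (auto simp: relax_def fun_eq_iff fun_apply)
  show ?thesis
    unfolding eq
    by (rule linear_map_on_combine[OF linear_map_on_id linear_exchange_scattering subspace_dual])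
qed

text \<open>
  The quotients are bounded by 1 because \<open>\<Pi> S\<close> is a contraction; this makes the supremum an
  upper bound.
\<close>

lemma relax_le_Sup:
  assumes \<alpha>: "0 < \<alpha>" "\<alpha> < 1" and x: "x \<in> dual (VVh_Sigma D)"
  shows "tr.dnrm (relax \<alpha> x)
    \<le> (SUP x \<in> dual (VVh_Sigma D) - {0}. tr.dnrm (relax \<alpha> x) / tr.dnrm x) * tr.dnrm x"
proof (cases "x = 0")
  case True
  then have "relax \<alpha> x = 0" using linear_map_on_zero[OF linear_relax subspace_dual] by simp
  then show ?thesis using True tr.dnrm_eq_0[OF tr.dual_zero_mem] by simp
next
  case False
  have pos: "tr.dnrm x > 0" if "x \<in> dual (VVh_Sigma D) - {0}" for x
    using tr.dnrm_eq_0[of x] tr.dnrm_nonneg[of x] that by force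
  have "tr.dnrm (relax \<alpha> x) / tr.dnrm x \<le> 1" if x': "x \<in> dual (VVh_Sigma D) - {0}" for x
  proof -
    have x: "x \<in> dual (VVh_Sigma D)" using x' by blast
    have "tr.dnrm (relax \<alpha> x) \<le> (1 - \<alpha>) * tr.dnrm x + \<alpha> * tr.dnrm (exchange D T (scattering D T x))"
      unfolding relax_def
      using tr.dnrm_triangle_diff[OF tr.dual_scale_mem[OF x] tr.dual_scale_mem[OF exchange_scattering_mem[OF x]], of "of_real (1 - \<alpha>)" "of_real \<alpha>"]
        tr.dnrm_scale[OF x, of "of_real (1 - \<alpha>)"] tr.dnrm_scale[OF exchange_scattering_mem[OF x], of "of_real \<alpha>"] \<alpha>
      by (simp only: norm_of_real)
    also have "\<dots> \<le> (1 - \<alpha>) * tr.dnrm x + \<alpha> * tr.dnrm x"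
      using exchange_scattering_le[OF x] \<alpha> by simp
    also have "\<dots> = tr.dnrm x" by (simp add: algebra_simps)
    finally show ?thesis using pos[OF x'] by simp
  qed
  then have "tr.dnrm (relax \<alpha> x) / tr.dnrm x
      \<le> (SUP x \<in> dual (VVh_Sigma D) - {0}. tr.dnrm (relax \<alpha> x) / tr.dnrm x)"
    using x False by (intro cSUP_upper bdd_aboveI2[where M = 1]) auto
  then show ?thesis using pos[of x] x False by (simp add: pos_divide_le_eq)
qed

subsection \<open>The inexact iteration\<close>

text \<open>
  One step of the inexact iteration is an exact relaxed Richardson step, perturbed by the PCG error
  \<open>proj (S q) - p\<close>.
\<close>

lemma richardson_step:
  assumes q: "q \<in> dual (VVh_Sigma D)" and p: "p \<in> Vh_Sigma D"
  shows "cscale (of_real (1 - \<alpha>)) q + cscale (of_real \<alpha>) (scattering D T q)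
      - cscale (of_real (2 * \<alpha>)) (T (Rop D p)) + cscale (of_real \<alpha>) (gvec D T)
    = relax \<alpha> q + cscale (of_real \<alpha>) (gvec D T)
      + cscale (of_real (2 * \<alpha>)) (T (Rop D (proj (scattering D T q) - p)))"
proof -
  have S: "scattering D T q \<in> dual (VVh_Sigma D)" using linear_map_on_mem[OF linear_scattering q] .
  have eq: "T (Rop D (proj (scattering D T q) - p)) = T (Rop D (proj (scattering D T q))) - T (Rop D p)"
    using proj_mem[OF S] p by (rule linear_map_on_diff[OF linear_TR sub_Vh_Sigma])
  show ?thesis
    unfolding eq by (auto simp: relax_def exchange_def proj_def fun_eq_iff fun_apply algebra_simps)
qed

text \<open>
  With \<open>x n\<close> the norm of the increment \<open>q (Suc n) - q n\<close> and \<open>y n\<close> the norm of the PCG error, the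
  initial guess of PCG is off by at most \<open>x n + y n\<close>, which gives the two-term recurrence. The
  increments and the PCG errors therefore decay geometrically. Together they control the distance to
  the fixed point, because
  \<open>id - relax \<alpha>\<close> is bounded below by \<open>1 - \<rho>\<close>.
\<close>

theorem inexact_iteration_converges:
  fixes \<RR> :: "real^2^2"
  assumes k: "k \<ge> 1" and \<alpha>: "0 < \<alpha>" "\<alpha> < 1"
    and q_0: "q 0 = 0" and p_0: "p 0 = 0"
    and p_step: "\<And>n. p (Suc n) = PCG D T P k (p n) (Rstar D (scattering D T (q n)))"
    and q_step: "\<And>n. q (Suc n) =
        cscale (of_real (1 - \<alpha>)) (q n) + cscale (of_real \<alpha>) (scattering D T (q n))
        - cscale (of_real (2 * \<alpha>)) (T (Rop D (p (Suc n)))) + cscale (of_real \<alpha>) (gvec D T)"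
    and \<rho>: "\<rho> = (SUP x \<in> dual (VVh_Sigma D) - {0}. tr.dnrm (relax \<alpha> x) / tr.dnrm x)"
    and \<epsilon>: "\<epsilon> = 2 * ((sqrt (cond_on (Vh_Sigma D) (\<lambda>\<eta>. P (RTR D T \<eta>))) - 1)
                    / (sqrt (cond_on (Vh_Sigma D) (\<lambda>\<eta>. P (RTR D T \<eta>))) + 1)) ^ k"
    and RR: "\<RR> = vector [vector [\<rho> + 2 * \<epsilon>, 2 * sqrt (\<epsilon> * (1 + \<epsilon>))],
                          vector [2 * sqrt (\<epsilon> * (1 + \<epsilon>)), 2 * \<epsilon>]]"
    and RR_less_1: "onorm ((*v) \<RR>) < 1"
  defines "G \<equiv> \<lambda>x. x + exchange D T (scattering D T x)"
  defines "q_inf \<equiv> inv_into (dual (VVh_Sigma D)) G (gvec D T)"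
  shows "bij_betw G (dual (VVh_Sigma D)) (dual (VVh_Sigma D))"
    and "q_inf \<in> dual (VVh_Sigma D)"
    and "G q_inf = gvec D T"
    and "(\<lambda>n. tr.dnrm (q n - q_inf)) \<longlonglongrightarrow> 0"
    and "tr.dnrm (q n - q_inf) \<le> tr.dnrm (q 1) * onorm ((*v) \<RR>) ^ n / (1 - onorm ((*v) \<RR>))"
proof -
  let ?U = "dual (VVh_Sigma D)" and ?W = "Vh_Sigma D" and ?S = "scattering D T" and ?g = "gvec D T"
  let ?r = "onorm ((*v) \<RR>)"
  have r0: "0 \<le> ?r" by (rule onorm_pos_le[OF matrix_vector_mul_bounded_linear])
  note S_mem = linear_map_on_mem[OF linear_scattering]
  note relax_mem = linear_map_on_mem[OF linear_relax[of \<alpha>]]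
  note TR_mem = linear_map_on_mem[OF linear_TR]
  have relax_le: "tr.dnrm (relax \<alpha> x) \<le> \<rho> * tr.dnrm x" if "x \<in> ?U" for x
    unfolding \<rho> by (rule relax_le_Sup[OF \<alpha> that])
  obtain u0 where "u0 \<in> ?W" "u0 \<noteq> 0" using Vh_Sigma_nontrivial by blast
  from cg.cond_ge_1[OF this] have \<epsilon>0: "0 \<le> \<epsilon>"
    unfolding \<epsilon> by (intro mult_nonneg_nonneg zero_le_power divide_nonneg_nonneg) (auto intro: add_nonneg_nonneg)

  have \<rho>1: "\<rho> < 1"
  proof -
    (* the first diagonal entry is at most the operator norm *)
    let ?e = "vector [1, 0] :: real^2"
    have "(\<RR> *v ?e) $ 1 = \<rho> + 2 * \<epsilon>"
      by (simp add: RR matrix_vector_mult_def sum_2)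
    then have "\<rho> + 2 * \<epsilon> \<le> norm (\<RR> *v ?e)" using component_le_norm_cart[of "\<RR> *v ?e" 1] by simp
    also have "\<dots> \<le> ?r * norm ?e" by (rule onorm[OF matrix_vector_mul_bounded_linear])
    also have "norm ?e = 1" by (simp add: norm_vec_def L2_set_def sum_2)
    finally show ?thesis using RR_less_1 \<epsilon>0 by simp
  qed

  have linG: "linear_map_on ?U ?U G"
  proof -
    have eq: "G = (\<lambda>x. cscale 1 x + cscale 1 (exchange D T (?S x)))"
      by (auto simp: G_def fun_eq_iff fun_apply)
    show ?thesis
      unfolding eq by (rule linear_map_on_combine[OF linear_map_on_id linear_exchange_scattering subspace_dual])
  qed
  have relax_G: "x - relax \<alpha> x = cscale (of_real \<alpha>) (G x)" for x
    by (auto simp: relax_def G_def fun_eq_iff fun_apply algebra_simps)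
  have "inj_on G ?U"
  proof (rule linear_map_on_inj_onI[OF linG subspace_dual])
    fix x assume x: "x \<in> ?U" and "G x = 0"
    then have "x - relax \<alpha> x = 0" using relax_G[of x] fs.scale_zero_right by metis
    then have "tr.dnrm x \<le> \<rho> * tr.dnrm x" using relax_le[OF x] by simp
    then have "(1 - \<rho>) * tr.dnrm x \<le> 0" by (simp add: algebra_simps)
    then have "tr.dnrm x = 0" using \<rho>1 tr.dnrm_nonneg[OF x] by (simp add: mult_le_0_iff)
    then show "x = 0" using tr.dnrm_eq_0[OF x] by simp
  qed
  then show bij: "bij_betw G ?U ?U" by (rule tr.dual_inj_endo_onto[OF linG])
  then have "?g \<in> G ` ?U" using gvec_dual by (simp add: bij_betw_def)
  then show inf: "q_inf \<in> ?U" and Ginf: "G q_inf = ?g"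
    unfolding q_inf_def by (rule inv_into_into, rule f_inv_into_f)

  have mem: "q n \<in> ?U \<and> p n \<in> ?W" for n
  proof (induction n)
    case 0
    then show ?case using q_0 p_0 tr.dual_zero_mem sk.zero_mem by simp
  next
    case (Suc n)
    then have "p (Suc n) \<in> ?W"
      unfolding p_step using PCG_error(1)[OF _ linear_map_on_mem[OF linear_Rstar S_mem] k] by blast
    then show ?case
      unfolding q_step using Suc gvec_dual by (intro conjI tr.dual_mems S_mem TR_mem) auto
  qed
  then have qU: "q n \<in> ?U" and pW: "p n \<in> ?W" for n by auto
  define \<eta> where "\<eta> n = proj (?S (q n))" for n
  define d where "d n = \<eta> n - p (Suc n)" for n
  have \<eta>W: "\<eta> n \<in> ?W" for n unfolding \<eta>_def by (intro proj_mem S_mem qU)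
  have dW: "d n \<in> ?W" for n unfolding d_def by (intro sk.diff_mem \<eta>W pW)
  have cg: "sk.nrm (d n) \<le> \<epsilon> * sk.nrm (\<eta> n - p n)" for n
    using PCG_error(2)[OF pW linear_map_on_mem[OF linear_Rstar S_mem[OF qU]] k, of n n]
    unfolding d_def p_step \<eta>_def proj_def \<epsilon> .
  define c :: complex where "c = of_real (2 * \<alpha>)"
  have c: "cmod c \<le> 2" using \<alpha> by (simp add: c_def)
  have step: "q (Suc n) = relax \<alpha> (q n) + cscale (of_real \<alpha>) ?g + cscale c (T (Rop D (d n)))" for n
    using richardson_step[OF qU[of n] pW[of "Suc n"], of \<alpha>] unfolding q_step[of n] d_def \<eta>_def c_def .
  have TRd: "tr.dnrm (cscale c (T (Rop D v))) \<le> 2 * sk.nrm v" if v: "v \<in> ?W" for v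
  proof -
    have "tr.dnrm (cscale c (T (Rop D v))) = cmod c * sk.nrm v"
      using tr.dnrm_scale[OF TR_mem[OF v]] dnrm_TR[OF v] by simp
    then show ?thesis using mult_right_mono[OF c sk.nrm_nonneg[OF v]] by simp
  qed

  define x where "x n = tr.dnrm (q (Suc n) - q n)" for n
  define y where "y n = sk.nrm (d n)" for n
  have x_nonneg: "0 \<le> x n" for n unfolding x_def by (intro tr.dnrm_nonneg tr.dual_diff_mem qU)
  have y_nonneg: "0 \<le> y n" for n unfolding y_def by (intro sk.nrm_nonneg dW)
  have y_0: "y 0 = 0"
  proof -
    (* the first system has right-hand side 0 and initial guess 0 *)
    have "\<eta> 0 = 0"
      unfolding \<eta>_def q_0 by (simp add: linear_map_on_zero[OF linear_scattering subspace_dual]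
          linear_map_on_zero[OF linear_proj subspace_dual])
    then have "sk.nrm (\<eta> 0 - p 0) = 0" using sk.nrm_zero p_0 by simp
    then show ?thesis using cg[of 0] y_nonneg[of 0] unfolding y_def by simp
  qed
  have y_Suc: "y (Suc n) \<le> \<epsilon> * (x n + y n)" for n
  proof -
    have eq: "\<eta> (Suc n) - \<eta> n = proj (?S (q (Suc n) - q n))"
      unfolding \<eta>_def linear_map_on_diff[OF linear_scattering subspace_dual qU qU]
      by (rule linear_map_on_diff[OF linear_proj subspace_dual S_mem[OF qU] S_mem[OF qU], symmetric])
    have "sk.nrm (\<eta> (Suc n) - \<eta> n) \<le> tr.dnrm (?S (q (Suc n) - q n))"
      unfolding eq by (rule proj_le[OF S_mem[OF tr.dual_diff_mem[OF qU qU]]])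
    also have "\<dots> \<le> x n"
      unfolding x_def by (rule scattering_contraction[OF tr.dual_diff_mem[OF qU qU]])
    finally have e: "sk.nrm (\<eta> (Suc n) - \<eta> n) \<le> x n" .
    have eq2: "\<eta> (Suc n) - p (Suc n) = (\<eta> (Suc n) - \<eta> n) + d n" by (simp add: d_def)
    have "sk.nrm (\<eta> (Suc n) - p (Suc n)) \<le> x n + y n"
      using sk.nrm_triangle[OF sk.diff_mem[OF \<eta>W \<eta>W] dW, of "Suc n" n n] e
      unfolding eq2 y_def by linarith
    then show ?thesis
      using cg[of "Suc n"] mult_left_mono[OF _ \<epsilon>0] unfolding y_def by (meson order_trans)
  qed
  have x_Suc: "x (Suc n) \<le> \<rho> * x n + 2 * (y (Suc n) + y n)" for n
  proof -
    let ?q = "q (Suc n) - q n"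
    let ?D = "cscale c (T (Rop D (d (Suc n)))) - cscale c (T (Rop D (d n)))"
    have eq: "q (Suc (Suc n)) - q (Suc n) = relax \<alpha> ?q + ?D"
      unfolding linear_map_on_diff[OF linear_relax subspace_dual qU qU] step[of "Suc n"]
      by (subst (2) step[of n]) (auto simp: fun_eq_iff fun_apply)
    have D: "tr.dnrm ?D \<le> 2 * y (Suc n) + 2 * y n"
      unfolding y_def
      by (rule order_trans[OF tr.dnrm_triangle_diff add_mono[OF TRd TRd]])
        (intro tr.dual_scale_mem TR_mem dW)+
    have "x (Suc n) \<le> tr.dnrm (relax \<alpha> ?q) + tr.dnrm ?D"
      unfolding x_def eq by (intro tr.dnrm_triangle relax_mem tr.dual_mems qU TR_mem dW)
    also have "\<dots> \<le> \<rho> * x n + (2 * y (Suc n) + 2 * y n)"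
      using relax_le[OF tr.dual_diff_mem[OF qU qU]] D unfolding x_def by (rule add_mono)
    finally show ?thesis by simp
  qed
  have decay: "x n \<le> ?r ^ n * x 0" "y n \<le> ?r ^ n * x 0" for n
    by (rule matrix_recurrence_decay[OF x_nonneg y_nonneg \<epsilon>0 y_0 y_Suc x_Suc RR])+
  have x_0: "x 0 = tr.dnrm (q 1)" by (simp add: x_def q_0)
  have geo: "(\<lambda>n. ?r ^ n * x 0) \<longlonglongrightarrow> 0"
    using LIMSEQ_realpow_zero[OF r0 RR_less_1] by (rule tendsto_mult_left_zero)

  define E where "E n = tr.dnrm (q n - q_inf)" for n
  have eU: "q n - q_inf \<in> ?U" for n by (intro tr.dual_diff_mem qU inf)
  have E_nonneg: "0 \<le> E n" for n unfolding E_def by (rule tr.dnrm_nonneg[OF eU])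
  have E_le: "E n \<le> 3 / (1 - \<rho>) * (?r ^ n * x 0)" for n
  proof -
    let ?e = "q n - q_inf"
    have fix_inf: "relax \<alpha> q_inf = q_inf - cscale (of_real \<alpha>) ?g"
      unfolding Ginf[symmetric] relax_G[symmetric] by simp
    have eq: "?e = relax \<alpha> ?e + ((q n - q (Suc n)) + cscale c (T (Rop D (d n))))"
      unfolding linear_map_on_diff[OF linear_relax subspace_dual qU inf] fix_inf step[of n]
      by (auto simp: fun_eq_iff fun_apply)
    have "tr.dnrm (relax \<alpha> ?e + ((q n - q (Suc n)) + cscale c (T (Rop D (d n)))))
        \<le> tr.dnrm (relax \<alpha> ?e) + tr.dnrm ((q n - q (Suc n)) + cscale c (T (Rop D (d n))))"
      by (intro tr.dnrm_triangle relax_mem eU tr.dual_mems qU TR_mem dW)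
    then have "E n \<le> tr.dnrm (relax \<alpha> ?e) + tr.dnrm ((q n - q (Suc n)) + cscale c (T (Rop D (d n))))"
      unfolding eq[symmetric] E_def .
    moreover have "tr.dnrm ((q n - q (Suc n)) + cscale c (T (Rop D (d n))))
        \<le> tr.dnrm (q n - q (Suc n)) + tr.dnrm (cscale c (T (Rop D (d n))))"
      by (intro tr.dnrm_triangle tr.dual_mems qU TR_mem dW)
    moreover have "tr.dnrm (q n - q (Suc n)) = x n"
      unfolding x_def by (rule tr.dnrm_minus_commute[OF qU qU])
    moreover have "tr.dnrm (relax \<alpha> ?e) \<le> \<rho> * E n"
      unfolding E_def by (rule relax_le[OF eU])
    moreover have "tr.dnrm (cscale c (T (Rop D (d n)))) \<le> 2 * y n"
      unfolding y_def by (rule TRd[OF dW])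
    ultimately have "E n \<le> \<rho> * E n + (x n + 2 * y n)" by linarith
    then have "(1 - \<rho>) * E n \<le> 3 * (?r ^ n * x 0)" using decay[of n] by (simp add: algebra_simps)
    then show ?thesis using \<rho>1 by (simp add: field_simps)
  qed
  have lim: "E \<longlonglongrightarrow> 0"
  proof (rule tendsto_sandwich)
    show "\<forall>\<^sub>F n in sequentially. 0 \<le> E n" by (intro always_eventually allI E_nonneg)
    show "\<forall>\<^sub>F n in sequentially. E n \<le> 3 / (1 - \<rho>) * (?r ^ n * x 0)"
      by (intro always_eventually allI E_le)
    show "(\<lambda>n. 3 / (1 - \<rho>) * (?r ^ n * x 0)) \<longlonglongrightarrow> 0" using geo by (rule tendsto_mult_right_zero)
  qed (rule tendsto_const)
  then show "(\<lambda>n. tr.dnrm (q n - q_inf)) \<longlonglongrightarrow> 0" by (simp only: E_def[abs_def])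
  have E_Suc: "E n \<le> x n + E (Suc n)" for n
  proof -
    have eq: "(q n - q (Suc n)) + (q (Suc n) - q_inf) = q n - q_inf" by (simp add: fun_eq_iff fun_apply)
    have "E n \<le> tr.dnrm (q n - q (Suc n)) + E (Suc n)"
      unfolding E_def using tr.dnrm_triangle[OF tr.dual_diff_mem[OF qU qU] eU, of n "Suc n" "Suc n"] unfolding eq .
    then show ?thesis unfolding x_def tr.dnrm_minus_commute[OF qU qU, of n "Suc n"] .
  qed
  show "tr.dnrm (q n - q_inf) \<le> tr.dnrm (q 1) * ?r ^ n / (1 - ?r)"
    using telescoped_geometric_bound[OF RR_less_1 lim geo E_Suc decay(1), of n] unfolding E_def x_0 .
qed

end

(* The error bound is indexed from the first iterate q 1: the printed bound
   norm (q 0) * r^(n+1) / (1 - r) vanishes for the prescribed start q 0 = 0 and is false unless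
   q_inf = 0. It is the bound below, at n + 1, once the printed q^(n) is read as the iterate
   following the trivial guess. *)
theorem lemma7p1:
  fixes D :: "'a::euclidean_space helmholtz_ddm"
    and T :: "'a transmission_op" and P :: "'a precond"
    and k :: nat and \<alpha> \<rho> \<epsilon> :: real and \<RR> :: "real^2^2"
    and q :: "nat \<Rightarrow> (nat \<times> 'a \<Rightarrow> complex) \<Rightarrow> complex" and p :: "nat \<Rightarrow> 'a \<Rightarrow> complex"
    and q_inf :: "(nat \<times> 'a \<Rightarrow> complex) \<Rightarrow> complex"
  assumes setting: "helmholtz_setting D"
    and T: "hermitian_pos_def (VVh_Sigma D) T"
    and P: "hermitian_pos_def_dual (Vh_Sigma D) P"
    and k: "k \<ge> 1"
    and \<alpha>: "0 < \<alpha>" "\<alpha> < 1"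
    and q_0: "q 0 = 0" and p_0: "p 0 = 0"
    and p_step: "\<And>n. p (Suc n) = PCG D T P k (p n) (Rstar D (scattering D T (q n)))"
    and q_step: "\<And>n. q (Suc n) =
        cscale (of_real (1 - \<alpha>)) (q n) + cscale (of_real \<alpha>) (scattering D T (q n))
        - cscale (of_real (2 * \<alpha>)) (T (Rop D (p (Suc n)))) + cscale (of_real \<alpha>) (gvec D T)"
    and \<rho>: "\<rho> = (SUP x \<in> dual (VVh_Sigma D) - {0}.
        op_norm_dual (VVh_Sigma D) T
          (cscale (of_real (1 - \<alpha>)) x - cscale (of_real \<alpha>) (exchange D T (scattering D T x)))
        / op_norm_dual (VVh_Sigma D) T x)"
    and \<epsilon>: "\<epsilon> = 2 * ((sqrt (cond_on (Vh_Sigma D) (\<lambda>\<eta>. P (RTR D T \<eta>))) - 1)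
                    / (sqrt (cond_on (Vh_Sigma D) (\<lambda>\<eta>. P (RTR D T \<eta>))) + 1)) ^ k"
    and RR: "\<RR> = vector [vector [\<rho> + 2 * \<epsilon>, 2 * sqrt (\<epsilon> * (1 + \<epsilon>))],
                          vector [2 * sqrt (\<epsilon> * (1 + \<epsilon>)), 2 * \<epsilon>]]"
    and RR_less_1: "onorm ((*v) \<RR>) < 1"
    and q_inf: "q_inf = inv_into (dual (VVh_Sigma D))
        (\<lambda>x. x + exchange D T (scattering D T x)) (gvec D T)"
  shows "bij_betw (\<lambda>x. x + exchange D T (scattering D T x))
           (dual (VVh_Sigma D)) (dual (VVh_Sigma D)) \<and>
         q_inf \<in> dual (VVh_Sigma D) \<and>
         q_inf + exchange D T (scattering D T q_inf) = gvec D T \<and>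
         (\<lambda>n. op_norm_dual (VVh_Sigma D) T (q n - q_inf)) \<longlonglongrightarrow> 0 \<and>
         (\<forall>n. op_norm_dual (VVh_Sigma D) T (q n - q_inf)
           \<le> op_norm_dual (VVh_Sigma D) T (q 1) * onorm ((*v) \<RR>) ^ n / (1 - onorm ((*v) \<RR>)))"
proof -
  interpret helmholtz_ddm_ops D T P
    using setting T P by unfold_locales
  note main = inexact_iteration_converges[OF k \<alpha> q_0 p_0 p_step q_step \<rho>[folded relax_def] \<epsilon> RR RR_less_1]
  show ?thesis
    unfolding q_inf using main by blast
qed

end
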